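(* Let $D=(V(D),E(D),w)$ be a vertex-weighted rooted forest such that $w(x)\geq 2$ for every vertex $x$ with $d(x)\neq 1$. Let $I(D)$ be its edge ideal in the polynomial ring $S$ over a field $k$ whose variables are the vertices of $D$. Then $$\operatorname{pd}(I(D)^{t})=|E(D)|-1\quad\text{for all } t\geq 1.$$
   Context: A vertex-weighted oriented graph $D=(V(D),E(D),w)$ is a finite simple graph in which each edge is given exactly one direction ($xy\in E(D)$ denotes the edge directed from $x$ to $y$), together with a weight function $w:V(D)\to\{1,2,3,\ldots\}$. Standing convention: if a vertex $x$ is a source (no edge of $D$ ends at $x$), then $w(x)=1$. The degree $d(x)$ is the degree of $x$ in the underlying undirected graph. A rooted tree is an orientation of a tree in which all edges are oriented away from a distinguished vertex, the root; a rooted forest is a disjoint union of rooted trees. Let $k$ be a field and $V(D)=\{x_1,\ldots,x_n\}$. With $S=k[x_1,\ldots,x_n]$, the edge ideal of $D$ is $I(D)=(x_ix_j^{w(x_j)}\mid x_ix_j\in E(D))\subset S$. $\operatorname{pd}(I)$ denotes the projective dimension of the ideal $I$ as an $S$-module, i.e. $\max\{i\mid \beta_{i,j}(I)\neq 0\text{ for some }j\}$. *)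

theory Defs
  imports
    "HOL-Library.Poly_Mapping"
    "HOL-Library.Disjoint_Sets"
    "Jordan_Normal_Form.Matrix_Kernel"
begin

text \<open>
  Graphs. An oriented graph is given by its vertex set and its set of directed edges, where
  \<open>(x, y) \<in> E\<close> is the edge directed from \<open>x\<close> to \<open>y\<close>.
\<close>

definition oriented_graph :: "'v set \<Rightarrow> ('v \<times> 'v) set \<Rightarrow> bool" where
  "oriented_graph V E \<longleftrightarrow>
     finite V \<and> E \<subseteq> V \<times> V \<and> (\<forall>x. (x, x) \<notin> E) \<and> (\<forall>x y. (x, y) \<in> E \<longrightarrow> (y, x) \<notin> E)"

definition underlying :: "('v \<times> 'v) set \<Rightarrow> ('v \<times> 'v) set" where
  "underlying E = E \<union> E\<inverse>"

definition vdegree :: "('v \<times> 'v) set \<Rightarrow> 'v \<Rightarrow> nat" where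
  "vdegree E x = card {y. (x, y) \<in> underlying E}"

definition is_source :: "('v \<times> 'v) set \<Rightarrow> 'v \<Rightarrow> bool" where
  "is_source E x \<longleftrightarrow> (\<forall>y. (y, x) \<notin> E)"

definition vertex_weighted_oriented_graph ::
    "'v set \<Rightarrow> ('v \<times> 'v) set \<Rightarrow> ('v \<Rightarrow> nat) \<Rightarrow> bool" where
  "vertex_weighted_oriented_graph V E w \<longleftrightarrow>
     oriented_graph V E \<and> (\<forall>x\<in>V. w x \<ge> 1) \<and> (\<forall>x\<in>V. is_source E x \<longrightarrow> w x = 1)"

text \<open>A cycle of the underlying graph, listed by its pairwise distinct vertices.\<close>

definition is_cycle :: "('v \<times> 'v) set \<Rightarrow> 'v list \<Rightarrow> bool" where
  "is_cycle E vs \<longleftrightarrow>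
     length vs \<ge> 3 \<and> distinct vs \<and>
     (\<forall>i < length vs. (vs ! i, vs ! (Suc i mod length vs)) \<in> underlying E)"

definition underlying_tree :: "'v set \<Rightarrow> ('v \<times> 'v) set \<Rightarrow> bool" where
  "underlying_tree V E \<longleftrightarrow>
     V \<noteq> {} \<and> (\<forall>x\<in>V. \<forall>y\<in>V. (x, y) \<in> (underlying E)\<^sup>*) \<and> (\<nexists>vs. is_cycle E vs)"

definition graph_dist :: "('v \<times> 'v) set \<Rightarrow> 'v \<Rightarrow> 'v \<Rightarrow> nat" where
  "graph_dist E x y = (LEAST n. (x, y) \<in> (underlying E) ^^ n)"

text \<open>
  In a rooted tree every edge points away from the root \<open>r\<close>: its head lies farther from \<open>r\<close> (in the
  underlying tree) than its tail.
\<close>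

definition rooted_tree :: "'v set \<Rightarrow> ('v \<times> 'v) set \<Rightarrow> bool" where
  "rooted_tree V E \<longleftrightarrow>
     oriented_graph V E \<and> underlying_tree V E \<and>
     (\<exists>r\<in>V. \<forall>(x, y)\<in>E. graph_dist E r x < graph_dist E r y)"

definition rooted_forest :: "'v set \<Rightarrow> ('v \<times> 'v) set \<Rightarrow> bool" where
  "rooted_forest V E \<longleftrightarrow>
     (\<exists>P. partition_on V P \<and> E \<subseteq> (\<Union>C\<in>P. C \<times> C) \<and> (\<forall>C\<in>P. rooted_tree C (E \<inter> C \<times> C)))"


text \<open>
  The polynomial ring over \<open>'k\<close> in the variables \<open>'v\<close>; a monomial is its exponent vector, and
  multiplication in \<open>'a \<Rightarrow>\<^sub>0 'b\<close> is the convolution product.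
\<close>

type_synonym ('v, 'k) mpoly = "('v \<Rightarrow>\<^sub>0 nat) \<Rightarrow>\<^sub>0 'k"

definition Var :: "'v \<Rightarrow> ('v, 'k::field) mpoly" where
  "Var x = Poly_Mapping.single (Poly_Mapping.single x 1) 1"

definition mdeg :: "('v::finite \<Rightarrow>\<^sub>0 nat) \<Rightarrow> nat" where
  "mdeg m = (\<Sum>x\<in>UNIV. Poly_Mapping.lookup m x)"

definition ideal_gen :: "'a::comm_ring_1 set \<Rightarrow> 'a set" where
  "ideal_gen A = Modules.module.span (*) A"

primrec ideal_power :: "'a::comm_ring_1 set \<Rightarrow> nat \<Rightarrow> 'a set" where
  "ideal_power I 0 = UNIV"
| "ideal_power I (Suc t) = ideal_gen {a * b | a b. a \<in> I \<and> b \<in> ideal_power I t}"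

definition edge_ideal :: "('v \<times> 'v) set \<Rightarrow> ('v \<Rightarrow> nat) \<Rightarrow> ('v, 'k::field) mpoly set" where
  "edge_ideal E w = ideal_gen {Var x * Var y ^ w y | x y. (x, y) \<in> E}"


text \<open>
  Minimal graded free resolutions
  \<open>\<dots> \<rightarrow> F\<^sub>1 \<rightarrow> F\<^sub>0 \<rightarrow> I \<rightarrow> 0\<close> of a homogeneous ideal \<open>I\<close> of \<open>S\<close>. The list \<open>d i\<close> holds the degrees of the
  basis elements of \<open>F\<^sub>i\<close>, that is, \<open>F\<^sub>i\<close> is the direct sum of the \<open>S(-j)\<close> over the entries \<open>j\<close> of \<open>d i\<close>.
  The matrix \<open>\<phi> 0\<close> represents \<open>F\<^sub>0 \<rightarrow> I \<subseteq> S\<close> and \<open>\<phi> (Suc i)\<close> represents \<open>F\<^bsub>i+1\<^esub> \<rightarrow> F\<^sub>i\<close>, acting on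
  column vectors. The resolution is an infinite sequence in which \<open>F\<^sub>i = 0\<close> is \<open>d i = []\<close>.
\<close>

definition mat_image :: "'a::comm_ring_1 mat \<Rightarrow> 'a vec set" where
  "mat_image A = {A *\<^sub>v v | v. v \<in> carrier_vec (dim_col A)}"

definition minimal_graded_free_resolution ::
    "('v::finite, 'k::field) mpoly set \<Rightarrow> (nat \<Rightarrow> nat list) \<Rightarrow> (nat \<Rightarrow> ('v, 'k) mpoly mat) \<Rightarrow> bool"
where
  "minimal_graded_free_resolution I d \<phi> \<longleftrightarrow>
     \<comment> \<open>ranks\<close>
     \<phi> 0 \<in> carrier_mat 1 (length (d 0)) \<and>
     (\<forall>i. \<phi> (Suc i) \<in> carrier_mat (length (d i)) (length (d (Suc i)))) \<and>
     \<comment> \<open>the maps are homogeneous of degree 0\<close>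
     (\<forall>c < length (d 0). \<forall>m \<in> Poly_Mapping.keys (\<phi> 0 $$ (0, c)). mdeg m = d 0 ! c) \<and>
     (\<forall>i. \<forall>r < length (d i). \<forall>c < length (d (Suc i)).
        \<forall>m \<in> Poly_Mapping.keys (\<phi> (Suc i) $$ (r, c)). mdeg m + d i ! r = d (Suc i) ! c) \<and>
     \<comment> \<open>exactness\<close>
     mat_image (\<phi> 0) = {vec 1 (\<lambda>_. f) | f. f \<in> I} \<and>
     (\<forall>i. mat_image (\<phi> (Suc i)) = mat_kernel (\<phi> i)) \<and>
     \<comment> \<open>minimality: all entries lie in the homogeneous maximal ideal\<close>
     (\<forall>i. elements_mat (\<phi> (Suc i)) \<subseteq> ideal_gen (range Var))"

text \<open>
  The graded Betti number \<open>\<beta>\<^bsub>i,j\<^esub>(I)\<close> is the number of copies of \<open>S(-j)\<close> in \<open>F\<^sub>i\<close>. Minimal graded free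
  resolutions are unique up to isomorphism, so the choice of the resolution does not matter.
\<close>

definition graded_betti :: "('v::finite, 'k::field) mpoly set \<Rightarrow> nat \<Rightarrow> nat \<Rightarrow> nat" where
  "graded_betti I i j =
     count_list ((SOME d. \<exists>\<phi>. minimal_graded_free_resolution I d \<phi>) i) j"

text \<open>Meaningful for nonzero homogeneous ideals; there the set is finite and nonempty.\<close>

definition pd :: "('v::finite, 'k::field) mpoly set \<Rightarrow> nat" where
  "pd I = Max {i. \<exists>j. graded_betti I i j \<noteq> 0}"

end

(*
  Let J be the t-th power of the edge ideal I(D). Both bounds come from following Tor(S/J, S/Y) as a
  regular sequence of linear forms is added to Y one element at a time.

  Every root r has degree one; let s be its child. If x_r u and x_s u lie in J, so does the monomial
  u, by an exchange argument on the ways to write a monomial as a product of generators. Hence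
  x_r - x_s is regular modulo J, also after other roots have been identified with their children.
  As these differences form a regular sequence on S/J, adding the remaining |E| variables one at a
  time leaves Tor_i(S/J, k) = 0 for i > |E|.

  For an edge into a leaf, with generator g, one has J : g^(t-1) = I(D). The monomial u with exponent
  w(x) - 1 at every non-root x and 1 at every root is not in I(D), but x u is for every non-root x.
  So u g^(t-1) represents a nonzero element of S/J annihilated by the |E| non-root variables, which
  gives a nonzero class in Tor_|E|(S/J, S/(non-root variables)).

  Minimal resolutions exist because the syzygies of a monomial ideal are multigraded and generated
  in degrees dividing the least common multiple of the generators.
*)
theory Submission
  imports Defs
begin

section \<open>Vanishing of Tor along regular sequences\<close>

text \<open>\<open>pd\<close> is read off a minimal resolution picked by Hilbert choice, so both
  bounds are proved for the matrices of an arbitrary one. Putting the ring in front turns a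
  resolution of J into one of S/J; this shift is the origin of the -1 in |E| - 1. Tor appears only
  as congruences modulo Y between vectors over S, and long exact sequences become explicit chases.

  The weight hypothesis acts twice. A root is a source, hence of weight 1, hence of degree one: it
  has exactly one child, and no vertex is isolated. A non-root with a child has degree at least two,
  hence weight at least 2, which keeps the exponents of the socle monomial positive at every parent.

  Differences x_r - x_s are taken because x_r and x_s are both zero divisors modulo J. There is one
  difference per root and one edge per non-root, so |E| variables remain, each of which may cost one
  homological degree. Every Y is the kernel of an idempotent substitution of variables by variables
  or 0: membership is an equation, and regularity in S is cancellation.\<close>

definition mat_app :: "(nat \<Rightarrow> nat \<Rightarrow> 'a::comm_ring_1) \<Rightarrow> nat \<Rightarrow> (nat \<Rightarrow> 'a) \<Rightarrow> nat \<Rightarrow> 'a" where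
  "mat_app M n v = (\<lambda>r. \<Sum>c<n. M r c * v c)"

lemma mat_app_add: "mat_app M n (\<lambda>c. u c + v c) r = mat_app M n u r + mat_app M n v r"
  by (simp add: mat_app_def algebra_simps sum.distrib)

lemma mat_app_diff: "mat_app M n (\<lambda>c. u c - v c) r = mat_app M n u r - mat_app M n v r"
  by (simp add: mat_app_def algebra_simps sum_subtractf)

lemma mat_app_scale: "mat_app M n (\<lambda>c. y * v c) r = y * mat_app M n v r"
  by (simp add: mat_app_def algebra_simps sum_distrib_left)

lemma mat_app_cong: "(\<And>c. c < n \<Longrightarrow> u c = v c) \<Longrightarrow> mat_app M n u r = mat_app M n v r"
  by (simp add: mat_app_def)

definition is_ideal :: "'a::comm_ring_1 set \<Rightarrow> bool" where
  "is_ideal Y \<longleftrightarrow> 0 \<in> Y \<and> (\<forall>a\<in>Y. \<forall>b\<in>Y. a + b \<in> Y) \<and> (\<forall>a. \<forall>b\<in>Y. a * b \<in> Y)"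

lemma is_idealD:
  assumes "is_ideal Y"
  shows ideal_zero: "0 \<in> Y"
    and ideal_add: "a \<in> Y \<Longrightarrow> b \<in> Y \<Longrightarrow> a + b \<in> Y"
    and ideal_mult: "b \<in> Y \<Longrightarrow> a * b \<in> Y"
  using assms by (auto simp: is_ideal_def)

lemma ideal_uminus: "is_ideal Y \<Longrightarrow> a \<in> Y \<Longrightarrow> - a \<in> Y"
  using ideal_mult[of Y a "-1"] by simp

lemma ideal_diff: "is_ideal Y \<Longrightarrow> a \<in> Y \<Longrightarrow> b \<in> Y \<Longrightarrow> a - b \<in> Y"
  using ideal_add[of Y a "-b"] ideal_uminus[of Y b] by simp

lemma ideal_sum: "is_ideal Y \<Longrightarrow> (\<And>x. x \<in> B \<Longrightarrow> f x \<in> Y) \<Longrightarrow> sum f B \<in> Y"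
  by (induction B rule: infinite_finite_induct) (auto intro: ideal_zero ideal_add)

lemma mat_app_ideal:
  assumes "is_ideal Y" "\<And>c. c < n \<Longrightarrow> v c \<in> Y"
  shows "mat_app M n v r \<in> Y"
  unfolding mat_app_def using assms by (intro ideal_sum ideal_mult) auto

text \<open>
  \<open>G\<^sub>0 = S\<close>, and \<open>A i\<close> is the matrix of \<open>G\<^bsub>i+1\<^esub> \<rightarrow> G\<^sub>i\<close>; vectors are functions of which only the
  values below the rank matter. The complex resolves \<open>S / I\<close>.
\<close>

locale resolution =
  fixes rk :: "nat \<Rightarrow> nat" and A :: "nat \<Rightarrow> nat \<Rightarrow> nat \<Rightarrow> 'a::comm_ring_1" and I :: "'a set"
  assumes outside: "rk i \<le> r \<Longrightarrow> A i r c = 0"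
    and rk_0: "rk 0 = 1"
    and img: "f \<in> I \<longleftrightarrow> (\<exists>u. f = mat_app (A 0) (rk 1) u 0)"
    and complex: "mat_app (A i) (rk (Suc i)) (mat_app (A (Suc i)) (rk (Suc (Suc i))) u) r = 0"
    and exact: "(\<And>r. mat_app (A i) (rk (Suc i)) v r = 0) \<Longrightarrow>
                  \<exists>u. \<forall>c<rk (Suc i). v c = mat_app (A (Suc i)) (rk (Suc (Suc i))) u c"
begin

abbreviation D :: "nat \<Rightarrow> (nat \<Rightarrow> 'a) \<Rightarrow> nat \<Rightarrow> 'a" where
  "D i \<equiv> mat_app (A i) (rk (Suc i))"

text \<open>This says that \<open>Tor\<^bsub>i+1\<^esub>(S/I, S/Y) = 0\<close>.\<close>

definition tor_vanishes :: "'a set \<Rightarrow> nat \<Rightarrow> bool" where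
  "tor_vanishes Y i \<longleftrightarrow>
     (\<forall>v. (\<forall>r. D i v r \<in> Y) \<longrightarrow> (\<exists>u. \<forall>c<rk (Suc i). v c - D (Suc i) u c \<in> Y))"

lemma D_outside: "rk i \<le> r \<Longrightarrow> D i v r = 0"
  by (simp add: mat_app_def outside)

lemma tor_vanishes_zero: "tor_vanishes {0} i"
  unfolding tor_vanishes_def using exact[of i] by simp

text \<open>Chase in the long exact sequence of 0 -> S/Y -> S/Y -> S/Y' -> 0, the first map being
  multiplication by \<open>y\<close>: Tor in degree i+2 over Y' sits between Tor in degrees i+2 and
  i+1 over Y. The inclusions and \<open>split\<close> encode Y' = Y + (y).\<close>

lemma tor_vanishes_step:
  assumes Y: "is_ideal Y" and Y': "is_ideal Y'" "Y \<subseteq> Y'" "y \<in> Y'"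
    and split: "\<And>f. f \<in> Y' \<Longrightarrow> \<exists>a b. b \<in> Y \<and> f = y * a + b"
    and regular: "\<And>a. y * a \<in> Y \<Longrightarrow> a \<in> Y"
    and tor: "tor_vanishes Y i" "tor_vanishes Y (Suc i)"
  shows "tor_vanishes Y' (Suc i)"
  unfolding tor_vanishes_def
proof (intro allI impI)
  fix v assume v: "\<forall>r. D (Suc i) v r \<in> Y'"
  then have "\<forall>r. \<exists>a b. b \<in> Y \<and> D (Suc i) v r = y * a + b"
    using split by blast
  then obtain a b where ab: "\<And>r. b r \<in> Y" "\<And>r. D (Suc i) v r = y * a r + b r"
    by metis
  \<comment> \<open>\<open>a\<close> represents the image of \<open>v\<close> under the connecting
    map; regularity of \<open>y\<close> makes it a cycle modulo Y.\<close>
  have "D i a r \<in> Y" for r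
  proof (rule regular)
    have "0 = D i (\<lambda>r. y * a r + b r) r"
      using complex[of i v r] ab(2) by (metis (no_types, lifting) mat_app_cong)
    then have "y * D i a r = - D i b r"
      by (simp add: mat_app_add mat_app_scale algebra_simps add_eq_0_iff2)
    then show "y * D i a r \<in> Y"
      using mat_app_ideal[OF Y, of _ b] ab(1) ideal_uminus[OF Y] by simp
  qed
  then obtain a' where a': "\<And>c. c < rk (Suc i) \<Longrightarrow> a c - D (Suc i) a' c \<in> Y"
    using tor(1) unfolding tor_vanishes_def by blast
  \<comment> \<open>Subtracting \<open>y * a'\<close>, which is 0 modulo Y', corrects
    \<open>v\<close> to a cycle modulo the smaller ideal Y.\<close>
  have "D (Suc i) (\<lambda>c. v c - y * a' c) r \<in> Y" for r
  proof (cases "r < rk (Suc i)")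
    case True
    have "D (Suc i) (\<lambda>c. v c - y * a' c) r = y * (a r - D (Suc i) a' r) + b r"
      by (simp add: mat_app_diff mat_app_scale ab algebra_simps)
    then show ?thesis
      using a'[OF True] ab(1) ideal_add[OF Y] ideal_mult[OF Y] by simp
  next
    case False
    then show ?thesis using D_outside ideal_zero[OF Y] by simp
  qed
  then obtain u where u: "\<And>c. c < rk (Suc (Suc i)) \<Longrightarrow> v c - y * a' c - D (Suc (Suc i)) u c \<in> Y"
    using tor(2) unfolding tor_vanishes_def by blast
  have "v c - D (Suc (Suc i)) u c \<in> Y'" if "c < rk (Suc (Suc i))" for c
  proof -
    have "v c - D (Suc (Suc i)) u c = a' c * y + (v c - y * a' c - D (Suc (Suc i)) u c)"
      by (simp add: algebra_simps)
    then show ?thesis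
      using u[OF that] Y' ideal_add[OF Y'(1)] ideal_mult[OF Y'(1)] by (metis subsetD)
  qed
  then show "\<exists>u. \<forall>c<rk (Suc (Suc i)). v c - D (Suc (Suc i)) u c \<in> Y'" by blast
qed

text \<open>At the bottom of the sequence the third term is S/(I+Y), which need not vanish.
  Injectivity of \<open>y\<close> on it takes over, and this is what \<open>regular\<close>
  states.\<close>

lemma tor_vanishes_step_0:
  assumes Y: "is_ideal Y" and Y': "is_ideal Y'" "Y \<subseteq> Y'" "y \<in> Y'"
    and split: "\<And>f. f \<in> Y' \<Longrightarrow> \<exists>a b. b \<in> Y \<and> f = y * a + b"
    and regular: "\<And>a f. f \<in> I \<Longrightarrow> y * a - f \<in> Y \<Longrightarrow> \<exists>g\<in>I. a - g \<in> Y"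
    and tor: "tor_vanishes Y 0"
  shows "tor_vanishes Y' 0"
  unfolding tor_vanishes_def
proof (intro allI impI)
  fix v assume v: "\<forall>r. D 0 v r \<in> Y'"
  then obtain a b where ab: "b \<in> Y" "D 0 v 0 = y * a + b"
    using split by blast
  have "D 0 v 0 \<in> I" using img by auto
  moreover have "y * a - D 0 v 0 \<in> Y"
    using ab ideal_uminus[OF Y] by simp
  ultimately obtain g where "g \<in> I" "a - g \<in> Y"
    using regular by blast
  then obtain a' where a': "a - D 0 a' 0 \<in> Y"
    using img[of g] by auto
  have "D 0 (\<lambda>c. v c - y * a' c) r \<in> Y" for r
  proof (cases "r = 0")
    case True
    have "D 0 (\<lambda>c. v c - y * a' c) 0 = y * (a - D 0 a' 0) + b"
      by (simp add: mat_app_diff mat_app_scale ab algebra_simps)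
    then show ?thesis
      using a' ab(1) ideal_add[OF Y] ideal_mult[OF Y] True by simp
  next
    case False
    then show ?thesis using D_outside[of 0 r] rk_0 ideal_zero[OF Y] by simp
  qed
  then obtain u where u: "\<And>c. c < rk (Suc 0) \<Longrightarrow> v c - y * a' c - D (Suc 0) u c \<in> Y"
    using tor unfolding tor_vanishes_def by blast
  have "v c - D (Suc 0) u c \<in> Y'" if "c < rk (Suc 0)" for c
  proof -
    have "v c - D (Suc 0) u c = a' c * y + (v c - y * a' c - D (Suc 0) u c)"
      by (simp add: algebra_simps)
    then show ?thesis
      using u[OF that] Y' ideal_add[OF Y'(1)] ideal_mult[OF Y'(1)] by (metis subsetD)
  qed
  then show "\<exists>u. \<forall>c<rk (Suc 0). v c - D (Suc 0) u c \<in> Y'" by blast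
qed

text \<open>Both maps next to the module of rank \<open>rk (Suc i)\<close> vanish modulo m, so Tor
  is that free module modulo m, and the all-ones vector is a nonzero class in it unless the rank is
  0.\<close>

lemma rank_eq_0_if_tor_vanishes:
  assumes m: "is_ideal m" "1 \<notin> m" and entries: "\<And>r c. A i r c \<in> m" "\<And>r c. A (Suc i) r c \<in> m"
    and tor: "tor_vanishes m i"
  shows "rk (Suc i) = 0"
proof (rule ccontr)
  assume "rk (Suc i) \<noteq> 0"
  have D: "D j v r \<in> m" if "j \<in> {i, Suc i}" for j v r
    unfolding mat_app_def
    using entries that by (intro ideal_sum[OF m(1)]) (auto simp: mult.commute intro: ideal_mult[OF m(1)])
  then obtain u where "\<forall>c<rk (Suc i). 1 - D (Suc i) u c \<in> m"
    using tor[unfolded tor_vanishes_def, rule_format, of "\<lambda>_. 1"] by auto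
  then have "1 - D (Suc i) u 0 + D (Suc i) u 0 \<in> m"
    using \<open>rk (Suc i) \<noteq> 0\<close> D ideal_add[OF m(1)] by blast
  then show False using m(2) by simp
qed

text \<open>
  A class of \<open>Tor\<^sub>j(S/I, S/Y)\<close> annihilated by \<open>X\<close>, for \<open>Y\<close> generated by a regular sequence of length
  \<open>j\<close>, is lifted along the connecting maps that identify this module with \<open>0 :\<^bsub>S/I\<^esub> Y\<close>.
\<close>

definition nonzero_class :: "'a set \<Rightarrow> 'a set \<Rightarrow> nat \<Rightarrow> bool" where
  "nonzero_class X Y j \<longleftrightarrow> (\<exists>v.
     (\<forall>i r. j = Suc i \<longrightarrow> D i v r \<in> Y) \<and>
     \<not> (\<exists>u. \<forall>c<rk j. v c - D j u c \<in> Y) \<and>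
     (\<forall>x\<in>X. \<exists>u. \<forall>c<rk j. x * v c - D j u c \<in> Y))"

text \<open>\<open>y\<close> annihilates the class of \<open>v\<close>, so \<open>y * v\<close> is a
  boundary \<open>D j v'\<close> modulo Y, and \<open>v'\<close> is a preimage of the class under
  the connecting map. Vanishing of Tor in degree j+1 over Y makes that map injective, so
  annihilation by X carries over to \<open>v'\<close>.\<close>

lemma nonzero_class_step:
  assumes Y: "is_ideal Y" and Y': "is_ideal Y'" "Y \<subseteq> Y'" "y \<in> Y'" and y: "y \<in> X"
    and split: "\<And>f. f \<in> Y' \<Longrightarrow> \<exists>a b. b \<in> Y \<and> f = y * a + b"
    and regular: "\<And>a. y * a \<in> Y \<Longrightarrow> a \<in> Y"
    and tor: "tor_vanishes Y j"
    and cls: "nonzero_class X Y j"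
  shows "nonzero_class X Y' (Suc j)"
proof -
  obtain v where cyc: "\<And>i r. j = Suc i \<Longrightarrow> D i v r \<in> Y"
    and nz: "\<And>u. \<exists>c<rk j. v c - D j u c \<notin> Y"
    and ann: "\<And>x. x \<in> X \<Longrightarrow> \<exists>u. \<forall>c<rk j. x * v c - D j u c \<in> Y"
    using cls unfolding nonzero_class_def by blast
  obtain v' where v': "\<And>c. c < rk j \<Longrightarrow> y * v c - D j v' c \<in> Y"
    using ann[OF y] by blast
  have "D j v' r \<in> Y'" for r
  proof (cases "r < rk j")
    case True
    have "D j v' r = v r * y - (y * v r - D j v' r)"
      by (simp add: algebra_simps)
    then show ?thesis
      using v'[OF True] Y' ideal_diff[OF Y'(1)] ideal_mult[OF Y'(1)] by (metis subsetD)
  next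
    case False
    then show ?thesis using D_outside ideal_zero[OF Y'(1)] by simp
  qed
  \<comment> \<open>Were \<open>v'\<close> a boundary modulo Y', applying \<open>D j\<close> would
    make \<open>y * v\<close> congruent to \<open>y * D j a\<close>, and cancelling \<open>y\<close>
    would make \<open>v\<close> a boundary.\<close>
  moreover have "\<exists>c<rk (Suc j). v' c - D (Suc j) u c \<notin> Y'" for u
  proof (rule ccontr)
    assume "\<not> (\<exists>c<rk (Suc j). v' c - D (Suc j) u c \<notin> Y')"
    then have "\<forall>c. \<exists>a b. c < rk (Suc j) \<longrightarrow> b \<in> Y \<and> v' c - D (Suc j) u c = y * a + b"
      using split by meson
    then obtain a b where ab: "\<And>c. c < rk (Suc j) \<Longrightarrow> b c \<in> Y"
      "\<And>c. c < rk (Suc j) \<Longrightarrow> v' c - D (Suc j) u c = y * a c + b c"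
      by metis
    have "v c - D j a c \<in> Y" if c: "c < rk j" for c
    proof (rule regular)
      have "D j (\<lambda>c. v' c - D (Suc j) u c) c = D j (\<lambda>c. y * a c + b c) c"
        by (rule mat_app_cong) (simp add: ab)
      then have "D j v' c = y * D j a c + D j b c"
        using complex[of j u c] by (simp add: mat_app_diff mat_app_add mat_app_scale)
      then have "y * (v c - D j a c) = (y * v c - D j v' c) + D j b c"
        by (simp add: algebra_simps)
      then show "y * (v c - D j a c) \<in> Y"
        using v'[OF c] mat_app_ideal[OF Y ab(1)] ideal_add[OF Y] by simp
    qed
    then show False using nz by blast
  qed
  moreover have "\<exists>u. \<forall>c<rk (Suc j). x * v' c - D (Suc j) u c \<in> Y'" if x: "x \<in> X" for x
  proof -
    obtain a where a: "\<And>c. c < rk j \<Longrightarrow> x * v c - D j a c \<in> Y"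
      using ann[OF x] by blast
    have "D j (\<lambda>c. x * v' c - y * a c) r \<in> Y" for r
    proof (cases "r < rk j")
      case True
      have "D j (\<lambda>c. x * v' c - y * a c) r = y * (x * v r - D j a r) - x * (y * v r - D j v' r)"
        by (simp add: mat_app_diff mat_app_scale algebra_simps)
      then show ?thesis
        using v'[OF True] a[OF True] ideal_diff[OF Y] ideal_mult[OF Y] by simp
    next
      case False
      then show ?thesis using D_outside ideal_zero[OF Y] by simp
    qed
    then obtain u where u: "\<And>c. c < rk (Suc j) \<Longrightarrow> x * v' c - y * a c - D (Suc j) u c \<in> Y"
      using tor unfolding tor_vanishes_def by blast
    have "x * v' c - D (Suc j) u c \<in> Y'" if "c < rk (Suc j)" for c
    proof -
      have "x * v' c - D (Suc j) u c = a c * y + (x * v' c - y * a c - D (Suc j) u c)"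
        by (simp add: algebra_simps)
      then show ?thesis
        using u[OF that] Y' ideal_add[OF Y'(1)] ideal_mult[OF Y'(1)] by (metis subsetD)
    qed
    then show ?thesis by blast
  qed
  ultimately show ?thesis unfolding nonzero_class_def by blast
qed

lemma nonzero_class_0:
  assumes "q \<notin> I" "\<And>x. x \<in> X \<Longrightarrow> x * q \<in> I"
  shows "nonzero_class X {0} 0"
proof -
  have "\<forall>x\<in>X. \<exists>u. x * q - D 0 u 0 = 0"
    using assms(2) img by auto
  moreover have "\<not> (\<exists>u. q - D 0 u 0 = 0)"
    using assms(1) img by auto
  ultimately show ?thesis
    unfolding nonzero_class_def by (intro exI[of _ "\<lambda>_. q"]) (auto simp: rk_0)
qed

lemma rank_nonzero: "nonzero_class X Y j \<Longrightarrow> rk j \<noteq> 0"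
  unfolding nonzero_class_def by auto

end

section \<open>Factorizations of monomials into generators\<close>

text \<open>The two contributions are added so that an edge whose ends have been identified yields
  the exponent w v + 1.\<close>

definition gen_exp :: "('v \<Rightarrow> 'v) \<Rightarrow> ('v \<Rightarrow> nat) \<Rightarrow> 'v \<Rightarrow> 'v \<Rightarrow> nat" where
  "gen_exp q w v x = of_bool (q v = x) + (if v = x then w v else 0)"

definition usage :: "'v set \<Rightarrow> ('v \<Rightarrow> 'v) \<Rightarrow> ('v \<Rightarrow> nat) \<Rightarrow> ('v \<Rightarrow> nat) \<Rightarrow> 'v \<Rightarrow> nat" where
  "usage A q w a x = (\<Sum>v\<in>A. a v * gen_exp q w v x)"

text \<open>
  The edge into \<open>v \<in> A\<close> yields the generator with exponent vector \<open>gen_exp q w v\<close>, where \<open>q v\<close> is the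
  parent of \<open>v\<close>; the case \<open>q v = v\<close> arises when a root is identified with its child. The predicate
  says that the monomial \<open>x\<^sup>m\<close> lies in the \<open>t\<close>-th power of the ideal.
\<close>

definition in_power :: "'v set \<Rightarrow> ('v \<Rightarrow> 'v) \<Rightarrow> ('v \<Rightarrow> nat) \<Rightarrow> nat \<Rightarrow> ('v \<Rightarrow> nat) \<Rightarrow> bool" where
  "in_power A q w t m \<longleftrightarrow> (\<exists>a. sum a A = t \<and> (\<forall>x. usage A q w a x \<le> m x))"

lemma in_power_mono: "in_power A q w t m \<Longrightarrow> (\<And>x. m x \<le> m' x) \<Longrightarrow> in_power A q w t m'"
  unfolding in_power_def using order_trans by blast

lemma in_power_0 [simp]: "in_power A q w 0 m"
  unfolding in_power_def by (intro exI[of _ "\<lambda>_. 0"]) (simp add: usage_def)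

lemma sum_upd:
  fixes f :: "'v \<Rightarrow> nat"
  assumes "finite A" "v \<in> A"
  shows "(\<Sum>u\<in>A. (a(v := k)) u * f u) + a v * f v = (\<Sum>u\<in>A. a u * f u) + k * f v"
proof -
  have "(\<Sum>u\<in>A - {v}. (a(v := k)) u * f u) = (\<Sum>u\<in>A - {v}. a u * f u)"
    by (rule sum.cong) auto
  then show ?thesis
    using assms by (simp add: sum.remove[of A v])
qed

lemma usage_upd:
  assumes "finite A" "v \<in> A"
  shows "usage A q w (a(v := k)) x + a v * gen_exp q w v x = usage A q w a x + k * gen_exp q w v x"
  unfolding usage_def by (rule sum_upd[OF assms])

lemma sum_upd1:
  fixes a :: "'v \<Rightarrow> nat"
  assumes "finite A" "v \<in> A"
  shows "sum (a(v := k)) A + a v = sum a A + k"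
  using sum_upd[OF assms, of a k "\<lambda>_. 1"] by simp

lemma usage_inc:
  assumes "finite A" "v \<in> A"
  shows "usage A q w (a(v := Suc (a v))) x = usage A q w a x + gen_exp q w v x"
  using usage_upd[OF assms, of q w a "Suc (a v)" x] by simp

lemma usage_dec:
  assumes "finite A" "v \<in> A" "a v > 0"
  shows "usage A q w (a(v := a v - 1)) x + gen_exp q w v x = usage A q w a x"
proof -
  have "a v * gen_exp q w v x = (a v - 1) * gen_exp q w v x + gen_exp q w v x"
    using assms(3) by (cases "a v") auto
  then show ?thesis
    using usage_upd[OF assms(1,2), of q w a "a v - 1" x] by linarith
qed

section \<open>Exchange between two factorizations\<close>

definition alloc_dist :: "'v set \<Rightarrow> ('v \<Rightarrow> nat) \<Rightarrow> ('v \<Rightarrow> nat) \<Rightarrow> nat" where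
  "alloc_dist A a b = (\<Sum>v\<in>A. (a v - b v) + (b v - a v))"

lemma alloc_dist_commute: "alloc_dist A a b = alloc_dist A b a"
  unfolding alloc_dist_def by (simp add: add.commute)

lemma alloc_dist_inc:
  assumes "finite A" "v \<in> A" "a v < b v"
  shows "alloc_dist A (a(v := Suc (a v))) b < alloc_dist A a b"
  unfolding alloc_dist_def using assms by (intro sum_strict_mono_ex1) auto

lemma alloc_dist_dec:
  assumes "finite A" "v \<in> A" "b v < a v"
  shows "alloc_dist A (a(v := a v - 1)) b < alloc_dist A a b"
  unfolding alloc_dist_def using assms by (intro sum_strict_mono_ex1) auto

text \<open>The variable v occurs only in the generator of v and in those of its children. With
  agreement at the children, \<open>b\<close> already pays for one more copy of the generator of
  v.\<close>

lemma usage_inc_le: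
  assumes fin: "finite A" and v: "v \<in> A" "a v < b v"
    and agree: "\<And>u. u \<in> A \<Longrightarrow> q u = v \<Longrightarrow> u \<noteq> v \<Longrightarrow> a u = b u"
  shows "usage A q w (a(v := Suc (a v))) v \<le> usage A q w b v"
  unfolding usage_def
proof (rule sum_mono)
  fix u assume "u \<in> A"
  then show "(a(v := Suc (a v))) u * gen_exp q w u v \<le> b u * gen_exp q w u v"
    using v agree[of u] mult_le_mono1[of "Suc (a v)" "b v" "gen_exp q w v v"]
    by (cases "u = v"; cases "q u = v") (auto simp: gen_exp_def)
qed

text \<open>The capacity of the parent p stops \<open>a\<close> from taking one more v. As
  \<open>b\<close> fits under the same capacity with more copies of v, some other generator
  involving p is taken more often by \<open>a\<close>. Trading one of its copies for v keeps p
  within bounds and brings \<open>a\<close> closer to \<open>b\<close>.\<close>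

lemma alloc_swap:
  assumes fin: "finite A" and s: "s \<notin> A"
    and feas: "\<And>x. x \<noteq> s \<Longrightarrow> usage A q w a x \<le> z x" "\<And>x. x \<noteq> s \<Longrightarrow> usage A q w b x \<le> z x"
    and v: "v \<in> A" "a v < b v"
    and agree: "\<And>u. u \<in> A \<Longrightarrow> q u = v \<Longrightarrow> u \<noteq> v \<Longrightarrow> a u = b u"
    and q: "q v \<noteq> v" "q v \<noteq> s" and tight: "z (q v) \<le> usage A q w a (q v)"
  shows "\<exists>a'. sum a' A = sum a A \<and> (\<forall>x. x \<noteq> s \<longrightarrow> usage A q w a' x \<le> z x) \<and>
            usage A q w a' s \<le> usage A q w a s \<and> alloc_dist A a' b < alloc_dist A a b"
proof -
  define p where "p = q v"
  have "\<exists>v'\<in>A. v' \<noteq> v \<and> b v' < a v' \<and> gen_exp q w v' p > 0"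
  proof (rule ccontr)
    assume "\<not> ?thesis"
    then have *: "a u * gen_exp q w u p \<le> b u * gen_exp q w u p" if "u \<in> A" for u
      using that v(2) by (cases "u = v"; cases "b u < a u") auto
    have "usage A q w a p < usage A q w b p"
      unfolding usage_def using fin * v
      by (intro sum_strict_mono_ex1) (auto simp: p_def gen_exp_def intro!: bexI[of _ v])
    then show False
      using tight feas(2)[OF q(2)] by (simp add: p_def)
  qed
  then obtain v' where v': "v' \<in> A" "v' \<noteq> v" "b v' < a v'" "gen_exp q w v' p > 0"
    by blast
  define a1 where "a1 = a(v := Suc (a v))"
  define a' where "a' = a1(v' := a1 v' - 1)"
  have a1v': "a1 v' = a v'" using v' by (simp add: a1_def)
  have use': "usage A q w a' x + gen_exp q w v' x = usage A q w a x + gen_exp q w v x" for x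
    using usage_dec[OF fin v'(1), of a1 q w x] usage_inc[OF fin v(1), of q w a x] v'(3)
    by (simp add: a'_def a1_def v'(2))
  have genv: "gen_exp q w v x = 0" if "x \<noteq> v" "x \<noteq> p" for x
    using that by (simp add: gen_exp_def p_def)
  have "sum a1 A = sum a A + 1"
    using sum_upd1[OF fin v(1), of a "Suc (a v)"] by (simp add: a1_def)
  moreover have "sum a' A + a1 v' = sum a1 A + (a1 v' - 1)"
    using sum_upd1[OF fin v'(1), of a1 "a1 v' - 1"] by (simp add: a'_def)
  ultimately have "sum a' A = sum a A" using v'(3) a1v' by simp
  moreover have "usage A q w a' x \<le> z x" if x: "x \<noteq> s" for x
  proof (cases "x = v")
    case True
    have "usage A q w a' v \<le> usage A q w a1 v"
      using usage_dec[OF fin v'(1), of a1 q w v] v'(3) a1v' by (simp add: a'_def)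
    also have "\<dots> \<le> usage A q w b v"
      unfolding a1_def by (rule usage_inc_le[where a = a and b = b, OF fin v agree])
    finally show ?thesis using feas(2)[OF x] True by simp
  next
    case False
    show ?thesis
    proof (cases "x = p")
      case True
      then have "gen_exp q w v x = 1" using q by (simp add: gen_exp_def p_def)
      then show ?thesis using use'[of x] v'(4) feas(1)[OF x] True by simp
    next
      case False
      then show ?thesis using use'[of x] genv[of x] feas(1)[OF x] \<open>x \<noteq> v\<close> by simp
    qed
  qed
  moreover have "usage A q w a' s \<le> usage A q w a s"
    using use'[of s] genv[of s] s v q by (metis add_leD1 add_cancel_right_right p_def order_refl)
  moreover have "alloc_dist A a' b < alloc_dist A a b"
    using alloc_dist_inc[where a = a and b = b, OF fin v] 
      alloc_dist_dec[where a = a1 and b = b, OF fin v'(1)] v'(3) a1v'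
    by (simp add: a'_def a1_def)
  ultimately show ?thesis by blast
qed

lemma ex_max_nat:
  fixes h :: "'v \<Rightarrow> nat"
  assumes "finite B" "B \<noteq> {}"
  shows "\<exists>v\<in>B. \<forall>u\<in>B. h u \<le> h v"
proof -
  have "Max (h ` B) \<in> h ` B" using assms by (intro Max_in) auto
  then obtain v where "v \<in> B" "Max (h ` B) = h v" by blast
  then show ?thesis using assms Max_ge[of "h ` B"] by (intro bexI[of _ v]) auto
qed

text \<open>
  The deepest vertex where \<open>a\<close> and \<open>b\<close> differ either lets \<open>a\<close> grow or allows \<open>a\<close> or \<open>b\<close> to be moved
  towards the other.
\<close>

lemma alloc_exchange:
  assumes fin: "finite A" and s: "s \<notin> A"
    and height: "\<And>v. v \<in> A \<Longrightarrow> q v \<noteq> v \<Longrightarrow> h (q v) < (h v :: nat)"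
    and "\<And>x. x \<noteq> s \<Longrightarrow> usage A q w a x \<le> z x" "\<And>x. x \<noteq> s \<Longrightarrow> usage A q w b x \<le> z x"
    and "sum a A < sum b A"
  shows "\<exists>c. sum c A = Suc (sum a A) \<and> (\<forall>x. x \<noteq> s \<longrightarrow> usage A q w c x \<le> z x) \<and>
           usage A q w c s \<le> Suc (usage A q w a s)"
  using assms(4-)
proof (induction "alloc_dist A a b" arbitrary: a b rule: less_induct)
  case less
  note feas = less.prems(1,2)
  have "\<exists>v\<in>A. a v \<noteq> b v"
    using less.prems(3) by (metis less_irrefl sum.cong)
  then obtain v where v: "v \<in> A" "a v \<noteq> b v"
    and "\<And>u. u \<in> A \<Longrightarrow> a u \<noteq> b u \<Longrightarrow> h u \<le> h v"
    using fin ex_max_nat[of "{v\<in>A. a v \<noteq> b v}" h] by auto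
  \<comment> \<open>A child of \<open>v\<close> lies strictly deeper, so maximality of
    \<open>v\<close> forces agreement there.\<close>
  then have agree: "a u = b u" if "u \<in> A" "q u = v" "u \<noteq> v" for u
    using that height[of u] by fastforce
  have gen0: "gen_exp q w v x = 0" if "x \<noteq> v" "x \<noteq> q v" for x
    using that by (simp add: gen_exp_def)
  have sv: "s \<noteq> v" using v s by auto
  consider "a v < b v" | "b v < a v" using v(2) by linarith
  then show ?case
  proof cases
    case 1
    let ?c = "a(v := Suc (a v))"
    have le: "usage A q w ?c v \<le> z v"
      using usage_inc_le[where a = a and b = b and q = q and w = w, OF fin v(1) 1] agree feas(2)[of v] sv
      by (metis order_trans)
    have sum: "sum ?c A = Suc (sum a A)"
      using sum_upd1[OF fin v(1), of a "Suc (a v)"] by simp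
    \<comment> \<open>Either the parent does not obstruct (it is \<open>v\<close> itself, it is the
      uncapped s, or it has room) and \<open>a\<close> grows at once, or a swap shortens the
      distance. Growing raises the usage of s by one if the parent is s, and not at all
      otherwise.\<close>
    show ?thesis
    proof (cases "q v = v \<or> q v = s \<or> usage A q w a (q v) < z (q v)")
      case True
      have "usage A q w ?c x \<le> z x" if "x \<noteq> s" for x
        using le True feas(1)[OF that] gen0[of x] that
        by (cases "x = v"; cases "x = q v") (auto simp: usage_inc[OF fin v(1)] gen_exp_def)
      moreover have "usage A q w ?c s \<le> Suc (usage A q w a s)"
        using sv by (simp add: usage_inc[OF fin v(1)] gen_exp_def)
      ultimately show ?thesis using sum by blast
    next
      case False
      then have "\<exists>a'. sum a' A = sum a A \<and> (\<forall>x. x \<noteq> s \<longrightarrow> usage A q w a' x \<le> z x) \<and>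
            usage A q w a' s \<le> usage A q w a s \<and> alloc_dist A a' b < alloc_dist A a b"
        using alloc_swap[where a = a and b = b and q = q and w = w and z = z, OF fin s feas v(1) 1]
          agree by auto
      then obtain a' where a': "sum a' A = sum a A" "\<And>x. x \<noteq> s \<Longrightarrow> usage A q w a' x \<le> z x"
        "usage A q w a' s \<le> usage A q w a s" "alloc_dist A a' b < alloc_dist A a b"
        by blast
      then obtain c where c: "sum c A = Suc (sum a' A)" "\<forall>x. x \<noteq> s \<longrightarrow> usage A q w c x \<le> z x"
        "usage A q w c s \<le> Suc (usage A q w a' s)"
        using less.hyps[OF a'(4,2) feas(2)] less.prems(3) by auto
      then have "usage A q w c s \<le> Suc (usage A q w a s)"
        using a'(3) by linarith
      then show ?thesis
        using c(1,2) a'(1) by auto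
    qed
  next
    case 2
    \<comment> \<open>Here \<open>b\<close> moves towards \<open>a\<close>, by growing or by a swap
      with the roles exchanged. Its total never drops, so the induction hypothesis still
      applies.\<close>
    have "\<exists>b'. sum b A \<le> sum b' A \<and> (\<forall>x. x \<noteq> s \<longrightarrow> usage A q w b' x \<le> z x) \<and>
            alloc_dist A b' a < alloc_dist A b a"
    proof (cases "q v = v \<or> q v = s \<or> usage A q w b (q v) < z (q v)")
      case True
      let ?c = "b(v := Suc (b v))"
      have le: "usage A q w ?c v \<le> z v"
        using usage_inc_le[where a = b and b = a, OF fin v(1) 2] agree feas(1)[of v] sv
        by (metis order_trans)
      have "usage A q w ?c x \<le> z x" if "x \<noteq> s" for x
        using le True feas(2)[OF that] gen0[of x] that
        by (cases "x = v"; cases "x = q v") (auto simp: usage_inc[OF fin v(1)] gen_exp_def)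
      moreover have "sum b A \<le> sum ?c A"
        using sum_upd1[OF fin v(1), of b "Suc (b v)"] by simp
      moreover have "alloc_dist A ?c a < alloc_dist A b a"
        by (rule alloc_dist_inc[where a = b and b = a, OF fin v(1) 2])
      ultimately show ?thesis by blast
    next
      case False
      then show ?thesis
        using alloc_swap[where a = b and b = a and q = q and w = w and z = z,
            OF fin s feas(2) feas(1) v(1) 2] agree
        by (metis not_le_imp_less order_refl)
    qed
    then obtain b' where b': "sum b A \<le> sum b' A" "\<And>x. x \<noteq> s \<Longrightarrow> usage A q w b' x \<le> z x"
      "alloc_dist A a b' < alloc_dist A a b"
      by (metis alloc_dist_commute)
    then have "sum a A < sum b' A" using less.prems(3) by linarith
    then show ?thesis
      using less.hyps[OF b'(3) feas(1) b'(2)] by auto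
  qed
qed

text \<open>Take factorizations \<open>a\<close> of x_r z and \<open>b\<close> of x_s z; only the
  edge into s uses r. If \<open>a\<close> has one copy of this edge too many for z, then
  \<open>b\<close> has more factors off this edge, and the exchange supplies \<open>a\<close> with
  one more factor there. It replaces the surplus copy: it costs at most one x_s, while the removed
  copy frees w s >= 1 of them.\<close>

lemma in_power_root_regular:
  assumes fin: "finite A" and height: "\<And>v. v \<in> A \<Longrightarrow> q v \<noteq> v \<Longrightarrow> h (q v) < (h v :: nat)"
    and w: "w s \<ge> 1" and r: "r \<notin> A" and s: "s \<in> A" "q s = r"
    and only: "\<And>v. v \<in> A \<Longrightarrow> q v = r \<Longrightarrow> v = s"
    and zr: "in_power A q w t (\<lambda>x. z x + of_bool (x = r))"
    and zs: "in_power A q w t (\<lambda>x. z x + of_bool (x = s))"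
  shows "in_power A q w t z"
proof -
  obtain a where a: "sum a A = t" "\<And>x. usage A q w a x \<le> z x + of_bool (x = r)"
    using zr unfolding in_power_def by blast
  obtain b where b: "sum b A = t" "\<And>x. usage A q w b x \<le> z x + of_bool (x = s)"
    using zs unfolding in_power_def by blast
  have rs: "r \<noteq> s" using r s by auto
  \<comment> \<open>Without its edge, s lies outside the index set, as the exchange requires; the
    capacity at s is checked separately at the end.\<close>
  define A' where "A' = A - {s}"
  have A': "finite A'" "s \<notin> A'" using fin by (auto simp: A'_def)
  have split: "usage A q w c x = usage A' q w c x + c s * gen_exp q w s x" for c x
    unfolding usage_def A'_def using fin s by (simp add: sum.remove[of A s])
  have split': "sum c A = sum c A' + c s" for c :: "'a \<Rightarrow> nat"
    unfolding A'_def using fin s by (simp add: sum.remove[of A s])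
  have gens: "gen_exp q w s x = (if x = r then 1 else if x = s then w s else 0)" for x
    using s rs by (simp add: gen_exp_def)
  have A'r: "usage A' q w c r = 0" for c
    unfolding usage_def A'_def using only r by (intro sum.neutral) (auto simp: gen_exp_def)
  show ?thesis
  proof (cases "a s \<le> z r")
    case True
    then have "usage A q w a x \<le> z x" for x
      using a(2)[of x] A'r by (cases "x = r") (auto simp: split gens)
    then show ?thesis unfolding in_power_def using a(1) by blast
  next
    case False
    have as: "a s = Suc (z r)"
      using a(2)[of r] False A'r by (simp add: split gens)
    have bs: "b s \<le> z r"
      using b(2)[of r] A'r rs by (simp add: split gens)
    have "usage A' q w a x \<le> z x" if "x \<noteq> s" for x
      using a(2)[of x] that A'r by (cases "x = r") (auto simp: split gens)
    moreover have "usage A' q w b x \<le> z x" if "x \<noteq> s" for x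
      using b(2)[of x] that A'r by (cases "x = r") (auto simp: split gens)
    moreover have "sum a A' < sum b A'"
      using a(1) b(1) as bs by (simp add: split')
    ultimately obtain c where c: "sum c A' = Suc (sum a A')" "\<And>x. x \<noteq> s \<Longrightarrow> usage A' q w c x \<le> z x"
      "usage A' q w c s \<le> Suc (usage A' q w a s)"
      using alloc_exchange[OF A', of q h w a z b] height unfolding A'_def by auto
    let ?c = "c(s := z r)"
    have c': "usage A' q w ?c x = usage A' q w c x" for x
      unfolding usage_def using A'(2) by (intro sum.cong) auto
    have "sum ?c A' = sum c A'"
      using A'(2) by (intro sum.cong) auto
    then have "sum ?c A = t"
      using a(1) c(1) as by (simp add: split')
    moreover have "usage A q w ?c x \<le> z x" for x
    proof (cases "x = s")
      case True
      have "usage A' q w a s + Suc (z r) * w s \<le> z s"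
        using a(2)[of s] as rs by (simp add: split gens)
      then show ?thesis
        using c(3) w rs True by (simp add: split c' gens del: fun_upd_apply) simp
    next
      case False
      then show ?thesis
        using c(2)[of x] A'r by (auto simp: split c' gens)
    qed
    ultimately show ?thesis unfolding in_power_def by blast
  qed
qed

section \<open>Colon by a leaf generator and the socle monomial\<close>

lemma in_power_leaf_cancel:
  assumes fin: "finite A" and v: "v \<in> A" "q v \<noteq> v" and leaf: "\<And>u. u \<in> A \<Longrightarrow> q u \<noteq> v"
    and pow: "in_power A q w (Suc t) (\<lambda>x. m x + gen_exp q w v x)"
  shows "in_power A q w t m"
proof -
  obtain a where a: "sum a A = Suc t" "\<And>x. usage A q w a x \<le> m x + gen_exp q w v x"
    using pow unfolding in_power_def by blast
  have "\<exists>u\<in>A. a u > 0 \<and> (\<forall>x. usage A q w a x \<le> m x + gen_exp q w u x)"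
  proof (cases "a v > 0")
    case True
    then show ?thesis using a(2) v by blast
  next
    case False
    have "usage A q w a v = 0"
      unfolding usage_def using leaf False by (intro sum.neutral) (auto simp: gen_exp_def)
    then have *: "usage A q w a x \<le> m x" if "x \<noteq> q v" for x
      using a(2)[of x] that by (cases "x = v") (auto simp: gen_exp_def)
    have **: "usage A q w a (q v) \<le> Suc (m (q v))"
      using a(2)[of "q v"] v by (simp add: gen_exp_def)
    show ?thesis
    proof (cases "usage A q w a (q v) = 0")
      case True
      obtain u where "u \<in> A" "a u > 0"
        using a(1) by (metis sum.neutral gr0I nat.distinct(1))
      moreover have "usage A q w a x \<le> m x + gen_exp q w u x" for x
        using * True by (cases "x = q v") (auto intro: trans_le_add1)
      ultimately show ?thesis by blast
    next
      case False
      then obtain u where u: "u \<in> A" "a u * gen_exp q w u (q v) \<noteq> 0"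
        unfolding usage_def by (meson sum.neutral)
      moreover have "usage A q w a x \<le> m x + gen_exp q w u x" for x
        using *[of x] ** u(2) by (cases "x = q v") auto
      ultimately show ?thesis by auto
    qed
  qed
  then obtain u where u: "u \<in> A" "a u > 0" "\<And>x. usage A q w a x \<le> m x + gen_exp q w u x"
    by blast
  have "sum (a(u := a u - 1)) A = t"
    using sum_upd1[OF fin u(1), of a "a u - 1"] a(1) u(2) by simp
  moreover have "usage A q w (a(u := a u - 1)) x \<le> m x" for x
    using usage_dec[where a = a, OF fin u(1,2), of q w x] u(3)[of x] by simp
  ultimately show ?thesis unfolding in_power_def by blast
qed

lemma in_power_Suc_gen:
  assumes "finite A" "v \<in> A" "in_power A q w t m"
  shows "in_power A q w (Suc t) (\<lambda>x. m x + gen_exp q w v x)"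
proof -
  obtain a where a: "sum a A = t" "\<And>x. usage A q w a x \<le> m x"
    using assms(3) unfolding in_power_def by blast
  have "sum (a(v := Suc (a v))) A = Suc t"
    using sum_upd1[OF assms(1,2), of a "Suc (a v)"] a(1) by simp
  moreover have "usage A q w (a(v := Suc (a v))) x \<le> m x + gen_exp q w v x" for x
    using a(2) by (simp add: usage_inc[OF assms(1,2)])
  ultimately show ?thesis unfolding in_power_def by blast
qed

lemma in_power_Suc_cases:
  assumes "finite A" "in_power A q w (Suc t) m"
  shows "\<exists>v\<in>A. \<exists>m'. in_power A q w t m' \<and> (\<forall>x. m x = m' x + gen_exp q w v x)"
proof -
  obtain a where a: "sum a A = Suc t" "\<And>x. usage A q w a x \<le> m x"
    using assms(2) unfolding in_power_def by blast
  obtain v where v: "v \<in> A" "a v > 0"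
    using a(1) by (metis sum.neutral gr0I nat.distinct(1))
  have u: "usage A q w (a(v := a v - 1)) x + gen_exp q w v x \<le> m x" for x
    using usage_dec[where a = a, OF assms(1) v, of q w x] a(2)[of x] by simp
  have "sum (a(v := a v - 1)) A = t"
    using sum_upd1[OF assms(1) v(1), of a "a v - 1"] a(1) v(2) by simp
  moreover have "usage A q w (a(v := a v - 1)) x \<le> m x - gen_exp q w v x" for x
    using u[of x] by linarith
  ultimately have "in_power A q w t (\<lambda>x. m x - gen_exp q w v x)"
    unfolding in_power_def by blast
  moreover have "m x = m x - gen_exp q w v x + gen_exp q w v x" for x
    using u[of x] by linarith
  ultimately show ?thesis
    using v(1) by (intro bexI[of _ v] exI[of _ "\<lambda>x. m x - gen_exp q w v x"]) auto
qed

lemma in_power_add_iff: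
  assumes fin: "finite A" and v: "v \<in> A" "q v \<noteq> v" and leaf: "\<And>u. u \<in> A \<Longrightarrow> q u \<noteq> v"
  shows "in_power A q w (k + t) (\<lambda>x. m x + k * gen_exp q w v x) \<longleftrightarrow> in_power A q w t m"
proof (induction k)
  case (Suc k)
  have eq: "(\<lambda>x. m x + Suc k * gen_exp q w v x) = (\<lambda>x. (m x + k * gen_exp q w v x) + gen_exp q w v x)"
    by (simp add: algebra_simps)
  have "in_power A q w (Suc (k + t)) (\<lambda>x. (m x + k * gen_exp q w v x) + gen_exp q w v x) \<longleftrightarrow>
      in_power A q w (k + t) (\<lambda>x. m x + k * gen_exp q w v x)" (is "?L \<longleftrightarrow> ?R")
  proof
    show "?L \<Longrightarrow> ?R" by (rule in_power_leaf_cancel[where q = q and w = w, OF fin v leaf])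
    show "?R \<Longrightarrow> ?L" by (rule in_power_Suc_gen[where q = q and w = w, OF fin v(1)])
  qed
  then show ?case
    unfolding eq add_Suc using Suc by simp
qed simp

text \<open>The monomial for \<open>t = 1\<close> is the top degree of the Taylor complex, lowered by one in each
  variable outside the roots.\<close>

lemma socle_exists:
  assumes fin: "finite A" and v: "v \<in> A" "q v \<noteq> v" and leaf: "\<And>u. u \<in> A \<Longrightarrow> q u \<noteq> v"
    and w: "\<And>v. v \<in> A \<Longrightarrow> w v \<ge> 1" and q: "\<And>v. v \<in> A \<Longrightarrow> q v \<noteq> v"
    and inner: "\<And>v. v \<in> A \<Longrightarrow> q v \<in> A \<Longrightarrow> w (q v) \<ge> 2"
    and t: "t \<ge> 1"
  shows "\<exists>u. \<not> in_power A q w t u \<and> (\<forall>x\<in>A. in_power A q w t (\<lambda>y. u y + of_bool (y = x)))"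
proof -
  define u where "u x = (if x \<in> A then w x - 1 else 1)" for x
  have one: "in_power A q w 1 m \<longleftrightarrow> (\<exists>v\<in>A. \<forall>x. gen_exp q w v x \<le> m x)" for m
  proof
    assume "in_power A q w 1 m"
    then obtain v m' where "v \<in> A" "\<forall>x. m x = m' x + gen_exp q w v x"
      using in_power_Suc_cases[OF fin, of q w 0 m] by auto
    then show "\<exists>v\<in>A. \<forall>x. gen_exp q w v x \<le> m x"
      by (intro bexI[of _ v]) auto
  next
    assume "\<exists>v\<in>A. \<forall>x. gen_exp q w v x \<le> m x"
    then obtain v where v: "v \<in> A" "\<And>x. gen_exp q w v x \<le> m x" by blast
    then have "in_power A q w (Suc 0) (\<lambda>x. 0 + gen_exp q w v x)"
      using in_power_Suc_gen[OF fin v(1), of q w 0 "\<lambda>_. 0"] by simp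
    then show "in_power A q w 1 m"
      using in_power_mono v(2) by fastforce
  qed
  have "\<not> in_power A q w 1 u"
  proof
    assume "in_power A q w 1 u"
    then obtain v where v: "v \<in> A" "\<And>x. gen_exp q w v x \<le> u x" using one by blast
    then have "w v \<le> w v - 1" using v(2)[of v] by (simp add: u_def gen_exp_def)
    then show False using w[OF v(1)] by simp
  qed
  moreover have "in_power A q w 1 (\<lambda>y. u y + of_bool (y = x))" if x: "x \<in> A" for x
    unfolding one
  \<comment> \<open>One more x raises its exponent to w x, so the generator of x divides: its parent
    has exponent at least 1 in \<open>u\<close>, a root by definition and a non-root because its
    weight is at least 2.\<close>
  proof (intro bexI[of _ x] allI)
    fix y show "gen_exp q w x y \<le> u y + of_bool (y = x)"
      using x w[OF x] q[OF x] inner[OF x] by (auto simp: gen_exp_def u_def)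
  qed (rule x)
  \<comment> \<open>k = t - 1; multiplying by the k-th power of the leaf generator transports the
    case t = 1 to t.\<close>
  moreover obtain k where k: "t = k + 1" using t by (metis add.commute le_Suc_ex)
  moreover have "(\<lambda>y. u y + k * gen_exp q w v y + of_bool (y = x)) =
      (\<lambda>y. u y + of_bool (y = x) + k * gen_exp q w v y)" for x
    by (simp add: ac_simps)
  ultimately show ?thesis
    using in_power_add_iff[where q = q and w = w and k = k and t = 1, OF fin v leaf]
    by (intro exI[of _ "\<lambda>x. u x + k * gen_exp q w v x"]) (simp add: k)
qed

section \<open>Monomial ideals and substitution homomorphisms\<close>

abbreviation keys :: "('a \<Rightarrow>\<^sub>0 'b::zero) \<Rightarrow> 'a set" where "keys \<equiv> Poly_Mapping.keys"

abbreviation lookup :: "('a \<Rightarrow>\<^sub>0 'b::zero) \<Rightarrow> 'a \<Rightarrow> 'b" where "lookup \<equiv> Poly_Mapping.lookup"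

lemma module_mult: "Modules.module ((*) :: 'a::comm_ring_1 \<Rightarrow> 'a \<Rightarrow> 'a)"
  by unfold_locales (auto simp: algebra_simps)

lemma is_ideal_iff_subspace: "is_ideal Y \<longleftrightarrow> Modules.module.subspace (*) Y"
  unfolding is_ideal_def Modules.module.subspace_def[OF module_mult] by auto

lemma ideal_gen_superset: "A \<subseteq> ideal_gen A"
  unfolding ideal_gen_def by (rule Modules.module.span_superset[OF module_mult])

lemma is_ideal_ideal_gen: "is_ideal (ideal_gen A)"
  unfolding ideal_gen_def is_ideal_iff_subspace by (rule Modules.module.subspace_span[OF module_mult])

lemma ideal_gen_minimal: "A \<subseteq> Y \<Longrightarrow> is_ideal Y \<Longrightarrow> ideal_gen A \<subseteq> Y"
  unfolding ideal_gen_def is_ideal_iff_subspace by (rule Modules.module.span_minimal[OF module_mult])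

lemma poly_mapping_sum_singles: "f = (\<Sum>m\<in>keys f. Poly_Mapping.single m (lookup f m))"
proof (rule poly_mapping_eqI)
  fix k
  have "(\<Sum>m\<in>keys f. lookup f m when m = k) = (\<Sum>m\<in>keys f \<inter> {k}. lookup f m)"
    by (auto simp: when_def sum.inter_restrict intro!: sum.cong)
  also have "\<dots> = lookup f k"
    by (cases "k \<in> keys f") (auto simp: in_keys_iff)
  finally show "lookup f k = lookup (\<Sum>m\<in>keys f. Poly_Mapping.single m (lookup f m)) k"
    by (simp add: lookup_sum lookup_single)
qed

lemma mpoly_induct [case_names zero single add]:
  fixes f :: "'m \<Rightarrow>\<^sub>0 'k::comm_monoid_add"
  assumes "P 0" and "\<And>m c. P (Poly_Mapping.single m c)"
    and add: "\<And>f g. P f \<Longrightarrow> P g \<Longrightarrow> P (f + g)"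
  shows "P f"
proof -
  have "P (\<Sum>m\<in>K. Poly_Mapping.single m (lookup f m))" if "finite K" for K
    using that by (induction K) (auto intro: assms)
  then show ?thesis
    using poly_mapping_sum_singles[of f] finite_keys[of f] by metis
qed

lemma lookup_single_mult_add:
  fixes f :: "('m::cancel_comm_monoid_add) \<Rightarrow>\<^sub>0 'k::comm_ring_1"
  shows "lookup (Poly_Mapping.single m c * f) (m + k) = c * lookup f k"
proof (induction f rule: mpoly_induct)
  case (single m' d)
  then show ?case by (simp add: mult_single lookup_single when_def)
qed (simp_all add: lookup_add algebra_simps)

lemma lookup_single_mult_eq_0:
  fixes f :: "('m::cancel_comm_monoid_add) \<Rightarrow>\<^sub>0 'k::comm_ring_1"
  assumes "\<nexists>k'. k = m + k'"
  shows "lookup (Poly_Mapping.single m c * f) k = 0"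
proof (induction f rule: mpoly_induct)
  case (single m' d)
  then show ?case using assms by (auto simp: mult_single lookup_single when_def)
qed (simp_all add: lookup_add algebra_simps)

lemma monom_diff_add:
  fixes m k :: "'v \<Rightarrow>\<^sub>0 nat"
  assumes "\<And>x. lookup m x \<le> lookup k x"
  shows "k = m + (k - m)"
  by (rule poly_mapping_eqI) (simp add: lookup_add lookup_minus assms)

definition monomial_of :: "('v::finite \<Rightarrow> nat) \<Rightarrow> 'v \<Rightarrow>\<^sub>0 nat" where
  "monomial_of f = Abs_poly_mapping f"

lemma lookup_monomial_of [simp]: "lookup (monomial_of f) = f"
  by (simp add: monomial_of_def)

definition monomial_ideal :: "(('v \<Rightarrow>\<^sub>0 nat) \<Rightarrow> bool) \<Rightarrow> ('v, 'k::field) mpoly set" where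
  "monomial_ideal P = {f. \<forall>m\<in>keys f. P m}"

definition upward :: "(('v \<Rightarrow>\<^sub>0 nat) \<Rightarrow> bool) \<Rightarrow> bool" where
  "upward P \<longleftrightarrow> (\<forall>m k. P m \<longrightarrow> P (m + k))"

lemma is_ideal_monomial_ideal: "upward P \<Longrightarrow> is_ideal (monomial_ideal P)"
  unfolding is_ideal_def monomial_ideal_def upward_def
proof safe
  fix a b :: "('a \<Rightarrow>\<^sub>0 nat) \<Rightarrow>\<^sub>0 'b" and m
  assume "\<forall>m\<in>keys a. P m" "\<forall>m\<in>keys b. P m" "m \<in> keys (a + b)"
  then show "P m" using Poly_Mapping.keys_add[of a b] by auto
next
  fix a b :: "('a \<Rightarrow>\<^sub>0 nat) \<Rightarrow>\<^sub>0 'b" and m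
  assume up: "\<forall>m k. P m \<longrightarrow> P (m + k)" and "\<forall>m\<in>keys b. P m" "m \<in> keys (a * b)"
  then obtain m1 m2 where "m = m1 + m2" "P m2" using keys_mult[of a b] by blast
  then show "P m" using up by (metis add.commute)
qed simp

lemma single_eq_mult: "Poly_Mapping.single m (c :: 'k::comm_ring_1) = Poly_Mapping.single 0 c * Poly_Mapping.single m 1"
  by (simp add: mult_single)

lemma monomials_imp_in_ideal:
  fixes f :: "('v, 'k::field) mpoly"
  assumes J: "is_ideal J" and "\<And>m. m \<in> keys f \<Longrightarrow> Poly_Mapping.single m 1 \<in> J"
  shows "f \<in> J"
proof -
  have "(\<Sum>m\<in>keys f. Poly_Mapping.single m (lookup f m)) \<in> J"
    using assms(2) by (intro ideal_sum[OF J]) (metis single_eq_mult ideal_mult[OF J])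
  then show ?thesis using poly_mapping_sum_singles[of f] by simp
qed

lemma Var_power: "Var x ^ n = Poly_Mapping.single (Poly_Mapping.single x n) 1"
  by (induction n) (simp_all add: Var_def mult_single single_add[symmetric])

lemma Var_mult_Var_power:
  "Var (q v) * Var v ^ w v = Poly_Mapping.single (monomial_of (gen_exp q w v)) 1"
proof -
  have "Poly_Mapping.single (q v) 1 + Poly_Mapping.single v (w v) = monomial_of (gen_exp q w v)"
    by (rule poly_mapping_eqI) (simp add: lookup_add lookup_single gen_exp_def when_def)
  then show ?thesis
    by (simp add: Var_power Var_def[of "q v"] mult_single)
qed

lemma upward_in_power: "upward (\<lambda>m. in_power A q w t (lookup m))"
  unfolding upward_def by (auto intro: in_power_mono simp: lookup_add)

lemma in_power_gen: "finite A \<Longrightarrow> v \<in> A \<Longrightarrow> in_power A q w (Suc 0) (gen_exp q w v)"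
  using in_power_Suc_gen[of A v q w 0 "\<lambda>_. 0"] by simp

lemma edge_ideal_eq:
  fixes E :: "('v::finite \<times> 'v) set"
  assumes E: "E = (\<lambda>v. (q v, v)) ` A"
  shows "(edge_ideal E w :: ('v, 'k::field) mpoly set) = monomial_ideal (\<lambda>m. in_power A q w (Suc 0) (lookup m))"
proof
  have gens: "{Var x * Var y ^ w y |x y. (x, y) \<in> E} =
      (\<lambda>v. Poly_Mapping.single (monomial_of (gen_exp q w v)) 1 :: ('v, 'k) mpoly) ` A"
    unfolding E by (auto simp: Var_mult_Var_power image_iff intro: Var_mult_Var_power[symmetric])
  show "(edge_ideal E w :: ('v, 'k) mpoly set) \<subseteq> monomial_ideal (\<lambda>m. in_power A q w (Suc 0) (lookup m))"
    unfolding edge_ideal_def gens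
    by (rule ideal_gen_minimal[OF _ is_ideal_monomial_ideal[OF upward_in_power]])
      (auto simp: monomial_ideal_def in_power_gen)
  show "monomial_ideal (\<lambda>m. in_power A q w (Suc 0) (lookup m)) \<subseteq> (edge_ideal E w :: ('v, 'k) mpoly set)"
  proof
    fix f :: "('v, 'k) mpoly" assume f: "f \<in> monomial_ideal (\<lambda>m. in_power A q w (Suc 0) (lookup m))"
    show "f \<in> edge_ideal E w"
    proof (rule monomials_imp_in_ideal)
      show "is_ideal (edge_ideal E w :: ('v, 'k) mpoly set)"
        unfolding edge_ideal_def by (rule is_ideal_ideal_gen)
      fix m assume "m \<in> keys f"
      then have "in_power A q w (Suc 0) (lookup m)" using f by (auto simp: monomial_ideal_def)
      then obtain v m' where v: "v \<in> A" "\<And>x. lookup m x = m' x + gen_exp q w v x"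
        using in_power_Suc_cases[of A q w 0 "lookup m"] by auto
      then obtain k where "m = k + monomial_of (gen_exp q w v)"
        using monom_diff_add[of "monomial_of (gen_exp q w v)" m]
        by (metis add.commute le_add2 lookup_monomial_of)
      then have "Poly_Mapping.single m 1 =
          Poly_Mapping.single k 1 * (Poly_Mapping.single (monomial_of (gen_exp q w v)) 1 :: ('v, 'k) mpoly)"
        by (simp add: mult_single)
      moreover have "(Poly_Mapping.single (monomial_of (gen_exp q w v)) 1 :: ('v, 'k) mpoly) \<in> edge_ideal E w"
        unfolding edge_ideal_def gens by (intro subsetD[OF ideal_gen_superset] imageI v(1))
      ultimately show "(Poly_Mapping.single m 1 :: ('v, 'k) mpoly) \<in> edge_ideal E w"
        unfolding edge_ideal_def by (auto intro: ideal_mult[OF is_ideal_ideal_gen])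
    qed
  qed
qed

lemma ideal_power_edge_ideal:
  fixes E :: "('v::finite \<times> 'v) set"
  assumes E: "E = (\<lambda>v. (q v, v)) ` A"
  shows "ideal_power (edge_ideal E w) t = monomial_ideal (\<lambda>m. in_power A q w t (lookup m))"
proof (induction t)
  case 0
  then show ?case by (simp add: monomial_ideal_def)
next
  case (Suc t)
  let ?M = "\<lambda>t. monomial_ideal (\<lambda>m. in_power A q w t (lookup m)) :: ('v, 'a) mpoly set"
  let ?P = "{a * b |a b. a \<in> ?M (Suc 0) \<and> b \<in> ?M t}"
  have fin: "finite A" by simp
  have "ideal_gen ?P = ?M (Suc t)"
  proof
    show "ideal_gen ?P \<subseteq> ?M (Suc t)"
    proof (rule ideal_gen_minimal[OF _ is_ideal_monomial_ideal[OF upward_in_power]], safe)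
      fix a b :: "('v, 'a) mpoly"
      assume ab: "a \<in> ?M (Suc 0)" "b \<in> ?M t"
      show "a * b \<in> ?M (Suc t)"
        unfolding monomial_ideal_def
      proof safe
        fix m assume "m \<in> keys (a * b)"
        then obtain m1 m2 where m: "m = m1 + m2" "m1 \<in> keys a" "m2 \<in> keys b"
          using keys_mult[of a b] by blast
        then have "in_power A q w (Suc 0) (lookup m1)" and m2: "in_power A q w t (lookup m2)"
          using ab by (auto simp: monomial_ideal_def)
        then obtain v m' where v: "v \<in> A" "\<And>x. lookup m1 x = m' x + gen_exp q w v x"
          using in_power_Suc_cases[OF fin, of q w 0 "lookup m1"] by auto
        have "in_power A q w (Suc t) (\<lambda>x. lookup m2 x + gen_exp q w v x)"
          by (rule in_power_Suc_gen[OF fin v(1) m2])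
        then show "in_power A q w (Suc t) (lookup m)"
          by (rule in_power_mono) (simp add: m(1) lookup_add v(2))
      qed
    qed
    show "?M (Suc t) \<subseteq> ideal_gen ?P"
    proof
      fix f assume f: "f \<in> ?M (Suc t)"
      show "f \<in> ideal_gen ?P"
      proof (rule monomials_imp_in_ideal[OF is_ideal_ideal_gen])
        fix m assume "m \<in> keys f"
        then have "in_power A q w (Suc t) (lookup m)" using f by (auto simp: monomial_ideal_def)
        then obtain v m' where v: "v \<in> A" "in_power A q w t m'"
          "\<And>x. lookup m x = m' x + gen_exp q w v x"
          using in_power_Suc_cases[OF fin, of q w t "lookup m"] by auto
        have "m = monomial_of (gen_exp q w v) + monomial_of m'"
          by (rule poly_mapping_eqI) (simp add: lookup_add v(3))
        then have "Poly_Mapping.single m 1 =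
            Poly_Mapping.single (monomial_of (gen_exp q w v)) 1 * (Poly_Mapping.single (monomial_of m') 1 :: ('v, 'a) mpoly)"
          by (simp add: mult_single)
        moreover have "Poly_Mapping.single (monomial_of (gen_exp q w v)) 1 \<in> ?M (Suc 0)"
          "Poly_Mapping.single (monomial_of m') 1 \<in> ?M t"
          using v(2) in_power_gen[OF fin v(1)] by (auto simp: monomial_ideal_def)
        ultimately have "Poly_Mapping.single m 1 \<in> ?P" by blast
        then show "Poly_Mapping.single m 1 \<in> ideal_gen ?P"
          using ideal_gen_superset[of ?P] by (rule subsetD[rotated])
      qed
    qed
  qed
  then show ?case
    unfolding ideal_power.simps(2) Suc unfolding edge_ideal_eq[OF E] .
qed

section \<open>Substitution homomorphisms and their kernels\<close>

definition subst :: "('v::finite \<Rightarrow> ('v, 'k::field) mpoly) \<Rightarrow> ('v, 'k) mpoly \<Rightarrow> ('v, 'k) mpoly" where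
  "subst c f = (\<Sum>m\<in>keys f. Poly_Mapping.single 0 (lookup f m) * (\<Prod>v\<in>UNIV. c v ^ lookup m v))"

lemma subst_superset:
  assumes "finite K" "keys f \<subseteq> K"
  shows "subst c f = (\<Sum>m\<in>K. Poly_Mapping.single 0 (lookup f m) * (\<Prod>v\<in>UNIV. c v ^ lookup m v))"
  unfolding subst_def using assms
  by (intro sum.mono_neutral_left) (auto simp: in_keys_iff)

lemma subst_zero [simp]: "subst c 0 = 0"
  by (simp add: subst_def)

lemma subst_add: "subst c (f + g) = subst c f + subst c g"
  using subst_superset[of "keys f \<union> keys g" f c] subst_superset[of "keys f \<union> keys g" g c]
    subst_superset[of "keys f \<union> keys g" "f + g" c] Poly_Mapping.keys_add[of f g]
  by (simp add: lookup_add single_add distrib_right sum.distrib)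

lemma subst_single:
  "subst c (Poly_Mapping.single m a) = Poly_Mapping.single 0 a * (\<Prod>v\<in>UNIV. c v ^ lookup m v)"
  using subst_superset[of "{m}" "Poly_Mapping.single m a" c] by simp

lemma subst_mult: "subst c (f * g) = subst c f * subst c g"
proof (induction f rule: mpoly_induct)
  case (single m a)
  show ?case
  proof (induction g rule: mpoly_induct)
    case (single k b)
    have const: "Poly_Mapping.single 0 (a * b) = Poly_Mapping.single 0 a * Poly_Mapping.single (0 :: 'a \<Rightarrow>\<^sub>0 nat) b"
      by (simp add: mult_single)
    show ?case
      by (simp only: mult_single[of m] subst_single const lookup_add power_add prod.distrib) (simp only: mult_ac)
  qed (simp_all add: subst_add algebra_simps)
qed (simp_all add: subst_add algebra_simps)

lemma subst_uminus: "subst c (- f) = - subst c f"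
  using subst_add[of c f "- f"] by (simp add: eq_neg_iff_add_eq_0 add.commute)

lemma subst_diff: "subst c (f - g) = subst c f - subst c g"
  using subst_add[of c f "- g"] by (simp add: subst_uminus)

lemma subst_sum: "subst c (sum f B) = (\<Sum>b\<in>B. subst c (f b))"
  by (induction B rule: infinite_finite_induct) (simp_all add: subst_add)

lemma subst_const: "subst c (Poly_Mapping.single 0 a) = Poly_Mapping.single 0 a"
  by (simp add: subst_single)

lemma subst_one [simp]: "subst c 1 = 1"
  using subst_const[of c 1] by simp

lemma subst_Var [simp]: "subst c (Var x) = c x"
proof -
  have "(\<Prod>v\<in>UNIV. c v ^ lookup (Poly_Mapping.single x 1) v) = (\<Prod>v\<in>UNIV. if v = x then c v else 1)"
    by (intro prod.cong) (auto simp: lookup_single when_def)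
  then show ?thesis by (simp add: Var_def subst_single)
qed

lemma subst_power: "subst c (f ^ n) = subst c f ^ n"
  by (induction n) (simp_all add: subst_mult)

lemma subst_prod: "subst c (prod f B) = (\<Prod>b\<in>B. subst c (f b))"
  by (induction B rule: infinite_finite_induct) (simp_all add: subst_mult)

lemma subst_subst: "subst c (subst d f) = subst (\<lambda>v. subst c (d v)) f"
proof (induction f rule: mpoly_induct)
  case (single m a)
  then show ?case by (simp add: subst_single[of d] subst_single[of "\<lambda>v. subst c (d v)"] subst_mult
        subst_const subst_prod subst_power)
qed (simp_all add: subst_add)

lemma single_sum_exponents: 
  "finite B \<Longrightarrow> Poly_Mapping.single (\<Sum>b\<in>B. g b) (1::'k::comm_semiring_1) = (\<Prod>b\<in>B. Poly_Mapping.single (g b) 1)"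
proof (induction B rule: finite_induct)
  case (insert x B)
  have "Poly_Mapping.single (g x + sum g B) (1::'k) = Poly_Mapping.single (g x) 1 * Poly_Mapping.single (sum g B) 1"
    by (simp add: mult_single)
  then show ?case using insert by simp
qed simp

lemma prod_Var:
  fixes \<rho> :: "'v::finite \<Rightarrow> 'v"
  shows "(\<Prod>v\<in>UNIV. Var (\<rho> v) ^ lookup m v) =
     (Poly_Mapping.single (\<Sum>v\<in>UNIV. Poly_Mapping.single (\<rho> v) (lookup m v)) 1 :: ('v, 'k::field) mpoly)"
  by (simp add: Var_power single_sum_exponents)

lemma subst_Var_id [simp]: "subst Var f = f"
proof (induction f rule: mpoly_induct)
  case (single m a)
  have "(\<Sum>v\<in>UNIV. Poly_Mapping.single v (lookup m v)) = m"
    by (rule poly_mapping_eqI) (simp add: lookup_sum lookup_single when_def)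
  then show ?case by (simp add: subst_single prod_Var[of "\<lambda>v. v"] mult_single)
qed (simp_all add: subst_add)

definition subst_ker :: "('v::finite \<Rightarrow> ('v, 'k::field) mpoly) \<Rightarrow> ('v, 'k) mpoly set" where
  "subst_ker c = {f. subst c f = 0}"

lemma is_ideal_subst_ker: "is_ideal (subst_ker c)"
  unfolding is_ideal_def subst_ker_def by (auto simp: subst_add subst_mult)

lemma subst_ker_Var: "subst_ker Var = {0}"
  unfolding subst_ker_def by simp

text \<open>Modulo x_s - p the substitution x_s := p is the identity. Divisibility passes from
  variables to powers and products by the telescoping identity in \<open>mult\<close>.\<close>

lemma diff_subst_dvd:
  fixes f p :: "('v::finite, 'k::field) mpoly"
  shows "(Var s - p) dvd (f - subst (Var(s := p)) f)"
proof -
  define c where "c = (Var(s := p) :: 'v \<Rightarrow> ('v, 'k) mpoly)"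
  let ?y = "Var s - p"
  have mult: "?y dvd (a * b - a' * b')" if "?y dvd (a - a')" "?y dvd (b - b')" for a a' b b'
  proof -
    have "a * b - a' * b' = (a - a') * b + a' * (b - b')" by (simp add: algebra_simps)
    then show ?thesis using that by simp
  qed
  have pow: "?y dvd (Var v ^ n - c v ^ n)" for v n
    by (induction n) (auto intro!: mult simp: c_def)
  have "?y dvd ((\<Prod>v\<in>B. Var v ^ lookup m v) - (\<Prod>v\<in>B. c v ^ lookup m v))" for B m
    by (induction B rule: infinite_finite_induct) (auto intro!: mult pow)
  then have prod: "?y dvd ((\<Prod>v\<in>UNIV. Var v ^ lookup m v) - (\<Prod>v\<in>UNIV. c v ^ lookup m v))" for m
    by blast
  have "?y dvd (subst Var f - subst c f)"
    unfolding subst_def sum_subtractf[symmetric] right_diff_distrib[symmetric]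
    by (intro dvd_sum dvd_mult prod)
  then show ?thesis by (simp add: c_def)
qed

text \<open>Split f into f - \<open>subst c f\<close>, in the kernel of \<open>subst c\<close> by
  idempotence, and \<open>subst c f\<close>, which x_s := p kills and which is therefore a multiple
  of x_s - p.\<close>

lemma subst_ker_split:
  assumes idem: "\<And>v. subst c (c v) = c v" and c': "\<And>v. c' v = subst (Var(s := p)) (c v)"
    and f: "f \<in> subst_ker c'"
  shows "\<exists>a b. b \<in> subst_ker c \<and> f = (Var s - p) * a + b"
proof -
  have "c' = (\<lambda>v. subst (Var(s := p)) (c v))" using c' by auto
  then have "subst (Var(s := p)) (subst c f) = 0"
    using f by (simp add: subst_ker_def subst_subst)
  then obtain a where "subst c f = (Var s - p) * a"
    using diff_subst_dvd[of s p "subst c f"] by (auto simp: dvd_def)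
  moreover have "f - subst c f \<in> subst_ker c"
    by (simp add: subst_ker_def subst_diff subst_subst idem)
  ultimately show ?thesis
    by (intro exI[of _ a] exI[of _ "f - subst c f"]) simp
qed

lemma subst_ker_mono:
  assumes c': "\<And>v. c' v = subst (Var(s := p)) (c v)"
  shows "subst_ker c \<subseteq> subst_ker c'"
proof -
  have "c' = (\<lambda>v. subst (Var(s := p)) (c v))" using c' by auto
  then show ?thesis by (auto simp: subst_ker_def simp flip: subst_subst)
qed

lemma lookup_Var_mult:
  fixes f :: "('v, 'k::field) mpoly"
  shows "lookup (Var x * f) (m + Poly_Mapping.single x 1) = lookup f m"
  using lookup_single_mult_add[of "Poly_Mapping.single x (1::nat)" 1 f m] by (simp add: Var_def add.commute)

lemma lookup_Var_mult_nz:
  fixes f :: "('v, 'k::field) mpoly"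
  assumes "lookup (Var x * f) k \<noteq> 0"
  obtains m where "k = m + Poly_Mapping.single x 1" "lookup f m \<noteq> 0"
proof -
  obtain m where m: "k = Poly_Mapping.single x 1 + m"
    using assms lookup_single_mult_eq_0[of k "Poly_Mapping.single x (1::nat)" 1 f] by (auto simp: Var_def)
  then have k: "k = m + Poly_Mapping.single x 1" by (simp add: add.commute)
  then show ?thesis using that assms lookup_Var_mult by metis
qed

lemma ex_max_exponent:
  fixes b :: "('v, 'k::field) mpoly" and s :: 'v
  assumes "b \<noteq> 0"
  obtains u where "u \<in> keys b" "\<And>u'. u' \<in> keys b \<Longrightarrow> lookup u' s \<le> lookup u s"
proof -
  have "keys b \<noteq> {}" using assms by (metis Poly_Mapping.keys_eq_empty)
  then show ?thesis using that ex_max_nat[of "keys b" "\<lambda>u. lookup u s"] by auto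
qed

text \<open>Multiplication by p does not raise the exponent of s, so nothing cancels the term x_s u
  when u has the largest exponent of s.\<close>

lemma Var_diff_top:
  fixes b p :: "('v, 'k::field) mpoly"
  assumes p: "p = 0 \<or> (\<exists>x. x \<noteq> s \<and> p = Var x)"
    and u: "\<And>u'. u' \<in> keys b \<Longrightarrow> lookup u' s \<le> lookup u s"
  shows "lookup ((Var s - p) * b) (u + Poly_Mapping.single s 1) = lookup b u"
proof -
  have "lookup (p * b) (u + Poly_Mapping.single s 1) = 0"
  proof (rule ccontr)
    assume nz: "lookup (p * b) (u + Poly_Mapping.single s 1) \<noteq> 0"
    then obtain x where x: "x \<noteq> s" "p = Var x" using p by auto
    then obtain m where m: "u + Poly_Mapping.single s 1 = m + Poly_Mapping.single x 1" "lookup b m \<noteq> 0"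
      using nz lookup_Var_mult_nz by metis
    have "lookup u s + 1 = lookup m s"
      using arg_cong[OF m(1), of "\<lambda>m. lookup m s"] x(1) by (simp add: lookup_add lookup_single)
    moreover have "m \<in> keys b" using m(2) by (simp add: in_keys_iff)
    ultimately show False using u[of m] by simp
  qed
  then show ?thesis using lookup_Var_mult[of s b u] by (simp add: left_diff_distrib lookup_minus)
qed

lemma Var_diff_cancel:
  fixes b p :: "('v, 'k::field) mpoly"
  assumes p: "p = 0 \<or> (\<exists>x. x \<noteq> s \<and> p = Var x)" and zero: "(Var s - p) * b = 0"
  shows "b = 0"
proof (rule ccontr)
  assume "b \<noteq> 0"
  then obtain u where u: "u \<in> keys b" "\<And>u'. u' \<in> keys b \<Longrightarrow> lookup u' s \<le> lookup u s"
    using ex_max_exponent[of b s] by blast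
  then show False
    using Var_diff_top[where b = b and u = u, OF p u(2)] zero by (simp add: in_keys_iff)
qed

text \<open>A substitution that fixes x_s - p reduces regularity modulo its kernel to cancellation
  in S.\<close>

lemma subst_ker_regular:
  assumes p: "p = 0 \<or> (\<exists>x. x \<noteq> s \<and> p = Var x)" and y: "subst c (Var s - p) = Var s - p"
    and ya: "(Var s - p) * a \<in> subst_ker c"
  shows "a \<in> subst_ker c"
  using ya Var_diff_cancel[OF p, of "subst c a"] by (simp add: subst_ker_def subst_mult y)

text \<open>
  A monomial ideal has an associated prime containing two given variables if some monomial outside
  of it is multiplied into it by both; otherwise their difference is regular modulo the ideal.
\<close>

lemma Var_diff_regular_mod_monomial_ideal:
  fixes b :: "('v, 'k::field) mpoly"
  assumes up: "upward P" and rs: "r \<noteq> s"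
    and P: "\<And>z. P (z + Poly_Mapping.single r 1) \<Longrightarrow> P (z + Poly_Mapping.single s 1) \<Longrightarrow> P z"
    and yb: "(Var r - Var s) * b \<in> monomial_ideal P"
  shows "b \<in> monomial_ideal P"
proof (rule ccontr)
  assume not: "b \<notin> monomial_ideal P"
  let ?e = "\<lambda>x k. Poly_Mapping.single x (k::nat) :: 'v \<Rightarrow>\<^sub>0 nat"
  have es: "?e x (Suc k) = ?e x k + ?e x 1" for x k by (simp flip: single_add)
  \<comment> \<open>The hypothesis on single factors x_r and x_s extends to arbitrary powers, by
    induction on the sum of the exponents.\<close>
  have iter: "P z" if "P (z + ?e s k)" "P (z + ?e r l)" for z k l
    using that
  proof (induction "k + l" arbitrary: z k l rule: less_induct)
    case less
    show ?case
    proof (cases "k = 0 \<or> l = 0")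
      case True
      then show ?thesis using less.prems by auto
    next
      case False
      then obtain k' l' where kl: "k = Suc k'" "l = Suc l'" by (metis not0_implies_Suc)
      have 1: "P (z + ?e s 1 + ?e s k')" "P (z + ?e s 1 + ?e r l)"
        using less.prems up by (auto simp: kl es[of _ k'] upward_def ac_simps) (metis add.assoc add.commute)
      have 2: "P (z + ?e r 1 + ?e s k)" "P (z + ?e r 1 + ?e r l')"
        using less.prems up by (auto simp: kl es[of _ l'] upward_def ac_simps) (metis add.assoc add.commute)
      have "P (z + ?e s 1)" using less.hyps[OF _ 1] kl by simp
      moreover have "P (z + ?e r 1)" using less.hyps[OF _ 2] kl by simp
      ultimately show ?thesis using P by blast
    qed
  qed
  \<comment> \<open>\<open>b1\<close> collects the terms of \<open>b\<close> outside the ideal. Its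
    product with x_r - x_s still lies in the ideal, so at monomials outside the ideal x_r b1 and x_s
    b1 have equal coefficients.\<close>
  define b1 where "b1 = (\<Sum>m\<in>{m\<in>keys b. \<not> P m}. Poly_Mapping.single m (lookup b m))"
  have lb1: "lookup b1 m = (if P m then 0 else lookup b m)" for m
  proof -
    have "lookup b1 m = (\<Sum>k\<in>{m\<in>keys b. \<not> P m}. if k = m then lookup b m else 0)"
      by (auto simp: b1_def lookup_sum lookup_single when_def intro!: sum.cong)
    also have "\<dots> = (if P m then 0 else lookup b m)"
      by (auto simp: in_keys_iff)
    finally show ?thesis .
  qed
  have "b - b1 \<in> monomial_ideal P"
    by (auto simp: monomial_ideal_def in_keys_iff lookup_minus lb1 split: if_splits)
  then have "(Var r - Var s) * b - (Var r - Var s) * (b - b1) \<in> monomial_ideal P"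
    using yb ideal_diff[OF is_ideal_monomial_ideal[OF up]] ideal_mult[OF is_ideal_monomial_ideal[OF up]] by blast
  then have yb1: "(Var r - Var s) * b1 \<in> monomial_ideal P" by (simp add: algebra_simps)
  then have coeff0: "lookup (Var r * b1) m = lookup (Var s * b1) m" if "\<not> P m" for m
    using that by (auto simp: monomial_ideal_def in_keys_iff left_diff_distrib lookup_minus)
  have "b1 \<noteq> 0"
  proof
    assume "b1 = 0"
    then have "lookup b m = 0" if "\<not> P m" for m using lb1[of m] that by simp
    then show False using not by (auto simp: monomial_ideal_def in_keys_iff)
  qed
  then obtain u where u: "u \<in> keys b1" "\<And>u'. u' \<in> keys b1 \<Longrightarrow> lookup u' r \<le> lookup u r"
    using ex_max_exponent[of b1 r] by blast
  have "lookup ((Var r - Var s) * b1) (u + ?e r 1) = lookup b1 u"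
    by (rule Var_diff_top[OF _ u(2)]) (use rs in auto)
  then have Pur: "P (u + ?e r 1)"
    using yb1 u(1) by (auto simp: monomial_ideal_def in_keys_iff)
  have nPu: "\<not> P u" using u(1) lb1[of u] by (auto simp: in_keys_iff)
  \<comment> \<open>Starting from \<open>u\<close>, factors x_r are traded for x_s without leaving
    the support of \<open>b1\<close>. The monomial z x_s^(k+1) lies outside the ideal, since
    otherwise \<open>iter\<close> would put z and hence \<open>u\<close> into it; so the term of x_s
    b1 there is matched by one of x_r b1. The exponent of r in \<open>u\<close> bounds the number of
    trades, a contradiction.\<close>
  have "\<exists>z. u = z + ?e r k \<and> lookup b1 (z + ?e s k) \<noteq> 0" for k
  proof (induction k)
    case 0
    then show ?case using u(1) by (auto simp: in_keys_iff)
  next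
    case (Suc k)
    then obtain z where z: "u = z + ?e r k" "lookup b1 (z + ?e s k) \<noteq> 0" by blast
    have "\<not> P (z + ?e s (Suc k))"
    proof
      assume "P (z + ?e s (Suc k))"
      moreover have "P (z + ?e r (Suc k))" using Pur z(1) by (simp add: es[of _ k] ac_simps)
      ultimately have "P z" by (rule iter)
      then show False using nPu z(1) up by (auto simp: upward_def)
    qed
    moreover have "lookup (Var s * b1) (z + ?e s (Suc k)) = lookup b1 (z + ?e s k)"
      using lookup_Var_mult[of s b1 "z + ?e s k"] by (simp add: es[of _ k] ac_simps)
    ultimately have "lookup (Var r * b1) (z + ?e s (Suc k)) \<noteq> 0"
      using coeff0 z(2) by metis
    then obtain m where m: "z + ?e s (Suc k) = m + ?e r 1" "lookup b1 m \<noteq> 0"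
      by (rule lookup_Var_mult_nz)
    have "lookup (?e r 1) x \<le> lookup z x" for x
      using arg_cong[OF m(1), of "\<lambda>m. lookup m x"] rs
      by (auto simp: lookup_add lookup_single when_def split: if_splits)
    then obtain z' where z': "z = ?e r 1 + z'" using monom_diff_add by blast
    have "m + ?e r 1 = (z' + ?e s (Suc k)) + ?e r 1"
      unfolding m(1)[symmetric] z' by (simp only: ac_simps)
    then have "m = z' + ?e s (Suc k)" by simp
    moreover have "u = z' + ?e r (Suc k)"
      using z(1) z' by (simp add: es[of _ k] ac_simps)
    ultimately show ?case using m(2) by auto
  qed
  then obtain z where "u = z + ?e r (Suc (lookup u r))" by blast
  then have "lookup u r = lookup z r + Suc (lookup u r)"
    by (metis lookup_add lookup_single_eq)
  then show False by simp
qed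

section \<open>Length of a minimal resolution\<close>

text \<open>For idempotent \<rho> the kernel of this substitution is generated by the differences
  x_v - x_(\<rho> v) and the variables in W fixed by \<rho>.\<close>

definition merge_kill :: "('v::finite \<Rightarrow> 'v) \<Rightarrow> 'v set \<Rightarrow> 'v \<Rightarrow> ('v, 'k::field) mpoly" where
  "merge_kill \<rho> W v = (if \<rho> v \<in> W then 0 else Var (\<rho> v))"

lemma subst_merge_kill_idem:
  assumes "\<And>v. \<rho> (\<rho> v) = \<rho> v"
  shows "subst (merge_kill \<rho> W) (merge_kill \<rho> W v) = merge_kill \<rho> W v"
  by (simp add: merge_kill_def assms)

lemma merge_kill_id [simp]: "merge_kill (\<lambda>v. v) {} = Var"
  by (auto simp: merge_kill_def)

text \<open>The conclusions are what the Tor steps ask of Y, Y' and the element added to Y, here a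
  variable.\<close>

lemma subst_ker_kill:
  fixes \<rho> :: "'v::finite \<Rightarrow> 'v"
  assumes idem: "\<And>v. \<rho> (\<rho> v) = \<rho> v" and x: "\<rho> x = x" "x \<notin> W"
  defines "Y \<equiv> subst_ker (merge_kill \<rho> W) :: ('v, 'k::field) mpoly set"
    and "Y' \<equiv> subst_ker (merge_kill \<rho> (insert x W)) :: ('v, 'k) mpoly set"
  shows "Y \<subseteq> Y'" "Var x \<in> Y'" "f \<in> Y' \<Longrightarrow> \<exists>a b. b \<in> Y \<and> f = Var x * a + b"
    "Var x * a \<in> Y \<Longrightarrow> a \<in> Y"
proof -
  have c': "merge_kill \<rho> (insert x W) v = subst (Var(x := 0)) (merge_kill \<rho> W v :: ('v, 'k) mpoly)" for v
    by (auto simp: merge_kill_def)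
  show "Y \<subseteq> Y'" unfolding Y_def Y'_def by (rule subst_ker_mono[OF c'])
  show "Var x \<in> Y'" by (simp add: Y'_def subst_ker_def merge_kill_def x)
  show "\<exists>a b. b \<in> Y \<and> f = Var x * a + b" if "f \<in> Y'"
    using subst_ker_split[OF subst_merge_kill_idem[OF idem] c'] that unfolding Y_def Y'_def by simp
  show "a \<in> Y" if "Var x * a \<in> Y"
    using subst_ker_regular[of 0 x "merge_kill \<rho> W" a] that x
    unfolding Y_def by (simp add: merge_kill_def)
qed

text \<open>The condition on r says that r has neither been merged nor absorbed another variable.
  Hence redirecting r to s amounts to composing with x_r := x_s.\<close>

lemma subst_ker_merge:
  fixes \<rho> :: "'v::finite \<Rightarrow> 'v"
  assumes idem: "\<And>v. \<rho> (\<rho> v) = \<rho> v" and r: "\<And>v. \<rho> v = r \<longleftrightarrow> v = r" and s: "\<rho> s = s" "s \<noteq> r"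
  defines "Y \<equiv> subst_ker (merge_kill \<rho> {}) :: ('v, 'k::field) mpoly set"
    and "Y' \<equiv> subst_ker (merge_kill (\<rho>(r := s)) {}) :: ('v, 'k) mpoly set"
  shows "Y \<subseteq> Y'" "Var r - Var s \<in> Y'" "f \<in> Y' \<Longrightarrow> \<exists>a b. b \<in> Y \<and> f = (Var r - Var s) * a + b"
    "(Var r - Var s) * a \<in> Y \<Longrightarrow> a \<in> Y"
proof -
  have c': "merge_kill (\<rho>(r := s)) {} v = subst (Var(r := Var s)) (merge_kill \<rho> {} v :: ('v, 'k) mpoly)" for v
    using r[of v] r[of r] by (auto simp: merge_kill_def)
  show "Y \<subseteq> Y'" unfolding Y_def Y'_def by (rule subst_ker_mono[OF c'])
  show "Var r - Var s \<in> Y'" using s by (simp add: Y'_def subst_ker_def merge_kill_def subst_diff)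
  show "\<exists>a b. b \<in> Y \<and> f = (Var r - Var s) * a + b" if "f \<in> Y'"
    using subst_ker_split[OF subst_merge_kill_idem[OF idem] c'] that unfolding Y_def Y'_def by simp
  have p: "Var s = (0 :: ('v, 'k) mpoly) \<or> (\<exists>x. x \<noteq> r \<and> Var s = (Var x :: ('v, 'k) mpoly))"
    using s(2) by blast
  show "a \<in> Y" if "(Var r - Var s) * a \<in> Y"
    using subst_ker_regular[OF p, of "merge_kill \<rho> {}" a] that s r[of r]
    unfolding Y_def by (simp add: merge_kill_def subst_diff)
qed

section \<open>Powers of the edge ideal under identification of variables\<close>

context
  fixes \<rho> q :: "'v::finite \<Rightarrow> 'v" and A :: "'v set"
  assumes idem: "\<And>v. \<rho> (\<rho> v) = \<rho> v" and fixA: "\<And>v. v \<in> A \<Longrightarrow> \<rho> v = v"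
begin

abbreviation push :: "('v, 'k::field) mpoly \<Rightarrow> ('v, 'k) mpoly" where
  "push \<equiv> subst (merge_kill \<rho> {})"

definition push_exp :: "('v \<Rightarrow>\<^sub>0 nat) \<Rightarrow> 'v \<Rightarrow>\<^sub>0 nat" where
  "push_exp m = (\<Sum>v\<in>UNIV. Poly_Mapping.single (\<rho> v) (lookup m v))"

lemma push_single: "push (Poly_Mapping.single m c) = Poly_Mapping.single (push_exp m) c"
  by (simp add: subst_single merge_kill_def prod_Var push_exp_def mult_single)

lemma push_push: "push (push f) = push f"
  by (simp add: subst_subst subst_merge_kill_idem[OF idem])

lemma lookup_push_exp: "lookup (push_exp m) x = (\<Sum>v\<in>{v. \<rho> v = x}. lookup m v)"
  by (auto simp: push_exp_def lookup_sum lookup_single when_def sum.If_cases intro!: sum.cong)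

text \<open>Heads of edges are fixed by \<rho>, so an identification changes only the parent map,
  and exponents add up over the fibres of \<rho>.\<close>

lemma usage_merge: "usage A (\<lambda>v. \<rho> (q v)) w a x = (\<Sum>v\<in>{v. \<rho> v = x}. usage A q w a v)"
proof -
  have gen: "gen_exp (\<lambda>v. \<rho> (q v)) w u x = (\<Sum>v\<in>{v. \<rho> v = x}. gen_exp q w u v)" if "u \<in> A" for u
    using fixA[OF that] by (auto simp: gen_exp_def sum.distrib of_bool_def sum.delta)
  have "usage A (\<lambda>v. \<rho> (q v)) w a x = (\<Sum>u\<in>A. \<Sum>v\<in>{v. \<rho> v = x}. a u * gen_exp q w u v)"
    unfolding usage_def by (intro sum.cong refl) (simp add: gen sum_distrib_left)
  also have "\<dots> = (\<Sum>v\<in>{v. \<rho> v = x}. usage A q w a v)"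
    unfolding usage_def by (rule sum.swap)
  finally show ?thesis .
qed

lemma push_exp_usage: "push_exp (monomial_of (usage A q w a)) = monomial_of (usage A (\<lambda>v. \<rho> (q v)) w a)"
  by (rule poly_mapping_eqI) (simp add: lookup_push_exp usage_merge)

lemma in_power_push:
  assumes "in_power A q w t (lookup m)"
  shows "in_power A (\<lambda>v. \<rho> (q v)) w t (lookup (push_exp m))"
proof -
  obtain a where "sum a A = t" "\<And>x. usage A q w a x \<le> lookup m x"
    using assms unfolding in_power_def by blast
  then show ?thesis
    unfolding in_power_def by (auto simp: lookup_push_exp usage_merge intro: sum_mono)
qed

text \<open>Together with \<open>merged_lift\<close>, this lets regularity modulo I + Y, with Y the
  kernel of \<open>push\<close>, be tested modulo the merged monomial ideal.\<close>

lemma push_in_merged: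
  assumes "f \<in> monomial_ideal (\<lambda>m. in_power A q w t (lookup m))"
  shows "push f \<in> (monomial_ideal (\<lambda>m. in_power A (\<lambda>v. \<rho> (q v)) w t (lookup m)) :: ('v, 'k::field) mpoly set)"
    (is "_ \<in> ?M")
proof -
  have J: "is_ideal ?M" by (rule is_ideal_monomial_ideal[OF upward_in_power])
  have *: "Poly_Mapping.single (push_exp m) c \<in> ?M" if "m \<in> keys f" for m c
    using in_power_push[of w t m] that assms by (auto simp: monomial_ideal_def)
  have "push f = push (\<Sum>m\<in>keys f. Poly_Mapping.single m (lookup f m))"
    using poly_mapping_sum_singles[of f] by simp
  also have "\<dots> = (\<Sum>m\<in>keys f. Poly_Mapping.single (push_exp m) (lookup f m))"
    by (subst subst_sum) (simp add: push_single)
  also have "\<dots> \<in> ?M" by (intro ideal_sum[OF J] *)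
  finally show ?thesis .
qed

lemma merged_lift:
  assumes "b \<in> (monomial_ideal (\<lambda>m. in_power A (\<lambda>v. \<rho> (q v)) w t (lookup m)) :: ('v, 'k::field) mpoly set)"
  shows "\<exists>g\<in>monomial_ideal (\<lambda>m. in_power A q w t (lookup m)). push g = push b"
proof -
  let ?I = "monomial_ideal (\<lambda>m. in_power A q w t (lookup m)) :: ('v, 'k) mpoly set"
  have J: "is_ideal ?I" by (rule is_ideal_monomial_ideal[OF upward_in_power])
  have "\<exists>m'. in_power A q w t (lookup m') \<and> push_exp m' = push_exp m" if "m \<in> keys b" for m
  proof -
    have "in_power A (\<lambda>v. \<rho> (q v)) w t (lookup m)"
      using assms that by (simp add: monomial_ideal_def)
    then obtain a where a: "sum a A = t" "\<And>x. usage A (\<lambda>v. \<rho> (q v)) w a x \<le> lookup m x"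
      unfolding in_power_def by blast
    define U where "U = monomial_of (usage A q w a)"
    define U' where "U' = monomial_of (usage A (\<lambda>v. \<rho> (q v)) w a)"
    have U: "push_exp U = U'" by (simp add: U_def U'_def push_exp_usage)
    have add: "push_exp (m1 + m2) = push_exp m1 + push_exp m2" for m1 m2
      by (rule poly_mapping_eqI) (simp add: lookup_push_exp lookup_add sum.distrib)
    have "push (push (Poly_Mapping.single U (1::'k))) = push (Poly_Mapping.single U 1)"
      by (rule push_push)
    then have "Poly_Mapping.single (push_exp U') (1::'k) = Poly_Mapping.single U' 1"
      by (simp add: push_single U)
    then have U': "push_exp U' = U'"
      by (metis keys_single one_neq_zero singleton_inject)
    \<comment> \<open>Exchange the merged product U' for the product U of the original generators;
      both have the same image under \<open>push\<close>.\<close>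
    have "m = U' + (m - U')"
      using a(2) by (intro monom_diff_add) (simp add: U'_def)
    then have "push_exp (U + (m - U')) = push_exp m"
      using add[of U "m - U'"] add[of U' "m - U'"] U U' by simp
    moreover have "in_power A q w t (lookup (U + (m - U')))"
      unfolding in_power_def using a(1) by (intro exI[of _ a]) (simp add: U_def lookup_add)
    ultimately show ?thesis by blast
  qed
  then obtain g where g: "\<And>m. m \<in> keys b \<Longrightarrow> in_power A q w t (lookup (g m))"
    "\<And>m. m \<in> keys b \<Longrightarrow> push_exp (g m) = push_exp m"
    by metis
  let ?g = "\<Sum>m\<in>keys b. Poly_Mapping.single (g m) (lookup b m)"
  have "?g \<in> ?I"
    using g(1) by (intro ideal_sum[OF J]) (auto simp: monomial_ideal_def)
  moreover have "push ?g = push b"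
  proof -
    have "push ?g = (\<Sum>m\<in>keys b. Poly_Mapping.single (push_exp m) (lookup b m))"
      by (subst subst_sum) (simp add: push_single g(2))
    also have "\<dots> = push (\<Sum>m\<in>keys b. Poly_Mapping.single m (lookup b m))"
      by (subst subst_sum) (simp add: push_single)
    finally show ?thesis using poly_mapping_sum_singles[of b] by simp
  qed
  ultimately show ?thesis by blast
qed

end

text \<open>
  \<open>A\<close> is the set of vertices that are not roots, \<open>q\<close> the parent function and \<open>ch r\<close> the only child of
  the root \<open>r\<close>.
\<close>

locale weighted_forest =
  fixes A :: "'v::finite set" and q ch :: "'v \<Rightarrow> 'v" and w h :: "'v \<Rightarrow> nat"
  assumes q_neq: "v \<in> A \<Longrightarrow> q v \<noteq> v"
    and height: "v \<in> A \<Longrightarrow> h (q v) < h v"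
    and w_pos: "v \<in> A \<Longrightarrow> w v \<ge> 1"
    and child: "r \<notin> A \<Longrightarrow> ch r \<in> A" "r \<notin> A \<Longrightarrow> q (ch r) = r"
    and only_child: "v \<in> A \<Longrightarrow> q v \<notin> A \<Longrightarrow> v = ch (q v)"
    and inner: "v \<in> A \<Longrightarrow> q v \<in> A \<Longrightarrow> w (q v) \<ge> 2"
begin

definition power_ideal :: "nat \<Rightarrow> ('v, 'k::field) mpoly set" where
  "power_ideal t = monomial_ideal (\<lambda>m. in_power A q w t (lookup m))"

definition merge :: "'v set \<Rightarrow> 'v \<Rightarrow> 'v" where
  "merge R v = (if v \<in> R then ch v else v)"

lemma merge_idem: "R \<subseteq> - A \<Longrightarrow> merge R (merge R v) = merge R v"
  using child by (auto simp: merge_def)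

lemma merge_insert: "r \<notin> A \<Longrightarrow> merge (insert r R) = (merge R)(r := ch r)"
  by (auto simp: merge_def)

text \<open>Roots already identified with their children turn their edges into loops,
  \<open>q v = v\<close>. The exchange argument admits loops, so it still applies to r.\<close>

lemma root_regular:
  fixes b :: "('v, 'k::field) mpoly"
  assumes R: "R \<subseteq> - A" and r: "r \<notin> A" "r \<notin> R"
    and yb: "(Var r - Var (ch r)) * b \<in> monomial_ideal (\<lambda>m. in_power A (\<lambda>v. merge R (q v)) w t (lookup m))"
  shows "b \<in> monomial_ideal (\<lambda>m. in_power A (\<lambda>v. merge R (q v)) w t (lookup m))"
proof (rule Var_diff_regular_mod_monomial_ideal[OF upward_in_power _ _ yb])
  show "r \<noteq> ch r" using child(1)[OF r(1)] r(1) by auto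
next
  fix z :: "'v \<Rightarrow>\<^sub>0 nat"
  have eq: "lookup (z + Poly_Mapping.single x 1) = (\<lambda>y. lookup z y + of_bool (y = x))" for x
    by (auto simp: lookup_add lookup_single when_def)
  assume "in_power A (\<lambda>v. merge R (q v)) w t (lookup (z + Poly_Mapping.single r 1))"
    "in_power A (\<lambda>v. merge R (q v)) w t (lookup (z + Poly_Mapping.single (ch r) 1))"
  then show "in_power A (\<lambda>v. merge R (q v)) w t (lookup z)"
    unfolding eq
  proof (rule in_power_root_regular[where h = h, rotated -2])
    show "finite A" by simp
    show "h (merge R (q v)) < h v" if "v \<in> A" "merge R (q v) \<noteq> v" for v
      using that only_child[OF that(1)] height[OF that(1)] R by (auto simp: merge_def split: if_splits)
    show "1 \<le> w (ch r)" using w_pos child(1)[OF r(1)] .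
    show "merge R (q (ch r)) = r" using child(2)[OF r(1)] r by (simp add: merge_def)
    show "v = ch r" if "v \<in> A" "merge R (q v) = r" for v
      using that r R only_child[OF that(1)] child by (auto simp: merge_def split: if_splits)
  qed (use r child(1) in auto)
qed

end

section \<open>Upper and lower bound for the length of a resolution\<close>

locale forest_resolution = weighted_forest A q ch w h + resolution rk M "power_ideal t"
  for A :: "'v::finite set" and q ch w h rk t
    and M :: "nat \<Rightarrow> nat \<Rightarrow> nat \<Rightarrow> ('v, 'k::field) mpoly"
begin

text \<open>Adding x_r - x_(ch r) to Y creates no Tor in positive degrees. Degree 1 needs regularity
  modulo the power ideal plus Y; above that, regularity modulo Y suffices.\<close>

lemma tor_vanishes_merge:
  assumes "R \<subseteq> - A"
  shows "tor_vanishes (subst_ker (merge_kill (merge R) {})) i"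
proof -
  have "finite R" by simp
  then show ?thesis
    using assms
  proof (induction R arbitrary: i rule: finite_induct)
    case empty
    have "merge {} = (\<lambda>v. v)" by (auto simp: merge_def)
    then show ?case by (simp add: subst_ker_Var tor_vanishes_zero)
  next
    case (insert r R i)
    have r: "r \<notin> A" and R: "R \<subseteq> - A" using insert.prems by auto
    have s: "merge R (ch r) = ch r" "ch r \<noteq> r"
      using child[OF r] R r by (auto simp: merge_def)
    have mr: "merge R v = r \<longleftrightarrow> v = r" for v
      using R r insert.hyps child by (auto simp: merge_def)
    note ker = subst_ker_merge[where \<rho> = "merge R", OF merge_idem[OF R] mr s, folded merge_insert[OF r]]
    have regular: "\<exists>g\<in>power_ideal t. a - g \<in> subst_ker (merge_kill (merge R) {})"
      if f: "f \<in> power_ideal t" and yf: "(Var r - Var (ch r)) * a - f \<in> subst_ker (merge_kill (merge R) {})"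
      for a f :: "('v, 'k) mpoly"
    proof -
      let ?\<sigma> = "subst (merge_kill (merge R) {}) :: ('v, 'k) mpoly \<Rightarrow> ('v, 'k) mpoly"
      let ?M = "monomial_ideal (\<lambda>m. in_power A (\<lambda>v. merge R (q v)) w t (lookup m)) :: ('v, 'k) mpoly set"
      have fixA: "merge R v = v" if "v \<in> A" for v using that R by (auto simp: merge_def)
      have "(Var r - Var (ch r)) * ?\<sigma> a = ?\<sigma> f"
        using yf mr[of r] s(1) by (simp add: subst_ker_def subst_diff subst_mult merge_kill_def)
      moreover have "?\<sigma> f \<in> ?M"
        using push_in_merged[where \<rho> = "merge R" and A = A, OF merge_idem[OF R] fixA] f
        unfolding power_ideal_def by blast
      ultimately have "?\<sigma> a \<in> ?M"
        using root_regular[OF R r insert.hyps(2)] by metis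
      then obtain g where "g \<in> power_ideal t" "?\<sigma> g = ?\<sigma> (?\<sigma> a)"
        using merged_lift[where \<rho> = "merge R" and A = A, OF merge_idem[OF R] fixA]
        unfolding power_ideal_def by blast
      then show ?thesis
        by (intro bexI[of _ g])
          (simp_all add: subst_ker_def subst_diff subst_subst subst_merge_kill_idem[OF merge_idem[OF R]])
    qed
    show ?case
    proof (cases i)
      case 0
      show ?thesis
        unfolding 0
        by (rule tor_vanishes_step_0[OF is_ideal_subst_ker is_ideal_subst_ker ker(1,2)])
          (fact ker(3) regular insert.IH[OF R])+
    next
      case (Suc j)
      show ?thesis
        unfolding Suc
        by (rule tor_vanishes_step[OF is_ideal_subst_ker is_ideal_subst_ker ker(1,2)])
          (fact ker(3,4) insert.IH[OF R])+
    qed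
  qed
qed

text \<open>A variable need not be regular modulo I + Y, so each one added may lose the lowest
  degree in which Tor vanishes. The upper bound takes \<open>merge (- A)\<close> for \<rho>, the
  lower bound the identity.\<close>

lemma tor_vanishes_kill:
  assumes base: "\<And>i. tor_vanishes (subst_ker (merge_kill \<rho> {})) i"
    and idem: "\<And>v. \<rho> (\<rho> v) = \<rho> v"
    and W: "\<And>x. x \<in> W \<Longrightarrow> \<rho> x = x" and i: "card W \<le> i"
  shows "tor_vanishes (subst_ker (merge_kill \<rho> W)) i"
proof -
  have "finite W" by simp
  then show ?thesis
    using W i
  proof (induction W arbitrary: i rule: finite_induct)
    case empty
    then show ?case by (simp add: base)
  next
    case (insert x W i)
    obtain j where j: "i = Suc j" "card W \<le> j"
      using insert by (cases i) auto
    have x: "\<rho> x = x" using insert.prems by simp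
    have IH: "tor_vanishes (subst_ker (merge_kill \<rho> W)) j" "tor_vanishes (subst_ker (merge_kill \<rho> W)) (Suc j)"
      using insert j by auto
    note ker = subst_ker_kill[where \<rho> = \<rho>, OF idem x insert.hyps(2)]
    show ?case
      unfolding j(1)
      by (rule tor_vanishes_step[OF is_ideal_subst_ker is_ideal_subst_ker ker(1,2)])
        (fact ker(3,4) IH)+
  qed
qed

text \<open>With every root merged into its child, killing A kills all variables, so Y becomes the
  maximal ideal. The bound \<open>i \<ge> 1\<close> is there because minimality concerns the
  matrices from \<open>M 1\<close> on.\<close>

lemma rank_upper:
  assumes minimal: "\<And>i r c. lookup (M (Suc i) r c) 0 = 0"
    and i: "card A \<le> i" "i \<ge> 1"
  shows "rk (Suc i) = 0"
proof -
  let ?\<rho> = "merge (- A)"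
  let ?m = "subst_ker (merge_kill ?\<rho> A) :: ('v, 'k) mpoly set"
  have zero: "merge_kill ?\<rho> A = (\<lambda>v. 0 :: ('v, 'k) mpoly)"
    using child(1) by (auto simp: merge_kill_def merge_def)
  have mem: "f \<in> ?m \<longleftrightarrow> lookup f 0 = 0" for f
  proof -
    have "subst (\<lambda>v. 0) f = Poly_Mapping.single 0 (lookup f 0)"
    proof (induction f rule: mpoly_induct)
      case (single m c)
      show ?case
      proof (cases "m = 0")
        case False
        then obtain v where "lookup m v \<noteq> 0" by (metis lookup_zero poly_mapping_eqI)
        then have "(\<Prod>v\<in>UNIV. (0 :: ('v, 'k) mpoly) ^ lookup m v) = 0"
          by (intro prod_zero bexI[of _ v]) (auto simp: zero_power)
        then show ?thesis using False by (simp add: subst_single lookup_single)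
      qed (simp add: subst_single)
    qed (simp_all add: subst_add lookup_add single_add)
    moreover have "(Poly_Mapping.single 0 c :: ('v, 'k) mpoly) = 0 \<longleftrightarrow> c = 0" for c
      by (auto dest: arg_cong[of _ _ "\<lambda>f. lookup f 0"])
    ultimately show ?thesis
      by (simp add: subst_ker_def zero)
  qed
  have fixA: "merge (- A) x = x" if "x \<in> A" for x using that by (simp add: merge_def)
  have "tor_vanishes ?m i"
    by (rule tor_vanishes_kill[OF tor_vanishes_merge]) (auto simp: merge_idem fixA i)
  moreover obtain j where j: "i = Suc j" using i(2) by (cases i) auto
  ultimately show ?thesis
    using minimal by (intro rank_eq_0_if_tor_vanishes[of ?m] is_ideal_subst_ker) (auto simp: mem)
qed

lemma rank_lower:
  assumes t: "t \<ge> 1"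
  shows "rk (card A) \<noteq> 0"
proof -
  have "A \<noteq> {}" using child(1) by auto
  \<comment> \<open>A non-root of maximal height is a leaf.\<close>
  then obtain v where leaf: "v \<in> A" "\<And>u. u \<in> A \<Longrightarrow> q u \<noteq> v"
    using ex_max_nat[of A h] height by (metis finite_class.finite_UNIV finite_subset leD subset_UNIV)
  obtain u where u: "\<not> in_power A q w t u" "\<And>x. x \<in> A \<Longrightarrow> in_power A q w t (\<lambda>y. u y + of_bool (y = x))"
    using socle_exists[where A = A and q = q and w = w, OF finite leaf(1) q_neq[OF leaf(1)] leaf(2) w_pos q_neq inner t] by auto
  let ?q = "Poly_Mapping.single (monomial_of u) 1 :: ('v, 'k) mpoly"
  have "?q \<notin> power_ideal t"
    using u(1) by (simp add: power_ideal_def monomial_ideal_def)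
  moreover have "x * ?q \<in> power_ideal t" if x: "x \<in> Var ` A" for x
  proof -
    obtain v where v: "v \<in> A" "x = Var v" using x by blast
    have "lookup (Poly_Mapping.single v 1 + monomial_of u) = (\<lambda>y. u y + of_bool (y = v))"
      by (auto simp: lookup_add lookup_single when_def)
    then show ?thesis
      using u(2)[OF v(1)] by (simp add: v(2) Var_def mult_single power_ideal_def monomial_ideal_def)
  qed
  ultimately have base: "nonzero_class (Var ` A) {0} 0" by (rule nonzero_class_0)
  \<comment> \<open>Each variable killed raises the degree of the class by one, and all of A
    continues to annihilate it; W = A gives degree |A|.\<close>
  have "nonzero_class (Var ` A) (subst_ker (merge_kill (\<lambda>v. v) W)) (card W)" if "W \<subseteq> A" for W
  proof -
    have "finite W" by simp
    then show ?thesis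
      using that
    proof (induction W rule: finite_induct)
      case empty
      then show ?case using base by (simp add: subst_ker_Var)
    next
      case (insert x W)
      have tor: "tor_vanishes (subst_ker (merge_kill (\<lambda>v. v) W)) (card W)"
        by (rule tor_vanishes_kill) (auto simp: subst_ker_Var tor_vanishes_zero)
      have IH: "nonzero_class (Var ` A) (subst_ker (merge_kill (\<lambda>v. v) W)) (card W)"
        using insert by auto
      note ker = subst_ker_kill[where \<rho> = "\<lambda>v. v", OF refl refl insert.hyps(2)]
      have x: "Var x \<in> Var ` A" using insert.prems by blast
      have "nonzero_class (Var ` A) (subst_ker (merge_kill (\<lambda>v. v) (insert x W))) (Suc (card W))"
        by (rule nonzero_class_step[OF is_ideal_subst_ker is_ideal_subst_ker ker(1,2) x])
          (fact ker(3,4) tor IH)+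
      then show ?case using insert by simp
    qed
  qed
  then show ?thesis using rank_nonzero by blast
qed

end

section \<open>Multigraded syzygies\<close>

text \<open>Gaussian elimination, one coordinate b at a time: either U vanishes at b, or some g with
  \<open>g b\<close> nonzero clears that coordinate from all others.\<close>

lemma finite_spanning_subset:
  fixes U :: "('i \<Rightarrow> 'k::field) set"
  assumes "finite B" and "\<And>f c. f \<in> U \<Longrightarrow> c \<notin> B \<Longrightarrow> f c = 0"
    and "\<And>f g a. f \<in> U \<Longrightarrow> g \<in> U \<Longrightarrow> (\<lambda>c. f c - a * g c) \<in> U"
  shows "\<exists>T. finite T \<and> T \<subseteq> U \<and> (\<forall>f\<in>U. \<exists>k. \<forall>c. f c = (\<Sum>t\<in>T. k t * t c))"
  using assms
proof (induction B arbitrary: U rule: finite_induct)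
  case empty
  then show ?case by (intro exI[of _ "{}"]) auto
next
  case (insert b B U)
  define U' where "U' = {f \<in> U. f b = 0}"
  have "\<exists>T. finite T \<and> T \<subseteq> U' \<and> (\<forall>f\<in>U'. \<exists>k. \<forall>c. f c = (\<Sum>t\<in>T. k t * t c))"
  proof (rule insert.IH)
    show "f c = 0" if "f \<in> U'" "c \<notin> B" for f c
      using insert.prems(1)[of f c] that by (cases "c = b") (auto simp: U'_def)
  qed (use insert.prems(2) in \<open>auto simp: U'_def\<close>)
  then obtain T where T: "finite T" "T \<subseteq> U'" "\<forall>f\<in>U'. \<exists>k. \<forall>c. f c = (\<Sum>t\<in>T. k t * t c)"
    by blast
  show ?case
  proof (cases "U = U'")
    case True
    then show ?thesis using T by blast
  next
    case False
    then obtain g where g: "g \<in> U" "g b \<noteq> 0" by (auto simp: U'_def)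
    have gT: "g \<notin> T" using g T(2) by (auto simp: U'_def)
    have "\<exists>k. \<forall>c. f c = (\<Sum>t\<in>insert g T. k t * t c)" if f: "f \<in> U" for f
    proof -
      have "(\<lambda>c. f c - (f b / g b) * g c) \<in> U'"
        using insert.prems(2)[OF f g(1), of "f b / g b"] g(2) by (simp add: U'_def)
      then obtain k where k: "\<And>c. f c - (f b / g b) * g c = (\<Sum>t\<in>T. k t * t c)"
        using T(3) by fastforce
      have "f c = (\<Sum>t\<in>insert g T. (k(g := f b / g b)) t * t c)" for c
      proof -
        have "(\<Sum>t\<in>T. (k(g := f b / g b)) t * t c) = (\<Sum>t\<in>T. k t * t c)"
          using gT by (intro sum.cong) auto
        then show ?thesis using k[of c] T(1) gT by (simp add: algebra_simps)
      qed
      then show ?thesis by blast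
    qed
    then show ?thesis
      using T(1,2) g(1) by (intro exI[of _ "insert g T"]) (auto simp: U'_def)
  qed
qed

text \<open>The degree M part of a coefficient at a basis vector of degree N. Subtraction truncates,
  so the test says that x^N divides x^M.\<close>

definition component :: "('v \<Rightarrow>\<^sub>0 nat) \<Rightarrow> ('v \<Rightarrow>\<^sub>0 nat) \<Rightarrow> ('v, 'k::field) mpoly \<Rightarrow> ('v, 'k) mpoly" where
  "component M N u = (if M - N + N = M then Poly_Mapping.single (M - N) (lookup u (M - N)) else 0)"

lemma lookup_component: "lookup (component M N u) m = (if m + N = M then lookup u m else 0)"
  by (auto simp: component_def lookup_single when_def)

lemma homogeneous_entry_cases:
  fixes a :: "('v, 'k::field) mpoly"
  assumes "\<And>m. m \<in> keys a \<Longrightarrow> m + D = N"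
  shows "a = 0 \<or> (\<exists>k c. a = Poly_Mapping.single k c \<and> k + D = N)"
proof (cases "a = 0")
  case False
  then obtain k where k: "k \<in> keys a" by (metis Poly_Mapping.keys_eq_empty ex_in_conv)
  have "lookup a m = lookup (Poly_Mapping.single k (lookup a k)) m" for m
    using assms[of m] assms[OF k] by (cases "lookup a m = 0") (auto simp: lookup_single when_def in_keys_iff)
  then have "a = Poly_Mapping.single k (lookup a k)" by (intro poly_mapping_eqI)
  then show ?thesis using assms[OF k] by blast
qed simp

lemma lookup_component_mult:
  fixes a u :: "('v, 'k::field) mpoly"
  assumes "\<And>m. m \<in> keys a \<Longrightarrow> m + D = N"
  shows "lookup (component M N u * a) m = (if m + D = M then lookup (u * a) m else 0)"
proof (cases "a = 0")
  case False
  then obtain k c where single: "a = Poly_Mapping.single k c" "k + D = N"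
    using homogeneous_entry_cases[of a D N] assms by auto
  have comm: "f * a = Poly_Mapping.single k c * f" for f by (simp add: single mult.commute)
  show ?thesis
  proof (cases "\<exists>m'. m = k + m'")
    case True
    then obtain m' where m: "m = k + m'" by blast
    have "m + D = M \<longleftrightarrow> m' + N = M" using single(2) m by (metis add.assoc add.commute)
    then show ?thesis
      unfolding comm m by (simp add: lookup_single_mult_add lookup_component)
  next
    case False
    then show ?thesis unfolding comm by (simp add: lookup_single_mult_eq_0)
  qed
qed simp

definition homogeneous_vec ::
    "nat \<Rightarrow> (nat \<Rightarrow> 'v \<Rightarrow>\<^sub>0 nat) \<Rightarrow> ('v \<Rightarrow>\<^sub>0 nat) \<Rightarrow> (nat \<Rightarrow> ('v, 'k::field) mpoly) \<Rightarrow> bool" where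
  "homogeneous_vec r Ds M v \<longleftrightarrow> (\<forall>c. \<forall>m\<in>keys (v c). m + Ds c = M) \<and> (\<forall>c\<ge>r. v c = 0)"

abbreviation mono_le :: "('v \<Rightarrow>\<^sub>0 nat) \<Rightarrow> ('v \<Rightarrow>\<^sub>0 nat) \<Rightarrow> bool" where
  "mono_le M L \<equiv> \<forall>x. lookup M x \<le> lookup L x"

text \<open>
  Multigraded submodules of a free module of rank \<open>r\<close> on generators of degrees \<open>Ds c\<close>. By the last
  condition they are generated in degrees dividing \<open>L\<close>; it passes to the next syzygies because
  whether \<open>Ds c\<close> divides \<open>M\<close> depends only on \<open>gcd(M, L)\<close>.
\<close>

definition multigraded_submodule ::
    "('v \<Rightarrow>\<^sub>0 nat) \<Rightarrow> nat \<Rightarrow> (nat \<Rightarrow> 'v \<Rightarrow>\<^sub>0 nat) \<Rightarrow> (nat \<Rightarrow> ('v, 'k::field) mpoly) set \<Rightarrow> bool" where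
  "multigraded_submodule L r Ds Z \<longleftrightarrow>
     (\<forall>v\<in>Z. \<forall>c\<ge>r. v c = 0) \<and> (\<lambda>_. 0) \<in> Z \<and>
     (\<forall>u\<in>Z. \<forall>v\<in>Z. (\<lambda>c. u c + v c) \<in> Z) \<and> (\<forall>a. \<forall>v\<in>Z. (\<lambda>c. a * v c) \<in> Z) \<and>
     (\<forall>v\<in>Z. \<forall>M. (\<lambda>c. component M (Ds c) (v c)) \<in> Z) \<and>
     (\<forall>v\<in>Z. \<forall>M. homogeneous_vec r Ds M v \<longrightarrow>
        (\<exists>M' k. \<exists>v'\<in>Z. mono_le M' L \<and> homogeneous_vec r Ds M' v' \<and> v = (\<lambda>c. Poly_Mapping.single k 1 * v' c)))"

lemma multigraded_submoduleD:
  assumes "multigraded_submodule L r Ds Z" "v \<in> Z"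
  shows "c \<ge> r \<Longrightarrow> v c = 0" "u \<in> Z \<Longrightarrow> (\<lambda>c. u c + v c) \<in> Z" "(\<lambda>c. a * v c) \<in> Z"
    "(\<lambda>c. component M (Ds c) (v c)) \<in> Z"
    "homogeneous_vec r Ds M v \<Longrightarrow>
      \<exists>M' k. \<exists>v'\<in>Z. mono_le M' L \<and> homogeneous_vec r Ds M' v' \<and> v = (\<lambda>c. Poly_Mapping.single k 1 * v' c)"
  using assms unfolding multigraded_submodule_def by (fast, fast, fast, fast, fast)

definition gen_span :: "(nat \<Rightarrow> 'a::comm_ring_1) set \<Rightarrow> (nat \<Rightarrow> 'a) set" where
  "gen_span T = {z. \<exists>u. \<forall>i. z i = (\<Sum>v\<in>T. u v * v i)}"

lemma gen_span_zero: "(\<lambda>_. 0) \<in> gen_span T"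
  unfolding gen_span_def by (auto intro!: exI[of _ "\<lambda>_. 0"])

lemma gen_span_add:
  assumes "y \<in> gen_span T" "z \<in> gen_span T"
  shows "(\<lambda>i. y i + z i) \<in> gen_span T"
proof -
  obtain u u' where "\<forall>i. y i = (\<Sum>v\<in>T. u v * v i)" "\<forall>i. z i = (\<Sum>v\<in>T. u' v * v i)"
    using assms unfolding gen_span_def by blast
  then show ?thesis
    unfolding gen_span_def by (auto intro!: exI[of _ "\<lambda>v. u v + u' v"] simp: distrib_right sum.distrib)
qed

lemma gen_span_scale:
  assumes "z \<in> gen_span T"
  shows "(\<lambda>i. a * z i) \<in> gen_span T"
proof -
  obtain u where "\<forall>i. z i = (\<Sum>v\<in>T. u v * v i)"
    using assms unfolding gen_span_def by blast
  then show ?thesis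
    unfolding gen_span_def by (auto intro!: exI[of _ "\<lambda>v. a * u v"] simp: sum_distrib_left mult.assoc)
qed

lemma gen_span_sum:
  assumes "finite B" "\<And>b. b \<in> B \<Longrightarrow> f b \<in> gen_span T"
  shows "(\<lambda>i. \<Sum>b\<in>B. f b i) \<in> gen_span T"
  using assms by (induction B rule: finite_induct) (auto intro: gen_span_zero gen_span_add)

lemma gen_span_base:
  assumes "finite T" "v \<in> T"
  shows "v \<in> gen_span T"
proof -
  have "v i = (\<Sum>x\<in>T. (if x = v then 1 else 0) * x i)" for i
    using assms by (simp add: if_distrib[of "\<lambda>a. a * _"] cong: if_cong)
  then show ?thesis
    unfolding gen_span_def by (intro CollectI exI[of _ "\<lambda>x. if x = v then 1 else 0"]) simp
qed

lemma gen_span_subset: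
  assumes "finite T" "T \<subseteq> gen_span T'"
  shows "gen_span T \<subseteq> gen_span T'"
proof
  fix z assume "z \<in> gen_span T"
  then obtain u where u: "\<And>i. z i = (\<Sum>v\<in>T. u v * v i)" unfolding gen_span_def by blast
  have "(\<lambda>i. \<Sum>v\<in>T. u v * v i) \<in> gen_span T'"
    using assms by (intro gen_span_sum gen_span_scale) auto
  moreover have "z = (\<lambda>i. \<Sum>v\<in>T. u v * v i)" using u by auto
  ultimately show "z \<in> gen_span T'" by simp
qed

lemma vec_sum_components:
  fixes z :: "nat \<Rightarrow> ('v, 'k::field) mpoly" and Ds :: "nat \<Rightarrow> 'v \<Rightarrow>\<^sub>0 nat"
  assumes "\<And>c. c \<ge> r \<Longrightarrow> z c = 0"
  defines "Ms \<equiv> (\<Union>c<r. (\<lambda>m. m + Ds c) ` keys (z c))"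
  shows "finite Ms" "z i = (\<Sum>M\<in>Ms. component M (Ds i) (z i))"
proof -
  show fin: "finite Ms" by (simp add: Ms_def)
  show "z i = (\<Sum>M\<in>Ms. component M (Ds i) (z i))"
  proof (rule poly_mapping_eqI)
    fix m
    have "m + Ds i \<in> Ms" if "lookup (z i) m \<noteq> 0"
    proof -
      have "i < r" using assms(1)[of i] that by (cases "i < r") auto
      then show ?thesis unfolding Ms_def using that by (intro UN_I[of i]) (auto simp: in_keys_iff)
    qed
    then show "lookup (z i) m = lookup (\<Sum>M\<in>Ms. component M (Ds i) (z i)) m"
      using fin by (auto simp: lookup_sum lookup_component)
  qed
qed

text \<open>In a fixed degree M, coordinate c is a scalar times the monomial of exponent M - Ds c.
  The scalars, read off by \<open>co\<close>, form a subspace of k^r, and a finite spanning set over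
  k generates over S.\<close>

lemma homogeneous_finite_gens:
  fixes Z :: "(nat \<Rightarrow> ('v, 'k::field) mpoly) set"
  assumes Z: "multigraded_submodule L r Ds Z"
  shows "\<exists>T. finite T \<and> T \<subseteq> {v\<in>Z. homogeneous_vec r Ds M v} \<and> {v\<in>Z. homogeneous_vec r Ds M v} \<subseteq> gen_span T"
proof -
  let ?Z = "{v\<in>Z. homogeneous_vec r Ds M v}"
  define co where "co v c = lookup (v c) (M - Ds c)" for v :: "nat \<Rightarrow> ('v, 'k) mpoly" and c
  have co: "v c = Poly_Mapping.single (M - Ds c) (co v c)" if v: "v \<in> ?Z" for v c
  proof -
    have "\<And>m. m \<in> keys (v c) \<Longrightarrow> m + Ds c = M"
      using v by (auto simp: homogeneous_vec_def)
    then show ?thesis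
      using homogeneous_entry_cases[of "v c" "Ds c" M] by (auto simp: co_def)
  qed
  have "\<exists>T. finite T \<and> T \<subseteq> co ` ?Z \<and> (\<forall>f\<in>co ` ?Z. \<exists>k. \<forall>c. f c = (\<Sum>t\<in>T. k t * t c))"
  proof (rule finite_spanning_subset[of "{..<r}"])
    fix f c assume "f \<in> co ` ?Z" "c \<notin> {..<r}"
    then show "f c = 0" by (auto simp: co_def homogeneous_vec_def)
  next
    fix f g a assume "f \<in> co ` ?Z" "g \<in> co ` ?Z"
    then obtain u v where uv: "u \<in> ?Z" "v \<in> ?Z" "f = co u" "g = co v" by blast
    let ?x = "\<lambda>c. u c + Poly_Mapping.single 0 (- a) * v c"
    have lx: "lookup (?x c) m = lookup (u c) m - a * lookup (v c) m" for c m
      using lookup_single_mult_add[of 0 "- a" "v c" m] by (simp add: lookup_add)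
    have "?x \<in> Z"
      using multigraded_submoduleD(2,3)[OF Z] uv by blast
    moreover have "m + Ds c = M" if "m \<in> keys (?x c)" for m c
    proof -
      have "lookup (u c) m \<noteq> 0 \<or> lookup (v c) m \<noteq> 0"
        using that unfolding in_keys_iff lx by auto
      then show ?thesis using uv(1,2) by (auto simp: homogeneous_vec_def in_keys_iff)
    qed
    then have "homogeneous_vec r Ds M ?x"
      using uv(1,2) by (auto simp: homogeneous_vec_def)
    ultimately have "co ?x \<in> co ` ?Z" by blast
    moreover have "co ?x = (\<lambda>c. f c - a * g c)"
      by (rule ext) (simp only: co_def lx uv(3,4))
    ultimately show "(\<lambda>c. f c - a * g c) \<in> co ` ?Z" by simp
  qed simp
  then obtain T where T: "finite T" "T \<subseteq> co ` ?Z"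
    "\<And>f. f \<in> co ` ?Z \<Longrightarrow> \<exists>k. \<forall>c. f c = (\<Sum>t\<in>T. k t * t c)" by blast
  obtain T' where T': "T' \<subseteq> ?Z" "finite T'" "T = co ` T'"
    using finite_subset_image[OF T(1,2)] by blast
  have "v \<in> gen_span T'" if v: "v \<in> ?Z" for v
  proof -
    obtain k where k: "\<And>c. co v c = (\<Sum>t\<in>T. k t * t c)" using T(3) v by blast
    define g where "g = inv_into T' co"
    have g: "g t \<in> T'" "co (g t) = t" if "t \<in> T" for t
      using that T'(3) by (simp_all add: g_def f_inv_into_f inv_into_into)
    have "v = (\<lambda>c. \<Sum>t\<in>T. Poly_Mapping.single 0 (k t) * g t c)"
    proof
      fix c
      have "Poly_Mapping.single 0 (k t) * g t c = Poly_Mapping.single (M - Ds c) (k t * t c)" if "t \<in> T" for t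
        using co[of "g t" c] g[OF that] T'(1) by (auto simp: mult_single)
      moreover have "Poly_Mapping.single (M - Ds c) (\<Sum>t\<in>T. k t * t c) =
          (\<Sum>t\<in>T. Poly_Mapping.single (M - Ds c) (k t * t c))"
        using T(1) by (induction T rule: finite_induct) (simp_all add: single_add)
      ultimately show "v c = (\<Sum>t\<in>T. Poly_Mapping.single 0 (k t) * g t c)"
        using co[OF v, of c] k[of c] by simp
    qed
    moreover have "(\<lambda>c. \<Sum>t\<in>T. Poly_Mapping.single 0 (k t) * g t c) \<in> gen_span T'"
      using g(1) T'(2) by (intro gen_span_sum[OF T(1)] gen_span_scale gen_span_base)
    ultimately show ?thesis by simp
  qed
  then show ?thesis using T' by blast
qed

definition homogeneous_gens ::
    "('v \<Rightarrow>\<^sub>0 nat) \<Rightarrow> nat \<Rightarrow> (nat \<Rightarrow> 'v \<Rightarrow>\<^sub>0 nat) \<Rightarrow> (nat \<Rightarrow> ('v, 'k::field) mpoly) set \<Rightarrow>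
      (nat \<Rightarrow> ('v, 'k) mpoly) set \<Rightarrow> bool" where
  "homogeneous_gens L r Ds Z T \<longleftrightarrow> finite T \<and> T \<subseteq> Z \<and>
     (\<forall>v\<in>T. \<exists>M. mono_le M L \<and> homogeneous_vec r Ds M v) \<and> Z \<subseteq> gen_span T"

lemma finite_mono_le: "finite {M :: 'v::finite \<Rightarrow>\<^sub>0 nat. mono_le M L}"
proof -
  have "lookup ` {M. mono_le M L} \<subseteq> (\<Pi>\<^sub>E x\<in>UNIV. {..lookup L x})"
    by (auto simp: PiE_def extensional_def)
  moreover have "finite (\<Pi>\<^sub>E x\<in>(UNIV :: 'v set). {..lookup L x})"
    by (intro finite_PiE) auto
  ultimately have "finite (lookup ` {M. mono_le M L})"
    by (rule finite_subset)
  moreover have "inj_on lookup {M. mono_le M L}"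
    by (rule inj_onI) (simp only: poly_mapping_eq_iff)
  ultimately show ?thesis by (rule finite_imageD)
qed

text \<open>Finitely many degrees divide L, each contributing finitely many generators; any other
  homogeneous element is a monomial multiple of one in such a degree.\<close>

lemma ex_homogeneous_gens:
  fixes Z :: "(nat \<Rightarrow> ('v::finite, 'k::field) mpoly) set"
  assumes Z: "multigraded_submodule L r Ds Z"
  shows "\<exists>T. homogeneous_gens L r Ds Z T"
proof -
  let ?H = "\<lambda>M. {v\<in>Z. homogeneous_vec r Ds M v}"
  have "\<forall>M. \<exists>T. finite T \<and> T \<subseteq> ?H M \<and> ?H M \<subseteq> gen_span T"
    using homogeneous_finite_gens[OF Z] by (rule allI)
  then have "\<exists>T. \<forall>M. finite (T M) \<and> T M \<subseteq> ?H M \<and> ?H M \<subseteq> gen_span (T M)"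
    by (rule choice)
  then obtain T where T': "\<forall>M. finite (T M) \<and> T M \<subseteq> ?H M \<and> ?H M \<subseteq> gen_span (T M)"
    by (rule exE)
  have T: "finite (T M)" "T M \<subseteq> ?H M" "?H M \<subseteq> gen_span (T M)" for M
    using T' by (fast, fast, fast)
  define T' where "T' = (\<Union>M\<in>{M. mono_le M L}. T M)"
  have fin: "finite T'" unfolding T'_def using finite_mono_le T(1) by blast
  have hom: "v \<in> gen_span T'" if v: "v \<in> Z" "homogeneous_vec r Ds M v" for v M
  proof -
    obtain M' k v' where v': "v' \<in> Z" "mono_le M' L" "homogeneous_vec r Ds M' v'"
      "v = (\<lambda>c. Poly_Mapping.single k 1 * v' c)"
      using multigraded_submoduleD(5)[OF Z v] by blast
    have "T M' \<subseteq> T'" using v'(2) by (auto simp: T'_def)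
    then have "gen_span (T M') \<subseteq> gen_span T'"
      using gen_span_base[OF fin] by (intro gen_span_subset T(1)) blast
    then have "v' \<in> gen_span T'" using T(3) v'(1,3) by blast
    then show ?thesis unfolding v'(4) by (rule gen_span_scale)
  qed
  have "z \<in> gen_span T'" if z: "z \<in> Z" for z
  proof -
    have out: "z c = 0" if "c \<ge> r" for c by (rule multigraded_submoduleD(1)[OF Z z that])
    define Ms where "Ms = (\<Union>c<r. (\<lambda>m. m + Ds c) ` keys (z c))"
    note comps = vec_sum_components[where z = z and r = r and Ds = Ds, OF out, folded Ms_def]
    have "(\<lambda>c. component M (Ds c) (z c)) \<in> gen_span T'" for M
    proof (rule hom)
      show "(\<lambda>c. component M (Ds c) (z c)) \<in> Z"
        by (rule multigraded_submoduleD(4)[OF Z z])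
      show "homogeneous_vec r Ds M (\<lambda>c. component M (Ds c) (z c))"
        unfolding homogeneous_vec_def
        by (auto simp: in_keys_iff lookup_component out split: if_splits intro!: poly_mapping_eqI)
    qed
    then have "(\<lambda>c. \<Sum>M\<in>Ms. component M (Ds c) (z c)) \<in> gen_span T'"
      by (intro gen_span_sum comps(1))
    moreover have "z = (\<lambda>c. \<Sum>M\<in>Ms. component M (Ds c) (z c))"
      by (rule ext) (rule comps(2))
    ultimately show ?thesis by simp
  qed
  moreover have "v \<in> Z \<and> (\<exists>M. mono_le M L \<and> homogeneous_vec r Ds M v)" if v: "v \<in> T'" for v
  proof -
    obtain M where "mono_le M L" "v \<in> T M" using v by (auto simp: T'_def)
    then show ?thesis using T(2)[of M] by blast
  qed
  ultimately show ?thesis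
    unfolding homogeneous_gens_def using fin by (intro exI[of _ T'] conjI ballI subsetI) simp_all
qed

text \<open>A generating set of least size works: a relation with a nonzero constant term at v0
  would express v0 through the other generators.\<close>

lemma ex_minimal_gens:
  fixes Z :: "(nat \<Rightarrow> ('v::finite, 'k::field) mpoly) set"
  assumes Z: "multigraded_submodule L r Ds Z"
  shows "\<exists>T. homogeneous_gens L r Ds Z T \<and>
    (\<forall>u. (\<forall>i. (\<Sum>v\<in>T. u v * v i) = 0) \<longrightarrow> (\<forall>v\<in>T. lookup (u v) 0 = 0))"
proof -
  obtain T where T: "homogeneous_gens L r Ds Z T"
    and min: "\<And>T'. homogeneous_gens L r Ds Z T' \<Longrightarrow> card T \<le> card T'"
    using ex_has_least_nat[where P = "homogeneous_gens L r Ds Z" and m = card] ex_homogeneous_gens[OF Z]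
    by blast
  have fin: "finite T" using T by (simp add: homogeneous_gens_def)
  obtain dg where dg: "\<And>v. v \<in> T \<Longrightarrow> homogeneous_vec r Ds (dg v) v"
    using T unfolding homogeneous_gens_def by metis
  have "lookup (u v0) 0 = 0" if u: "\<And>i. (\<Sum>v\<in>T. u v * v i) = 0" and v0: "v0 \<in> T" for u v0
  proof (rule ccontr)
    assume nz: "lookup (u v0) 0 \<noteq> 0"
    \<comment> \<open>The part of the relation in the degree of v0 has at v0 the pure constant b,
      which is invertible.\<close>
    define u' where "u' v = component (dg v0) (dg v) (u v)" for v
    have rel: "(\<Sum>v\<in>T. u' v * v i) = 0" for i
    proof (rule poly_mapping_eqI)
      fix m
      have "lookup (u' v * v i) m = (if m + Ds i = dg v0 then lookup (u v * v i) m else 0)" if "v \<in> T" for v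
        unfolding u'_def using dg[OF that] by (intro lookup_component_mult) (auto simp: homogeneous_vec_def)
      then have "lookup (\<Sum>v\<in>T. u' v * v i) m = (if m + Ds i = dg v0 then lookup (\<Sum>v\<in>T. u v * v i) m else 0)"
        by (simp add: lookup_sum)
      then show "lookup (\<Sum>v\<in>T. u' v * v i) m = lookup 0 m" by (simp add: u)
    qed
    define b where "b = lookup (u v0) 0"
    have u'0: "u' v0 = Poly_Mapping.single 0 b"
      by (rule poly_mapping_eqI) (auto simp: u'_def b_def lookup_component lookup_single when_def)
    have v0i: "v0 i = (\<Sum>v\<in>T - {v0}. (Poly_Mapping.single 0 (- inverse b) * u' v) * v i)" for i
    proof -
      have "Poly_Mapping.single 0 b * v0 i = - (\<Sum>v\<in>T - {v0}. u' v * v i)"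
        using rel[of i] fin v0 u'0 by (simp add: sum.remove[of T v0] eq_neg_iff_add_eq_0)
      then have "Poly_Mapping.single 0 (inverse b) * (Poly_Mapping.single 0 b * v0 i) =
          Poly_Mapping.single 0 (inverse b) * (- (\<Sum>v\<in>T - {v0}. u' v * v i))" by simp
      moreover have "Poly_Mapping.single 0 (inverse b) * Poly_Mapping.single 0 b = (1 :: ('v, 'k) mpoly)"
        using nz by (simp add: mult_single b_def)
      ultimately show ?thesis
        by (simp add: single_uminus sum_distrib_left mult.assoc[symmetric] sum_negf)
    qed
    have fin': "finite (T - {v0})" using fin by simp
    have "v0 \<in> gen_span (T - {v0})"
      unfolding gen_span_def using v0i by (auto intro!: exI[of _ "\<lambda>v. Poly_Mapping.single 0 (- inverse b) * u' v"])
    then have "T \<subseteq> gen_span (T - {v0})" using gen_span_base[OF fin'] by blast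
    then have "gen_span T \<subseteq> gen_span (T - {v0})" by (rule gen_span_subset[OF fin])
    then have "homogeneous_gens L r Ds Z (T - {v0})"
      using T unfolding homogeneous_gens_def by blast
    then have "card T \<le> card (T - {v0})" by (rule min)
    then show False using card_Diff1_less[OF fin v0] by simp
  qed
  then show ?thesis using T by blast
qed

section \<open>Minimal presentations and their syzygies\<close>

text \<open>One step of a minimal multigraded resolution. Minimality is put as a property of
  relations and will exclude constant terms from the next matrix.\<close>

definition syzygy_step ::
    "('v \<Rightarrow>\<^sub>0 nat) \<Rightarrow> nat \<Rightarrow> (nat \<Rightarrow> 'v \<Rightarrow>\<^sub>0 nat) \<Rightarrow> (nat \<Rightarrow> ('v, 'k::field) mpoly) set \<Rightarrow>
      nat \<Rightarrow> (nat \<Rightarrow> 'v \<Rightarrow>\<^sub>0 nat) \<Rightarrow> (nat \<Rightarrow> nat \<Rightarrow> ('v, 'k) mpoly) \<Rightarrow> bool" where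
  "syzygy_step L r Ds Z r' Ds' A \<longleftrightarrow>
     (\<forall>c<r'. mono_le (Ds' c) L) \<and> (\<forall>c. homogeneous_vec r Ds (Ds' c) (\<lambda>i. A i c)) \<and>
     (\<forall>i. \<forall>c\<ge>r'. A i c = 0) \<and> Z = range (mat_app A r') \<and>
     (\<forall>v. (\<forall>i. mat_app A r' v i = 0) \<longrightarrow> (\<forall>c<r'. lookup (v c) 0 = 0))"

lemma ex_syzygy_step:
  fixes Z :: "(nat \<Rightarrow> ('v::finite, 'k::field) mpoly) set"
  assumes Z: "multigraded_submodule L r Ds Z"
  shows "\<exists>r' Ds' A. syzygy_step L r Ds Z r' Ds' A"
proof -
  obtain T where T: "homogeneous_gens L r Ds Z T"
    and min: "\<And>u. \<forall>i. (\<Sum>v\<in>T. u v * v i) = 0 \<Longrightarrow> \<forall>v\<in>T. lookup (u v) 0 = 0"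
    using ex_minimal_gens[OF Z] by blast
  have fin: "finite T" and TZ: "T \<subseteq> Z" and ZT: "Z \<subseteq> gen_span T"
    using T by (auto simp: homogeneous_gens_def)
  obtain g where g: "bij_betw g {0..<card T} T"
    using ex_bij_betw_nat_finite[OF fin] by blast
  have gT: "g c \<in> T" if "c < card T" for c
    using g that by (auto simp: bij_betw_def)
  obtain dg where dg: "\<And>v. v \<in> T \<Longrightarrow> mono_le (dg v) L \<and> homogeneous_vec r Ds (dg v) v"
    using T unfolding homogeneous_gens_def by metis
  define A where "A i c = (if c < card T then g c i else 0)" for i c
  have app: "mat_app A (card T) (\<lambda>c. u (g c)) i = (\<Sum>v\<in>T. u v * v i)" for u i
  proof -
    have "(\<Sum>v\<in>T. u v * v i) = (\<Sum>c\<in>{0..<card T}. u (g c) * g c i)"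
      using sum.reindex_bij_betw[OF g, of "\<lambda>v. u v * v i"] by simp
    then show ?thesis by (auto simp: mat_app_def A_def mult.commute lessThan_atLeast0 intro!: sum.cong)
  qed
  have inv: "\<exists>u. \<forall>c<card T. v c = u (g c)" for v :: "nat \<Rightarrow> ('v, 'k) mpoly"
    using g by (intro exI[of _ "\<lambda>x. v (the_inv_into {0..<card T} g x)"])
      (auto simp: bij_betw_def the_inv_into_f_f)
  have app': "\<exists>u. (\<forall>c<card T. v c = u (g c)) \<and> mat_app A (card T) v = (\<lambda>i. \<Sum>x\<in>T. u x * x i)" for v
  proof -
    obtain u where u: "\<forall>c<card T. v c = u (g c)" using inv by blast
    then have "mat_app A (card T) v i = mat_app A (card T) (\<lambda>c. u (g c)) i" for i
      by (intro mat_app_cong) auto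
    then show ?thesis using u app by (intro exI[of _ u]) auto
  qed
  have "Z = range (mat_app A (card T))"
  proof
    show "Z \<subseteq> range (mat_app A (card T))"
    proof
      fix z assume "z \<in> Z"
      then obtain u where "\<And>i. z i = (\<Sum>v\<in>T. u v * v i)" using ZT by (auto simp: gen_span_def)
      then have "z = mat_app A (card T) (\<lambda>c. u (g c))" using app by auto
      then show "z \<in> range (mat_app A (card T))" by blast
    qed
    show "range (mat_app A (card T)) \<subseteq> Z"
    proof safe
      fix v
      obtain u where u: "mat_app A (card T) v = (\<lambda>i. \<Sum>x\<in>T. u x * x i)" using app' by blast
      have "(\<lambda>i. \<Sum>x\<in>B. u x * x i) \<in> Z" if "finite B" "B \<subseteq> T" for B
        using that
      proof (induction B rule: finite_induct)
        case empty
        then show ?case using Z by (simp add: multigraded_submodule_def)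
      next
        case (insert x B)
        then have "(\<lambda>i. u x * x i) \<in> Z" "(\<lambda>i. \<Sum>x\<in>B. u x * x i) \<in> Z"
          using multigraded_submoduleD(3)[OF Z] TZ by auto
        then have "(\<lambda>i. u x * x i + (\<Sum>x\<in>B. u x * x i)) \<in> Z"
          using multigraded_submoduleD(2)[OF Z] by blast
        then show ?case using insert by simp
      qed
      then show "mat_app A (card T) v \<in> Z" using u fin by simp
    qed
  qed
  moreover have "lookup (v c) 0 = 0" if v: "\<forall>i. mat_app A (card T) v i = 0" and c: "c < card T" for v c
  proof -
    obtain u where u: "\<forall>c<card T. v c = u (g c)" "mat_app A (card T) v = (\<lambda>i. \<Sum>x\<in>T. u x * x i)"
      using app' by blast
    then have "\<forall>i. (\<Sum>x\<in>T. u x * x i) = 0" using v by auto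
    then show ?thesis using min[of u] u(1) gT[OF c] c by simp
  qed
  moreover have "homogeneous_vec r Ds (dg (g c)) (\<lambda>i. A i c)" for c
    using dg[OF gT] by (auto simp: A_def homogeneous_vec_def)
  ultimately show ?thesis
    unfolding syzygy_step_def using dg[OF gT]
    by (intro exI[of _ "card T"] exI[of _ "\<lambda>c. dg (g c)"] exI[of _ A]) (auto simp: A_def)
qed

definition syzygies :: "nat \<Rightarrow> (nat \<Rightarrow> nat \<Rightarrow> ('v, 'k::field) mpoly) \<Rightarrow> (nat \<Rightarrow> ('v, 'k) mpoly) set" where
  "syzygies r A = {v. (\<forall>c\<ge>r. v c = 0) \<and> (\<forall>i. mat_app A r v i = 0)}"

lemma multigraded_submodule_syzygies:
  assumes step: "syzygy_step L r Ds Z r' Ds' A"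
  shows "multigraded_submodule L r' Ds' (syzygies r' A)"
proof -
  have hom: "m + Ds i = Ds' c" if "m \<in> keys (A i c)" for m i c
    using step that by (auto simp: syzygy_step_def homogeneous_vec_def)
  have comp: "(\<lambda>c. component M (Ds' c) (v c)) \<in> syzygies r' A" if v: "v \<in> syzygies r' A" for v M
  proof -
    have "mat_app A r' (\<lambda>c. component M (Ds' c) (v c)) i = 0" for i
    proof (rule poly_mapping_eqI)
      fix m
      have "lookup (A i c * component M (Ds' c) (v c)) m = (if m + Ds i = M then lookup (A i c * v c) m else 0)" for c
        using lookup_component_mult[of "A i c" "Ds i" "Ds' c" M "v c" m] hom by (simp add: mult.commute)
      then have "lookup (mat_app A r' (\<lambda>c. component M (Ds' c) (v c)) i) m =
          (if m + Ds i = M then lookup (mat_app A r' v i) m else 0)"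
        by (simp add: mat_app_def lookup_sum)
      then show "lookup (mat_app A r' (\<lambda>c. component M (Ds' c) (v c)) i) m = lookup 0 m"
        using v by (simp add: syzygies_def)
    qed
    then show ?thesis
      using v by (auto simp: syzygies_def lookup_component intro!: poly_mapping_eqI)
  qed
  have bound: "\<exists>M' k. \<exists>v'\<in>syzygies r' A. mono_le M' L \<and> homogeneous_vec r' Ds' M' v' \<and>
      v = (\<lambda>c. Poly_Mapping.single k 1 * v' c)"
    if v: "v \<in> syzygies r' A" and hv: "homogeneous_vec r' Ds' M v" for v M
  proof -
    \<comment> \<open>Truncated subtraction makes \<open>M'\<close> the gcd of M and L. Every
      \<open>Ds' c\<close> with a nonzero coordinate divides both.\<close>
    define M' where "M' = M - (M - L)"
    define k where "k = M - L"
    have M': "lookup M' x = min (lookup M x) (lookup L x)" for x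
      by (simp add: M'_def lookup_minus)
    have M: "M = k + M'"
      by (rule poly_mapping_eqI) (simp add: k_def lookup_add lookup_minus M')
    have "\<exists>x. v c = Poly_Mapping.single k 1 * x \<and> (\<forall>m\<in>keys x. m + Ds' c = M') \<and> (c \<ge> r' \<longrightarrow> x = 0)" for c
    proof (cases "v c = 0")
      case True
      then show ?thesis by (intro exI[of _ 0]) simp
    next
      case False
      have "\<And>m. m \<in> keys (v c) \<Longrightarrow> m + Ds' c = M" using hv by (auto simp: homogeneous_vec_def)
      then obtain l a where l: "v c = Poly_Mapping.single l a" "l + Ds' c = M"
        using homogeneous_entry_cases[of "v c" "Ds' c" M] False by auto
      have c: "c < r'" using False hv by (auto simp: homogeneous_vec_def not_less[symmetric])
      have "lookup (Ds' c) x \<le> lookup M' x" for x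
      proof -
        have "lookup (Ds' c) x \<le> lookup L x" using step c by (simp add: syzygy_step_def)
        moreover have "lookup (Ds' c) x \<le> lookup M x" unfolding l(2)[symmetric] by (simp add: lookup_add)
        ultimately show ?thesis by (simp add: M')
      qed
      then obtain l' where l': "M' = Ds' c + l'" using monom_diff_add by blast
      have "l + Ds' c = (k + l') + Ds' c" using l(2) M l' by (simp add: ac_simps)
      then have "l = k + l'" by simp
      then show ?thesis
        using l(1) l' c by (intro exI[of _ "Poly_Mapping.single l' a"]) (auto simp: mult_single ac_simps)
    qed
    then obtain v' where v': "\<And>c. v c = Poly_Mapping.single k 1 * v' c"
      "\<And>c m. m \<in> keys (v' c) \<Longrightarrow> m + Ds' c = M'" "\<And>c. c \<ge> r' \<Longrightarrow> v' c = 0"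
      by metis
    \<comment> \<open>Multiplication by a monomial is injective, so \<open>v'\<close> is a syzygy
      because \<open>v\<close> is.\<close>
    have "mat_app A r' v' i = 0" for i
    proof (rule poly_mapping_eqI)
      fix m
      have "v = (\<lambda>c. Poly_Mapping.single k 1 * v' c)" using v'(1) by auto
      then have "Poly_Mapping.single k 1 * mat_app A r' v' i = 0"
        using v mat_app_scale[of A r' "Poly_Mapping.single k 1" v' i] by (simp add: syzygies_def)
      then show "lookup (mat_app A r' v' i) m = lookup 0 m"
        using lookup_single_mult_add[of k 1 "mat_app A r' v' i" m] by simp
    qed
    then have "v' \<in> syzygies r' A" using v'(3) by (simp add: syzygies_def)
    moreover have "homogeneous_vec r' Ds' M' v'" using v'(2,3) by (auto simp: homogeneous_vec_def)
    moreover have "mono_le M' L" by (simp add: M')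
    ultimately show ?thesis using v'(1) by blast
  qed
  have "(\<lambda>_. 0) \<in> syzygies r' A"
    by (simp add: syzygies_def mat_app_def)
  moreover have "(\<lambda>c. u c + v c) \<in> syzygies r' A" if "u \<in> syzygies r' A" "v \<in> syzygies r' A" for u v
    using that by (simp add: syzygies_def mat_app_add)
  moreover have "(\<lambda>c. a * v c) \<in> syzygies r' A" if "v \<in> syzygies r' A" for a v
    using that by (simp add: syzygies_def mat_app_scale)
  moreover have "\<forall>v\<in>syzygies r' A. \<forall>c\<ge>r'. v c = 0"
    by (simp add: syzygies_def)
  ultimately show ?thesis
    unfolding multigraded_submodule_def using comp bound by (intro conjI ballI allI impI) simp_all
qed

section \<open>Rooted forests\<close>

lemma relpow_shortest_inj:
  assumes xy: "(x, y) \<in> R\<^sup>*"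
  obtains f and n :: nat where "f 0 = x" "f n = y" "\<And>i. i < n \<Longrightarrow> (f i, f (Suc i)) \<in> R" "inj_on f {..n}"
proof -
  define n where "n = (LEAST n. (x, y) \<in> R ^^ n)"
  have "(x, y) \<in> R ^^ n"
    unfolding n_def using rtrancl_imp_relpow[OF xy] by (auto intro: LeastI)
  then obtain f where f: "f 0 = x" "f n = y" "\<And>i. i < n \<Longrightarrow> (f i, f (Suc i)) \<in> R"
    unfolding relpow_fun_conv by blast
  have neq: "f i \<noteq> f j" if ij: "i < j" "j \<le> n" for i j
  proof
    assume eq: "f i = f j"
    have "(x, f i) \<in> R ^^ i"
      unfolding relpow_fun_conv using f ij by (intro exI[of _ f]) auto
    moreover have "(f j, y) \<in> R ^^ (n - j)"
      unfolding relpow_fun_conv using f ij by (intro exI[of _ "\<lambda>k. f (j + k)"]) auto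
    ultimately have "(x, y) \<in> R ^^ (i + (n - j))"
      using eq by (auto simp: relpow_add)
    then have "n \<le> i + (n - j)" unfolding n_def by (rule Least_le)
    then show False using ij by linarith
  qed
  have "inj_on f {..n}"
    using neq by (intro inj_onI) (metis atMost_iff linorder_neqE_nat)
  then show ?thesis using that f by blast
qed

lemma sym_underlying: "sym (underlying F)"
  unfolding underlying_def by (auto intro!: symI)

text \<open>A shortest walk from the root to a parent of y avoids y, which is farther away. Two
  parents would thus be joined by a walk avoiding y, and a shortest such walk, closed up through y,
  is a cycle.\<close>

lemma rooted_tree_unique_parent:
  assumes tree: "rooted_tree C F" and e: "(x, y) \<in> F" "(x', y) \<in> F"
  shows "x = x'"
proof (rule ccontr)
  assume neq: "x \<noteq> x'"
  let ?U = "underlying F"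
  obtain r where r: "r \<in> C" and "\<forall>(x, y)\<in>F. graph_dist F r x < graph_dist F r y"
    using tree unfolding rooted_tree_def by blast
  then have dist: "graph_dist F r a < graph_dist F r b" if "(a, b) \<in> F" for a b
    using that by blast
  have FC: "F \<subseteq> C \<times> C" using tree by (auto simp: rooted_tree_def oriented_graph_def)
  have conn: "(r, v) \<in> ?U\<^sup>*" if "v \<in> C" for v
    using tree r that unfolding rooted_tree_def underlying_tree_def by blast
  define W where "W = ?U \<inter> {(a, b). a \<noteq> y \<and> b \<noteq> y}"
  have toW: "(r, v) \<in> W\<^sup>*" if v: "(v, y) \<in> F" for v
  proof -
    define n where "n = graph_dist F r v"
    obtain k where "(r, v) \<in> ?U ^^ k"
      using rtrancl_imp_relpow[OF conn] v FC by blast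
    then have "(r, v) \<in> ?U ^^ n"
      unfolding n_def graph_dist_def by (rule LeastI)
    then obtain f where f: "f 0 = r" "f n = v" "\<And>i. i < n \<Longrightarrow> (f i, f (Suc i)) \<in> ?U"
      unfolding relpow_fun_conv by blast
    have fy: "f i \<noteq> y" if "i \<le> n" for i
    proof
      assume eq: "f i = y"
      have "(r, y) \<in> ?U ^^ i"
        unfolding relpow_fun_conv using f that eq by (intro exI[of _ f]) auto
      then have "graph_dist F r y \<le> i" unfolding graph_dist_def by (rule Least_le)
      then show False using dist[OF v] that by (simp add: n_def)
    qed
    have "(r, v) \<in> W ^^ n"
      unfolding relpow_fun_conv using f fy by (intro exI[of _ f]) (auto simp: W_def)
    then show ?thesis by (rule relpow_imp_rtrancl)
  qed
  have "sym W" using sym_underlying[of F] by (auto simp: W_def sym_def)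
  then have "(x, r) \<in> W\<^sup>*" using toW[OF e(1)] by (meson sym_rtrancl symD)
  then have "(x, x') \<in> W\<^sup>*" using toW[OF e(2)] by (rule rtrancl_trans)
  then obtain f n where f: "f 0 = x" "f n = x'" "\<And>i. i < n \<Longrightarrow> (f i, f (Suc i)) \<in> W" "inj_on f {..n}"
    by (rule relpow_shortest_inj) (rule that)
  have n: "n > 0" using f(1,2) neq by (cases n) auto
  have fy: "f i \<noteq> y" if "i \<le> n" for i
    using f(3)[of i] f(3)[of "i - 1"] that n by (cases "i < n"; cases i) (auto simp: W_def)
  define vs where "vs = map f [0..<Suc n] @ [y]"
  have len: "length vs = n + 2" by (simp add: vs_def)
  have nth: "vs ! i = (if i \<le> n then f i else y)" if "i < n + 2" for i
    using that by (auto simp: vs_def nth_append)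
  have "is_cycle F vs"
    unfolding is_cycle_def
  proof (intro conjI allI impI)
    show "3 \<le> length vs" using n len by simp
    have "set [0..<Suc n] = {..n}" "y \<notin> f ` {..n}" using fy by auto
    then show "distinct vs"
      using f(4) by (simp add: vs_def distinct_map del: upt_Suc set_upt)
    fix i assume "i < length vs"
    then consider "i < n" | "i = n" | "i = Suc n" using len by linarith
    then show "(vs ! i, vs ! (Suc i mod length vs)) \<in> ?U"
    proof cases
      case 1
      then show ?thesis using f(3)[of i] by (simp add: len nth W_def)
    next
      case 2
      then show ?thesis using e(2) f(2) by (simp add: len nth underlying_def)
    next
      case 3
      then show ?thesis using e(1) f(1) by (simp add: len nth underlying_def)
    qed
  qed
  then show False using tree unfolding rooted_tree_def underlying_tree_def by blast
qed

lemma rooted_forest_edgeE: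
  assumes "rooted_forest V E"
  obtains P where "partition_on V P" "\<And>C. C \<in> P \<Longrightarrow> rooted_tree C (E \<inter> C \<times> C)"
    "\<And>x y. (x, y) \<in> E \<Longrightarrow> \<exists>C\<in>P. x \<in> C \<and> y \<in> C"
  using assms unfolding rooted_forest_def by (auto simp: subset_iff)

lemma rooted_forest_unique_parent:
  assumes forest: "rooted_forest V E" and e: "(x, y) \<in> E" "(x', y) \<in> E"
  shows "x = x'"
proof -
  obtain P where P: "partition_on V P" "\<And>C. C \<in> P \<Longrightarrow> rooted_tree C (E \<inter> C \<times> C)"
    "\<And>x y. (x, y) \<in> E \<Longrightarrow> \<exists>C\<in>P. x \<in> C \<and> y \<in> C"
    by (rule rooted_forest_edgeE[OF forest]) blast
  obtain C C' where C: "C \<in> P" "x \<in> C" "y \<in> C" "C' \<in> P" "x' \<in> C'" "y \<in> C'"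
    using P(3) e by meson
  then have "C = C'" using P(1) by (auto simp: partition_on_def disjoint_def)
  then show ?thesis
    using rooted_tree_unique_parent[OF P(2)[OF C(1)], of x y x'] e C by auto
qed

text \<open>The height is the distance from the root of the tree containing the vertex;
  \<open>comp\<close> selects that tree.\<close>

lemma rooted_forest_height:
  assumes forest: "rooted_forest V E"
  shows "\<exists>h :: 'v \<Rightarrow> nat. \<forall>(x, y)\<in>E. h x < h (y :: 'v)"
proof -
  obtain P where P: "partition_on V P" "\<And>C. C \<in> P \<Longrightarrow> rooted_tree C (E \<inter> C \<times> C)"
    "\<And>x y. (x, y) \<in> E \<Longrightarrow> \<exists>C\<in>P. x \<in> C \<and> y \<in> C"
    by (rule rooted_forest_edgeE[OF forest]) blast
  have "\<forall>C\<in>P. \<exists>r. \<forall>(x, y)\<in>E \<inter> C \<times> C. graph_dist (E \<inter> C \<times> C) r x < graph_dist (E \<inter> C \<times> C) r y"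
    using P(2) unfolding rooted_tree_def by blast
  then obtain r where r: "\<And>C. C \<in> P \<Longrightarrow>
      \<forall>(x, y)\<in>E \<inter> C \<times> C. graph_dist (E \<inter> C \<times> C) (r C) x < graph_dist (E \<inter> C \<times> C) (r C) y"
    by metis
  define comp where "comp x = (SOME C. C \<in> P \<and> x \<in> C)" for x
  have comp: "comp x = C" if "C \<in> P" "x \<in> C" for x C
  proof -
    have "comp x \<in> P \<and> x \<in> comp x" unfolding comp_def by (rule someI[of _ C]) (use that in blast)
    then show ?thesis using P(1) that by (auto simp: partition_on_def disjoint_def)
  qed
  define h where "h x = graph_dist (E \<inter> comp x \<times> comp x) (r (comp x)) x" for x
  have "h x < h y" if e: "(x, y) \<in> E" for x y
  proof -
    obtain C where C: "C \<in> P" "x \<in> C" "y \<in> C" using P(3)[OF e] by blast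
    then show ?thesis using r[OF C(1)] e by (auto simp: h_def comp)
  qed
  then show ?thesis by blast
qed

lemma weighted_forest_exists:
  fixes E :: "('v::finite \<times> 'v) set" and w :: "'v \<Rightarrow> nat"
  assumes graph: "vertex_weighted_oriented_graph UNIV E w"
    and forest: "rooted_forest UNIV E"
    and weight: "\<And>x. vdegree E x \<noteq> 1 \<Longrightarrow> w x \<ge> 2"
  shows "\<exists>A q ch h. weighted_forest A q ch w h \<and> E = (\<lambda>v. (q v, v)) ` A"
proof -
  obtain h where h: "\<And>x y. (x, y) \<in> E \<Longrightarrow> h x < (h y :: nat)"
    using rooted_forest_height[OF forest] by blast
  define A where "A = snd ` E"
  define q where "q v = (SOME u. (u, v) \<in> E)" for v
  define ch where "ch r = (SOME c. (r, c) \<in> E)" for r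
  have q: "(q v, v) \<in> E" if "v \<in> A" for v
    using that unfolding q_def A_def by (auto intro: someI)
  have q_eq: "q v = u" if "(u, v) \<in> E" for u v
  proof -
    have "v \<in> A" using that by (force simp: A_def)
    then show ?thesis by (rule rooted_forest_unique_parent[OF forest q that])
  qed
  have root: "\<exists>c. {y. (r, y) \<in> E} = {c}" if r: "r \<notin> A" for r
  proof -
    have src: "is_source E r" using r by (force simp: is_source_def A_def)
    then have "w r = 1" using graph by (auto simp: vertex_weighted_oriented_graph_def)
    then have "vdegree E r = 1" using weight[of r] by fastforce
    moreover have "{y. (r, y) \<in> underlying E} = {y. (r, y) \<in> E}"
      using src by (auto simp: underlying_def is_source_def)
    ultimately show ?thesis by (simp add: vdegree_def card_1_singleton_iff)
  qed
  have ch: "(r, ch r) \<in> E" if "r \<notin> A" for r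
    using root[OF that] unfolding ch_def by (metis (mono_tags) mem_Collect_eq singletonI someI)
  have "E = (\<lambda>v. (q v, v)) ` A"
    using q q_eq by (force simp: A_def)
  moreover have "weighted_forest A q ch w h"
  proof
    fix v assume v: "v \<in> A"
    show "h (q v) < h v" using h[OF q[OF v]] .
    then show "q v \<noteq> v" by auto
    show "w v \<ge> 1" using graph by (auto simp: vertex_weighted_oriented_graph_def)
    show "v = ch (q v)" if "q v \<notin> A"
      using root[OF that] ch[OF that] q[OF v] by (metis mem_Collect_eq singletonD)
    show "w (q v) \<ge> 2" if qv: "q v \<in> A"
    proof (rule weight)
      have sub: "{q (q v), v} \<subseteq> {y. (q v, y) \<in> underlying E}"
        using q[OF v] q[OF qv] by (auto simp: underlying_def)
      have "q (q v) \<noteq> v" using h[OF q[OF v]] h[OF q[OF qv]] by auto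
      then have "2 = card {q (q v), v}" by simp
      also have "\<dots> \<le> vdegree E (q v)" unfolding vdegree_def by (rule card_mono[OF _ sub]) simp
      finally show "vdegree E (q v) \<noteq> 1" by simp
    qed
  next
    fix r assume r: "r \<notin> A"
    show "ch r \<in> A" using ch[OF r] by (force simp: A_def)
    show "q (ch r) = r" using q_eq[OF ch[OF r]] .
  qed
  ultimately show ?thesis by blast
qed

section \<open>Existence of minimal resolutions and the projective dimension\<close>

lemma mat_mult_vec_index:
  assumes "B \<in> carrier_mat nr nc" "v \<in> carrier_vec nc" "r < nr"
  shows "(B *\<^sub>v v) $ r = mat_app (\<lambda>r c. B $$ (r, c)) nc (\<lambda>c. v $ c) r"
  using assms by (auto simp: mat_app_def scalar_prod_def lessThan_atLeast0 intro!: sum.cong)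

lemma mat_image_iff:
  assumes B: "B \<in> carrier_mat nr nc" and M: "\<And>r c. r < nr \<Longrightarrow> c < nc \<Longrightarrow> B $$ (r, c) = M r c"
  shows "v \<in> mat_image B \<longleftrightarrow> v \<in> carrier_vec nr \<and> (\<exists>u. \<forall>r<nr. v $ r = mat_app M nc u r)"
proof -
  have app: "mat_app (\<lambda>r c. B $$ (r, c)) nc u r = mat_app M nc u r" if "r < nr" for u r
    using M that by (simp add: mat_app_def)
  show ?thesis
  proof
    assume "v \<in> mat_image B"
    then obtain u where u: "v = B *\<^sub>v u" "u \<in> carrier_vec nc" using B by (auto simp: mat_image_def)
    then show "v \<in> carrier_vec nr \<and> (\<exists>u. \<forall>r<nr. v $ r = mat_app M nc u r)"
      using B mat_mult_vec_index[OF B u(2)] app by (auto intro!: exI[of _ "\<lambda>c. u $ c"])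
  next
    assume "v \<in> carrier_vec nr \<and> (\<exists>u. \<forall>r<nr. v $ r = mat_app M nc u r)"
    then obtain u where v: "v \<in> carrier_vec nr" "\<And>r. r < nr \<Longrightarrow> v $ r = mat_app M nc u r" by blast
    have u: "vec nc u \<in> carrier_vec nc" by simp
    have "v = B *\<^sub>v vec nc u"
    proof (rule eq_vecI)
      fix r assume "r < dim_vec (B *\<^sub>v vec nc u)"
      then have r: "r < nr" using B by simp
      have "mat_app M nc u r = mat_app M nc (\<lambda>c. vec nc u $ c) r" by (rule mat_app_cong) simp
      then show "v $ r = (B *\<^sub>v vec nc u) $ r"
        using v(2)[OF r] mat_mult_vec_index[OF B u r] app[OF r] by simp
    qed (use v(1) B in auto)
    then show "v \<in> mat_image B" using B unfolding mat_image_def by auto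
  qed
qed

lemma mat_kernel_iff:
  assumes B: "B \<in> carrier_mat nr nc" and M: "\<And>r c. r < nr \<Longrightarrow> c < nc \<Longrightarrow> B $$ (r, c) = M r c"
  shows "v \<in> mat_kernel B \<longleftrightarrow> v \<in> carrier_vec nc \<and> (\<forall>r<nr. mat_app M nc (\<lambda>c. v $ c) r = 0)"
proof -
  have app: "(B *\<^sub>v v) $ r = mat_app M nc (\<lambda>c. v $ c) r" if "r < nr" "v \<in> carrier_vec nc" for r
    using M that mat_mult_vec_index[OF B that(2,1)] by (simp add: mat_app_def)
  show ?thesis
    unfolding mat_kernel[OF B] using app B by (auto simp: vec_eq_iff)
qed

lemma constant_coeff_zero_iff:
  fixes f :: "('v::finite, 'k::field) mpoly"
  shows "f \<in> ideal_gen (range Var) \<longleftrightarrow> lookup f 0 = 0"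
proof
  let ?P = "\<lambda>m :: 'v \<Rightarrow>\<^sub>0 nat. m \<noteq> 0"
  have "upward ?P" unfolding upward_def by (auto simp: poly_mapping_eq_iff lookup_add fun_eq_iff)
  then have "ideal_gen (range Var) \<subseteq> (monomial_ideal ?P :: ('v, 'k) mpoly set)"
    by (intro ideal_gen_minimal is_ideal_monomial_ideal)
      (auto simp: monomial_ideal_def Var_def poly_mapping_eq_iff lookup_single fun_eq_iff when_def)
  moreover assume "f \<in> ideal_gen (range Var)"
  ultimately have "0 \<notin> keys f" by (auto simp: monomial_ideal_def)
  then show "lookup f 0 = 0" by (simp add: in_keys_iff)
next
  assume f: "lookup f 0 = 0"
  show "f \<in> ideal_gen (range Var)"
  proof (rule monomials_imp_in_ideal[OF is_ideal_ideal_gen])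
    fix m assume "m \<in> keys f"
    then have "m \<noteq> 0" using f by (auto simp: in_keys_iff)
    then obtain x where x: "lookup m x \<noteq> 0" by (metis lookup_zero poly_mapping_eqI)
    have "lookup (Poly_Mapping.single x 1) y \<le> lookup m y" for y
      using x by (auto simp: lookup_single when_def)
    then obtain k where "m = Poly_Mapping.single x 1 + k" using monom_diff_add by blast
    then have "Poly_Mapping.single m 1 = Poly_Mapping.single k 1 * (Var x :: ('v, 'k) mpoly)"
      by (simp add: Var_def mult_single add.commute)
    moreover have "(Var x :: ('v, 'k) mpoly) \<in> ideal_gen (range Var)"
      by (intro subsetD[OF ideal_gen_superset] rangeI)
    ultimately show "(Poly_Mapping.single m 1 :: ('v, 'k) mpoly) \<in> ideal_gen (range Var)"
      by (auto intro: ideal_mult[OF is_ideal_ideal_gen])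
  qed
qed

lemma multigraded_submodule_monomial_ideal:
  assumes up: "upward P"
    and bound: "\<And>M. P M \<Longrightarrow> \<exists>M'. mono_le M' L \<and> mono_le M' M \<and> P M'"
  shows "multigraded_submodule L 1 (\<lambda>_. 0) {v. v 0 \<in> monomial_ideal P \<and> (\<forall>c\<ge>1. v c = (0 :: ('v, 'k::field) mpoly))}"
    (is "multigraded_submodule L 1 _ ?Z")
proof -
  have J: "is_ideal (monomial_ideal P :: ('v, 'k) mpoly set)" by (rule is_ideal_monomial_ideal[OF up])
  have comp: "(\<lambda>c. component M 0 (v c)) \<in> ?Z" if "v \<in> ?Z" for v M
    using that by (auto simp: monomial_ideal_def in_keys_iff lookup_component split: if_splits intro!: poly_mapping_eqI)
  have hom: "\<exists>M' k. \<exists>v'\<in>?Z. mono_le M' L \<and> homogeneous_vec 1 (\<lambda>_. 0) M' v' \<and>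
      v = (\<lambda>c. Poly_Mapping.single k 1 * v' c)" if v: "v \<in> ?Z" and hv: "homogeneous_vec 1 (\<lambda>_. 0) M v" for v M
  proof (cases "v 0 = 0")
    case True
    then have "v = (\<lambda>_. 0)"
    proof -
      have "v c = 0" for c using v True by (cases c) auto
      then show ?thesis by auto
    qed
    then show ?thesis using v
      by (intro exI[of _ 0] bexI[of _ v]) (auto simp: homogeneous_vec_def)
  next
    case False
    have "v 0 = 0 \<or> (\<exists>k c. v 0 = Poly_Mapping.single k c \<and> k + 0 = M)"
      using hv unfolding homogeneous_vec_def by (intro homogeneous_entry_cases) blast
    then obtain a where a: "v 0 = Poly_Mapping.single M a"
      using False by auto
    then have "a \<noteq> 0" using False by auto
    note a = a this
    then have "P M" using v by (auto simp: monomial_ideal_def)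
    then obtain M' where M': "mono_le M' L" "mono_le M' M" "P M'" using bound by blast
    then obtain k where k: "M = M' + k" using monom_diff_add by blast
    define v' where "v' c = (if c = 0 then Poly_Mapping.single M' a else 0)" for c :: nat
    have "v c = Poly_Mapping.single k 1 * v' c" for c
      using v a k by (auto simp: v'_def mult_single add.commute)
    moreover have "v' \<in> ?Z" using M'(3) a(2) by (auto simp: v'_def monomial_ideal_def)
    moreover have "homogeneous_vec 1 (\<lambda>_. 0) M' v'" by (auto simp: homogeneous_vec_def v'_def)
    ultimately show ?thesis using M'(1) by blast
  qed
  have "(\<lambda>c. u c + v c) \<in> ?Z" if "u \<in> ?Z" "v \<in> ?Z" for u v
    using that by (auto intro: ideal_add[OF J])
  moreover have "(\<lambda>c. a * v c) \<in> ?Z" if "v \<in> ?Z" for a v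
    using that by (auto intro: ideal_mult[OF J])
  moreover have "(\<lambda>_. 0) \<in> ?Z" using ideal_zero[OF J] by simp
  ultimately show ?thesis
    unfolding multigraded_submodule_def using comp hom by (intro conjI ballI allI impI) simp_all
qed

lemma mdeg_add: "mdeg (m + k) = mdeg m + mdeg k"
  by (simp add: mdeg_def lookup_add sum.distrib)

text \<open>Dependent choice on triples of rank, degrees and submodule. \<open>Z (Suc i)\<close> is
  the kernel of \<open>A i\<close> and the image of \<open>A (Suc i)\<close>, which is
  exactness.\<close>

lemma ex_multigraded_resolution:
  fixes Z0 :: "(nat \<Rightarrow> ('v::finite, 'k::field) mpoly) set"
  assumes "multigraded_submodule L r0 Ds0 Z0"
  obtains rk Ds Z A where "rk 0 = r0" "Ds 0 = Ds0" "Z 0 = Z0"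
    "\<And>i::nat. syzygy_step L (rk i) (Ds i) (Z i) (rk (Suc i)) (Ds (Suc i)) (A i)"
    "\<And>i. Z (Suc i) = syzygies (rk (Suc i)) (A i)"
proof -
  let ?ms = "\<lambda>s. multigraded_submodule L (fst s) (fst (snd s)) (snd (snd s) :: (nat \<Rightarrow> ('v, 'k) mpoly) set)"
  let ?step = "\<lambda>s s' A. syzygy_step L (fst s) (fst (snd s)) (snd (snd s)) (fst s') (fst (snd s')) A \<and>
      snd (snd s') = syzygies (fst s') (A :: nat \<Rightarrow> nat \<Rightarrow> ('v, 'k) mpoly)"
  have "\<exists>f. \<forall>n. (?ms (f n) \<and> (n = 0 \<longrightarrow> f n = (r0, Ds0, Z0))) \<and> (\<exists>A. ?step (f n) (f (Suc n)) A)"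
  proof (rule dependent_nat_choice)
    show "\<exists>s. ?ms s \<and> (0 = (0::nat) \<longrightarrow> s = (r0, Ds0, Z0))" using assms by simp
  next
    fix s and n :: nat
    assume "?ms s \<and> (n = 0 \<longrightarrow> s = (r0, Ds0, Z0))"
    then obtain r' Ds' A where A: "syzygy_step L (fst s) (fst (snd s)) (snd (snd s)) r' Ds' A"
      using ex_syzygy_step by blast
    then show "\<exists>s'. (?ms s' \<and> (Suc n = 0 \<longrightarrow> s' = (r0, Ds0, Z0))) \<and> (\<exists>A. ?step s s' A)"
      by (intro exI[of _ "(r', Ds', syzygies r' A)"]) (auto intro: multigraded_submodule_syzygies)
  qed
  then obtain f where f0: "f 0 = (r0, Ds0, Z0)" and "\<And>n. \<exists>A. ?step (f n) (f (Suc n)) A" by blast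
  then obtain A where "\<And>n. ?step (f n) (f (Suc n)) (A n)" by metis
  then show ?thesis
    using that[of "\<lambda>n. fst (f n)" "\<lambda>n. fst (snd (f n))" "\<lambda>n. snd (snd (f n))" A] f0 by auto
qed

lemma ex_minimal_graded_free_resolution:
  fixes P :: "('v::finite \<Rightarrow>\<^sub>0 nat) \<Rightarrow> bool"
  assumes up: "upward P"
    and bound: "\<And>M. P M \<Longrightarrow> \<exists>M'. mono_le M' L \<and> mono_le M' M \<and> P M'"
  shows "\<exists>d \<phi>. minimal_graded_free_resolution (monomial_ideal P :: ('v, 'k::field) mpoly set) d \<phi>"
proof -
  let ?I = "monomial_ideal P :: ('v, 'k) mpoly set"
  obtain rk Ds Z and A :: "nat \<Rightarrow> nat \<Rightarrow> nat \<Rightarrow> ('v, 'k) mpoly" where init: "rk 0 = 1" "Ds 0 = (\<lambda>_. 0)"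
      "Z 0 = {v. v 0 \<in> ?I \<and> (\<forall>c\<ge>1. v c = 0)}"
    and step: "\<And>i::nat. syzygy_step L (rk i) (Ds i) (Z i) (rk (Suc i)) (Ds (Suc i)) (A i)"
    and Z: "\<And>i. Z (Suc i) = syzygies (rk (Suc i)) (A i)"
    by (rule ex_multigraded_resolution[OF multigraded_submodule_monomial_ideal[OF up]])
      (erule bound, rule that)
  \<comment> \<open>The locale-style complex starts with the ring itself, so F_i is the free module
    of rank \<open>rk (Suc i)\<close>.\<close>
  define d where "d i = map (\<lambda>c. mdeg (Ds (Suc i) c)) [0..<rk (Suc i)]" for i
  define \<phi> where "\<phi> i = mat (rk i) (rk (Suc i)) (\<lambda>(r, c). A i r c)" for i
  have len: "length (d i) = rk (Suc i)" for i by (simp add: d_def)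
  have \<phi>: "\<phi> i \<in> carrier_mat (rk i) (rk (Suc i))" "\<And>r c. r < rk i \<Longrightarrow> c < rk (Suc i) \<Longrightarrow> \<phi> i $$ (r, c) = A i r c" for i
    by (simp_all add: \<phi>_def)
  have hom: "m + Ds i r = Ds (Suc i) c" if "m \<in> keys (A i r c)" for i r c m
    using step[of i] that by (auto simp: syzygy_step_def homogeneous_vec_def)
  have outside: "A i r c = 0" if "rk i \<le> r" for i r c
    using step[of i] that by (auto simp: syzygy_step_def homogeneous_vec_def)
  have rangeZ: "Z i = range (mat_app (A i) (rk (Suc i)))" for i
    using step[of i] by (simp add: syzygy_step_def)
  have min: "lookup (v c) 0 = 0" if "v \<in> Z (Suc i)" "c < rk (Suc i)" for v c i
    using step[of i] that by (simp add: syzygy_step_def Z syzygies_def)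
  define ext where "ext n v c = (if c < n then v $ c else 0)" for n and v :: "('v, 'k) mpoly vec" and c
  have image: "v \<in> mat_image (\<phi> i) \<longleftrightarrow> v \<in> carrier_vec (rk i) \<and> ext (rk i) v \<in> Z i" for v i
  proof -
    have "ext (rk i) v \<in> Z i \<longleftrightarrow> (\<exists>u. \<forall>r<rk i. v $ r = mat_app (A i) (rk (Suc i)) u r)"
    proof -
      have "ext (rk i) v = mat_app (A i) (rk (Suc i)) u \<longleftrightarrow> (\<forall>r<rk i. v $ r = mat_app (A i) (rk (Suc i)) u r)" for u
        using outside by (auto simp: ext_def fun_eq_iff mat_app_def not_less)
      then show ?thesis unfolding rangeZ by auto
    qed
    moreover have "v \<in> mat_image (\<phi> i) \<longleftrightarrow>
        v \<in> carrier_vec (rk i) \<and> (\<exists>u. \<forall>r<rk i. v $ r = mat_app (A i) (rk (Suc i)) u r)"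
      by (rule mat_image_iff[OF \<phi>])
    ultimately show ?thesis by simp
  qed
  have kernel: "v \<in> mat_kernel (\<phi> i) \<longleftrightarrow> v \<in> carrier_vec (rk (Suc i)) \<and> ext (rk (Suc i)) v \<in> Z (Suc i)" for v i
  proof -
    have app: "mat_app (A i) (rk (Suc i)) (ext (rk (Suc i)) v) r = mat_app (A i) (rk (Suc i)) (\<lambda>c. v $ c) r" for r
      by (rule mat_app_cong) (simp add: ext_def)
    have zero: "mat_app (A i) (rk (Suc i)) u r = 0" if "rk i \<le> r" for u r
      using outside[OF that] by (simp add: mat_app_def)
    have "ext (rk (Suc i)) v \<in> Z (Suc i) \<longleftrightarrow> (\<forall>r<rk i. mat_app (A i) (rk (Suc i)) (\<lambda>c. v $ c) r = 0)"
      unfolding Z syzygies_def using zero by (auto simp: app ext_def not_less) (meson not_le_imp_less)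
    moreover have "v \<in> mat_kernel (\<phi> i) \<longleftrightarrow>
        v \<in> carrier_vec (rk (Suc i)) \<and> (\<forall>r<rk i. mat_app (A i) (rk (Suc i)) (\<lambda>c. v $ c) r = 0)"
      by (rule mat_kernel_iff[OF \<phi>])
    ultimately show ?thesis by simp
  qed
  have image0: "mat_image (\<phi> 0) = {vec 1 (\<lambda>_. f) | f. f \<in> ?I}"
  proof (rule Set.set_eqI, rule iffI)
    fix v assume "v \<in> mat_image (\<phi> 0)"
    then have v: "v \<in> carrier_vec 1" "v $ 0 \<in> ?I" using image[of v 0] init by (auto simp: ext_def)
    then have "v = vec 1 (\<lambda>_. v $ 0)" by (intro eq_vecI) auto
    then show "v \<in> {vec 1 (\<lambda>_. f) | f. f \<in> ?I}" using v(2) by blast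
  next
    fix v assume "v \<in> {vec 1 (\<lambda>_. f) | f. f \<in> ?I}"
    then show "v \<in> mat_image (\<phi> 0)" using image[of v 0] init by (auto simp: ext_def)
  qed
  \<comment> \<open>A column is the image of a unit vector, hence a relation of the previous step,
    and such relations have no constant terms.\<close>
  have entries: "A (Suc i) r c \<in> ideal_gen (range Var)" if rc: "r < rk (Suc i)" "c < rk (Suc (Suc i))" for i r c
  proof -
    have "mat_app (A (Suc i)) (rk (Suc (Suc i))) (\<lambda>x. if x = c then 1 else 0) = (\<lambda>r. A (Suc i) r c)"
      using rc(2) by (auto simp: mat_app_def if_distrib[of "\<lambda>a. _ * a"] cong: if_cong)
    then have "(\<lambda>r. A (Suc i) r c) \<in> Z (Suc i)" unfolding rangeZ by (metis rangeI)
    then show ?thesis using min[OF _ rc(1)] by (simp add: constant_coeff_zero_iff)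
  qed
  have "minimal_graded_free_resolution ?I d \<phi>"
    unfolding minimal_graded_free_resolution_def
  proof (intro conjI allI impI ballI)
    show "\<phi> 0 \<in> carrier_mat 1 (length (d 0))" using \<phi>(1)[of 0] by (simp add: len init)
    show "\<phi> (Suc i) \<in> carrier_mat (length (d i)) (length (d (Suc i)))" for i
      using \<phi>(1)[of "Suc i"] by (simp add: len)
    show "mdeg m = d 0 ! c" if "c < length (d 0)" "m \<in> keys (\<phi> 0 $$ (0, c))" for c m
      using that hom[of m 0 0 c] by (simp add: len \<phi>(2) init d_def)
    show "mdeg m + d i ! r = d (Suc i) ! c"
      if "r < length (d i)" "c < length (d (Suc i))" "m \<in> keys (\<phi> (Suc i) $$ (r, c))" for i r c m
      using that hom[of m "Suc i" r c] by (simp add: len \<phi>(2) d_def flip: mdeg_add)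
    show "mat_image (\<phi> 0) = {vec 1 (\<lambda>_. f) | f. f \<in> ?I}" by (rule image0)
    show "mat_image (\<phi> (Suc i)) = mat_kernel (\<phi> i)" for i
      using image[of _ "Suc i"] kernel[of _ i] by blast
    show "elements_mat (\<phi> (Suc i)) \<subseteq> ideal_gen (range Var)" for i
      using \<phi>(1)[of "Suc i"] \<phi>(2) entries by (auto simp: elements_mat_def)
  qed
  then show ?thesis by blast
qed

text \<open>Rank 1 is put in front to resolve the quotient by I. Entries outside the matrix
  dimensions are set to 0 because matrix access there is unspecified.\<close>

lemma resolution_of_matrices:
  fixes I :: "('v::finite, 'k::field) mpoly set"
  assumes res: "minimal_graded_free_resolution I d \<phi>"
  defines "rk \<equiv> \<lambda>i. case i of 0 \<Rightarrow> 1 | Suc j \<Rightarrow> length (d j)"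
  defines "A \<equiv> \<lambda>i r c. if r < rk i \<and> c < rk (Suc i) then \<phi> i $$ (r, c) else 0"
  shows "resolution rk A I" "lookup (A (Suc i) r c) 0 = 0"
proof -
  have \<phi>: "\<phi> i \<in> carrier_mat (rk i) (rk (Suc i))" for i
    using res by (cases i) (auto simp: minimal_graded_free_resolution_def rk_def)
  have A: "\<phi> i $$ (r, c) = A i r c" if "r < rk i" "c < rk (Suc i)" for i r c
    using that by (simp add: A_def)
  have im0: "mat_image (\<phi> 0) = {vec 1 (\<lambda>_. f) | f. f \<in> I}"
    and ex: "mat_image (\<phi> (Suc i)) = mat_kernel (\<phi> i)"
    and min: "elements_mat (\<phi> (Suc i)) \<subseteq> ideal_gen (range Var)" for i
    using res by (auto simp: minimal_graded_free_resolution_def)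
  have image: "v \<in> mat_image (\<phi> i) \<longleftrightarrow>
      v \<in> carrier_vec (rk i) \<and> (\<exists>u. \<forall>r<rk i. v $ r = mat_app (A i) (rk (Suc i)) u r)" for v i
    by (rule mat_image_iff[OF \<phi> A])
  have kernel: "v \<in> mat_kernel (\<phi> i) \<longleftrightarrow>
      v \<in> carrier_vec (rk (Suc i)) \<and> (\<forall>r<rk i. mat_app (A i) (rk (Suc i)) (\<lambda>c. v $ c) r = 0)" for v i
    by (rule mat_kernel_iff[OF \<phi> A])
  show "resolution rk A I"
  proof
    show out: "A i r c = 0" if "rk i \<le> r" for i r c using that by (simp add: A_def)
    have zero: "mat_app (A i) n u r = 0" if "rk i \<le> r" for i n u r
      using out[OF that] by (simp add: mat_app_def)
    show rk0: "rk 0 = 1" by (simp add: rk_def)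
    show "f \<in> I \<longleftrightarrow> (\<exists>u. f = mat_app (A 0) (rk 1) u 0)" for f
    proof -
      have "f \<in> I \<longleftrightarrow> vec 1 (\<lambda>_. f) \<in> mat_image (\<phi> 0)"
        unfolding im0 by (auto dest: arg_cong[of _ _ "\<lambda>v. v $ 0"])
      then show ?thesis using image[of "vec 1 (\<lambda>_. f)" 0] by (simp add: rk0)
    qed
    show "mat_app (A i) (rk (Suc i)) (mat_app (A (Suc i)) (rk (Suc (Suc i))) u) r = 0" for i u r
    proof (cases "r < rk i")
      case True
      let ?v = "vec (rk (Suc i)) (mat_app (A (Suc i)) (rk (Suc (Suc i))) u)"
      have "?v \<in> mat_image (\<phi> (Suc i))" unfolding image by auto
      then have "mat_app (A i) (rk (Suc i)) (\<lambda>c. ?v $ c) r = 0"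
        using kernel[of ?v i] True unfolding ex by blast
      moreover have "mat_app (A i) (rk (Suc i)) (\<lambda>c. ?v $ c) r =
          mat_app (A i) (rk (Suc i)) (mat_app (A (Suc i)) (rk (Suc (Suc i))) u) r"
        by (rule mat_app_cong) simp
      ultimately show ?thesis by simp
    qed (simp add: zero)
    show "\<exists>u. \<forall>c<rk (Suc i). v c = mat_app (A (Suc i)) (rk (Suc (Suc i))) u c"
      if v: "\<And>r. mat_app (A i) (rk (Suc i)) v r = 0" for i v
    proof -
      let ?v = "vec (rk (Suc i)) v"
      have "mat_app (A i) (rk (Suc i)) (\<lambda>c. ?v $ c) r = mat_app (A i) (rk (Suc i)) v r" for r
        by (rule mat_app_cong) simp
      then have "?v \<in> mat_kernel (\<phi> i)" unfolding kernel using v by simp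
      then have "?v \<in> mat_image (\<phi> (Suc i))" unfolding ex .
      then show ?thesis unfolding image by auto
    qed
  qed
  show "lookup (A (Suc i) r c) 0 = 0"
  proof (cases "r < rk (Suc i) \<and> c < rk (Suc (Suc i))")
    case True
    then have "\<phi> (Suc i) $$ (r, c) \<in> ideal_gen (range Var)"
      by (intro subsetD[OF min] elements_matI[OF \<phi>]) simp_all
    then show ?thesis using True by (simp add: A_def constant_coeff_zero_iff)
  qed (auto simp: A_def)
qed

lemma pd_eqI:
  assumes ex: "\<exists>d \<phi>. minimal_graded_free_resolution I d \<phi>"
    and zero: "\<And>d \<phi> i. minimal_graded_free_resolution I d \<phi> \<Longrightarrow> n < i \<Longrightarrow> d i = []"
    and nonzero: "\<And>d \<phi>. minimal_graded_free_resolution I d \<phi> \<Longrightarrow> d n \<noteq> []"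
  shows "pd I = n"
proof -
  define d where "d = (SOME d. \<exists>\<phi>. minimal_graded_free_resolution I d \<phi>)"
  have "\<exists>\<phi>. minimal_graded_free_resolution I d \<phi>"
    unfolding d_def using ex by (rule someI_ex)
  then have d: "\<And>i. n < i \<Longrightarrow> d i = []" "d n \<noteq> []"
    using zero nonzero by blast+
  have "{i. \<exists>j. graded_betti I i j \<noteq> 0} = {i. d i \<noteq> []}"
    by (auto simp: graded_betti_def d_def[symmetric] count_list_0_iff intro: list.set_intros)
      (metis hd_in_set)
  moreover have "Max {i. d i \<noteq> []} = n"
  proof (rule Max_eqI)
    have "{i. d i \<noteq> []} \<subseteq> {..n}" using d(1) by (auto simp: not_less[symmetric])
    then show "finite {i. d i \<noteq> []}" by (rule finite_subset) simp
    show "i \<le> n" if "i \<in> {i. d i \<noteq> []}" for i using that d(1) by (auto simp: not_less[symmetric])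
  qed (use d(2) in simp)
  ultimately show ?thesis by (simp add: pd_def)
qed

theorem theorem1p2:
  fixes E :: "('v::finite \<times> 'v) set" and w :: "'v \<Rightarrow> nat" and t :: nat
  assumes "vertex_weighted_oriented_graph UNIV E w"
    and "rooted_forest UNIV E"
    and "\<And>x. vdegree E x \<noteq> 1 \<Longrightarrow> w x \<ge> 2"
    and "t \<ge> 1"
  shows "int (pd (ideal_power (edge_ideal E w :: ('v, 'k::field) mpoly set) t)) = int (card E) - 1"
proof -
  obtain A q ch h where forest: "weighted_forest A q ch w h" and E: "E = (\<lambda>v. (q v, v)) ` A"
    using weighted_forest_exists[OF assms(1-3)] by blast
  interpret weighted_forest A q ch w h by (rule forest)
  let ?I = "power_ideal t :: ('v, 'k) mpoly set"
  have I: "ideal_power (edge_ideal E w) t = ?I"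
    unfolding power_ideal_def by (rule ideal_power_edge_ideal[OF E])
  have cardE: "card E = card A" unfolding E by (intro card_image inj_onI) simp
  have "A \<noteq> {}" using child(1) by auto
  then have pos: "card A \<ge> 1" by (simp add: card_gt_0_iff Suc_le_eq)
  have ex: "\<exists>d \<phi>. minimal_graded_free_resolution ?I d \<phi>"
    unfolding power_ideal_def
  proof (rule ex_minimal_graded_free_resolution[OF upward_in_power])
    fix M :: "'v \<Rightarrow>\<^sub>0 nat" assume "in_power A q w t (lookup M)"
    then obtain a where a: "sum a A = t" "\<And>x. usage A q w a x \<le> lookup M x"
      unfolding in_power_def by blast
    \<comment> \<open>A product of t generators takes each at most t times, so it divides the
      product of all their t-th powers, which serves as L.\<close>
    have "a v \<le> t" if "v \<in> A" for v
      using member_le_sum[of v A a] that a(1) by simp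
    then have "usage A q w a x \<le> usage A q w (\<lambda>_. t) x" for x
      unfolding usage_def by (intro sum_mono mult_le_mono1)
    moreover have "in_power A q w t (usage A q w a)"
      using a(1) unfolding in_power_def by blast
    ultimately show "\<exists>M'. mono_le M' (monomial_of (usage A q w (\<lambda>_. t))) \<and> mono_le M' M \<and> in_power A q w t (lookup M')"
      using a(2) by (intro exI[of _ "monomial_of (usage A q w a)"]) simp
  qed
  have "pd ?I = card A - 1"
  proof (rule pd_eqI[OF ex])
    fix d \<phi>
    assume res: "minimal_graded_free_resolution ?I d \<phi>"
    define rk where "rk = (\<lambda>i. case i of 0 \<Rightarrow> 1 | Suc j \<Rightarrow> length (d j))"
    define M where "M = (\<lambda>i r c. if r < rk i \<and> c < rk (Suc i) then \<phi> i $$ (r, c) else 0)"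
    note mats = resolution_of_matrices(1)[OF res, folded rk_def, folded M_def]
    interpret forest_resolution A q ch w h rk t M
      by (intro forest_resolution.intro forest mats)
    have minimal: "lookup (M (Suc i) r c) 0 = 0" for i r c
      using resolution_of_matrices(2)[OF res, where i = i and r = r and c = c] unfolding M_def rk_def .
    have len: "rk (Suc i) = length (d i)" for i by (simp add: rk_def)
    \<comment> \<open>\<open>d i\<close> has length \<open>rk (Suc i)\<close>, and i > |A| - 1 means
      i >= |A| >= 1, as \<open>rank_upper\<close> asks.\<close>
    show "d i = []" if "card A - 1 < i" for i
      using rank_upper[OF minimal, of i] that pos len[of i] by simp
    show "d (card A - 1) \<noteq> []"
      using rank_lower[OF assms(4)] len[of "card A - 1"] pos by auto
  qed
  then show ?thesis using pos by (simp add: I cardE)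
qed

end
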